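(* Let $n\ge 1$ and $0<\alpha<2$. Assume that $u\in L_\alpha$ is $\alpha$-harmonic in $\mathbb{R}^n$ and that $$\liminf_{|x|\to\infty}\frac{u(x)}{|x|^{\gamma}}\ \ge\ 0$$ for some real number $\gamma$ with $0\le\gamma\le 1$ and $\gamma<\alpha$. Then $u$ is constant: there is $C\in\mathbb{R}$ with $u(x)\equiv C$ for $x\in\mathbb{R}^n$.
   Context: $L_\alpha$ denotes the space of (measurable) functions $u:\mathbb{R}^n\to\mathbb{R}$ such that $\int_{\mathbb{R}^n}\frac{|u(x)|}{1+|x|^{n+\alpha}}\,dx<\infty$; functions in $L_\alpha$ that agree almost everywhere are identified. For $\phi$ in the Schwartz space $\mathcal{S}(\mathbb{R}^n)$ the fractional Laplacian is $$(-\Delta)^{\alpha/2}\phi(x)=C_{n,\alpha}\lim_{\epsilon\to0}\int_{\mathbb{R}^n\setminus B_\epsilon(x)}\frac{\phi(x)-\phi(z)}{|x-z|^{n+\alpha}}\,dz,$$ where $C_{n,\alpha}>0$ is the normalizing constant for which, equivalently, $\mathcal{F}((-\Delta)^{\alpha/2}\phi)(\xi)=|\xi|^\alpha\mathcal{F}\phi(\xi)$, with $\mathcal{F}$ the Fourier transform. A function $u$ is called $\alpha$-harmonic (in $\mathbb{R}^n$) if $u\in L_\alpha$ and $(-\Delta)^{\alpha/2}u=0$ in the sense of distributions, i.e. $\int_{\mathbb{R}^n}u(x)\,(-\Delta)^{\alpha/2}\phi(x)\,dx=0$ for all $\phi\in C_0^\infty(\mathbb{R}^n)$ (smooth functions with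 compact support). *)

theory Defs
  imports "HOL-Analysis.Analysis"
begin

definition partial :: "'n \<Rightarrow> (real ^ 'n::finite \<Rightarrow> real) \<Rightarrow> real ^ 'n \<Rightarrow> real" where
  "partial i f x = frechet_derivative f (at x) (axis i 1)"

text \<open>A multi-index is represented by a list of coordinate directions, taken in any order:
  \<open>partials [i, j, k] f\<close> is the derivative of \<open>f\<close> along \<open>k\<close>, then \<open>j\<close>, then \<open>i\<close>.\<close>

definition partials :: "'n list \<Rightarrow> (real ^ 'n::finite \<Rightarrow> real) \<Rightarrow> real ^ 'n \<Rightarrow> real" where
  "partials is f = foldr partial is f"

definition smooth :: "(real ^ 'n::finite \<Rightarrow> real) \<Rightarrow> bool" where
  "smooth f \<longleftrightarrow> (\<forall>is. partials is f differentiable_on UNIV)"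

definition schwartz :: "(real ^ 'n::finite \<Rightarrow> real) set" where
  "schwartz = {f. smooth f \<and> (\<forall>k is. bounded (range (\<lambda>x. norm x ^ k * partials is f x)))}"

definition test_functions :: "(real ^ 'n::finite \<Rightarrow> real) set" where
  "test_functions = {f. smooth f \<and> compact (closure {x. f x \<noteq> 0})}"

text \<open>The convention without \<open>2\<pi>\<close> in the exponent is the one for which the symbol of the
  fractional Laplacian is \<open>|\<xi>|\<^sup>\<alpha>\<close>; a constant prefactor would not affect anything below.\<close>

definition fourier :: "(real ^ 'n::finite \<Rightarrow> real) \<Rightarrow> real ^ 'n \<Rightarrow> complex" where
  "fourier f \<xi> = (LINT x|lebesgue. complex_of_real (f x) * cis (- (x \<bullet> \<xi>)))"

definition pv_integral :: "real \<Rightarrow> (real ^ 'n::finite \<Rightarrow> real) \<Rightarrow> real ^ 'n \<Rightarrow> real" where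
  "pv_integral \<alpha> \<phi> x =
     Lim (at_right 0) (\<lambda>\<epsilon>. LINT z:(UNIV - ball x \<epsilon>)|lebesgue.
       (\<phi> x - \<phi> z) / norm (x - z) powr (real CARD('n) + \<alpha>))"

definition frac_const :: "'n::finite itself \<Rightarrow> real \<Rightarrow> real" where
  "frac_const _ \<alpha> = (THE C. C > 0 \<and>
     (\<forall>\<phi> \<in> (schwartz :: (real ^ 'n \<Rightarrow> real) set). \<forall>\<xi>.
        fourier (\<lambda>x. C * pv_integral \<alpha> \<phi> x) \<xi> = norm \<xi> powr \<alpha> * fourier \<phi> \<xi>))"

definition frac_laplacian :: "real \<Rightarrow> (real ^ 'n::finite \<Rightarrow> real) \<Rightarrow> real ^ 'n \<Rightarrow> real" where
  "frac_laplacian \<alpha> \<phi> x = frac_const TYPE('n) \<alpha> * pv_integral \<alpha> \<phi> x"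

definition L_space :: "real \<Rightarrow> (real ^ 'n::finite \<Rightarrow> real) set" where
  "L_space \<alpha> = {u \<in> borel_measurable lebesgue.
     integrable lebesgue (\<lambda>x. \<bar>u x\<bar> / (1 + norm x powr (real CARD('n) + \<alpha>)))}"

definition alpha_harmonic :: "real \<Rightarrow> (real ^ 'n::finite \<Rightarrow> real) \<Rightarrow> bool" where
  "alpha_harmonic \<alpha> u \<longleftrightarrow> u \<in> L_space \<alpha> \<and>
     (\<forall>\<phi> \<in> test_functions. (LINT x|lebesgue. u x * frac_laplacian \<alpha> \<phi> x) = 0)"

text \<open>Elements of \<^const>\<open>L_space\<close> are functions considered up to equality almost everywhere, so
  the lower limit at infinity has to ignore null sets: it is the supremum over \<open>R\<close> of the
  essential infimum over \<open>|x| > R\<close>. It is never smaller than the pointwise lower limit.\<close>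

definition ess_liminf_at_infinity :: "(real ^ 'n::finite \<Rightarrow> real) \<Rightarrow> ereal" where
  "ess_liminf_at_infinity f = Liminf (inf at_infinity (ae_filter lebesgue)) (\<lambda>x. ereal (f x))"

end

theory Submission
  imports Defs "HOL-Probability.Probability"
begin

text \<open>Formally, an \<alpha>-harmonic \<open>u\<close> satisfies \<open>|\<xi>|\<^sup>\<alpha> \<cdot> F u = 0\<close>, so its Fourier transform
is supported at the origin and \<open>u\<close> is a polynomial; membership in \<open>L\<^sub>\<alpha>\<close> with \<open>\<alpha> < 2\<close> leaves only
polynomials of degree at most one, and the one-sided growth condition with \<open>\<gamma> \<le> 1\<close> removes the
linear part. The proof below makes this idea elementary: the pairing with
functions whose Fourier transform avoids the origin is replaced by explicit computations with the
heat kernel \<open>G\<^sub>t\<close>, whose Fourier transform is \<open>exp (- t |\<xi>|\<^sup>2)\<close>.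

\<^item> The second difference in time, \<open>g = G\<^sub>s - 2 G\<^sub>m + G\<^sub>t\<close> with \<open>m = (s + t) / 2\<close>, has a Fourier
  transform that vanishes to order four at the origin. Division by \<open>|\<xi>|\<^sup>\<alpha>\<close> is therefore harmless:
  \<open>g\<close> is the fractional Laplacian of a Riesz potential \<open>f\<close>, and \<open>f\<close> decays at least like
  \<open>|x|\<close> to the power \<open>- n - \<alpha>\<close>. This decay is that of the fractional Laplacian of a bump function
  \<open>\<phi>\<close>, and so Fubini's theorem applies to the pairing of \<open>u\<close> with \<open>f * (-\<Delta>)\<^sup>\<alpha>\<^sup>/\<^sup>2 \<phi>\<close>, which is
  \<open>g * \<phi>\<close>. As \<open>u\<close> annihilates the fractional Laplacians of all translates of \<open>\<phi>\<close>, it annihilates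
  \<open>g * \<phi>\<close>, and \<open>g\<close> itself when \<open>\<phi>\<close> shrinks to a point mass (\<open>harmonic_annihilates\<close>).

\<^item> Hence \<open>U(t, a) = \<integral> u(x) G\<^sub>t(a - x) dx\<close> is midpoint-affine in \<open>t\<close>. It grows at most like
  \<open>t\<close> to the power \<open>\<alpha> / 2 < 1\<close>, so it does not depend on \<open>t\<close> (\<open>heat_flow_constant\<close>).

\<^item> Second differences of \<open>U(t, a)\<close> in \<open>a\<close> gain a factor \<open>1 / t\<close>, hence tend to zero as \<open>t\<close> grows;
  being independent of \<open>t\<close> they vanish, and \<open>U\<close> is affine in \<open>a\<close> (\<open>heat_flow_affine\<close>).

\<^item> As \<open>t\<close> tends to zero, \<open>U(t, a)\<close> tends to \<open>u\<close> weakly, so \<open>u\<close> agrees almost everywhere with a continuous affine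
  function (\<open>weakly_harmonic_eq_heat_flow\<close>). Along a ray on which this function decreases
  it would fall below \<open>- \<epsilon> |x|\<close> for small \<open>\<epsilon>\<close>, which \<open>\<gamma> \<le> 1\<close> forbids (\<open>affine_sublinear_below_constant\<close>).

None of this says anything about \<open>u\<close> unless the normalizing constant of the fractional Laplacian is
known to be nonzero. It is defined by a Fourier identity for Schwartz functions, so this identity has to be proved first
(\<open>frac_const_pos\<close>). Its core is \<open>\<integral> (1 - cos (\<xi> \<bullet> y)) / |y|\<^sup>n\<^sup>+\<^sup>\<alpha> dy = \<kappa> |\<xi>|\<^sup>\<alpha>\<close>
(\<open>fractional_symbol\<close>). Here and for all other power weights, \<open>|y|\<close> to a negative power is written as a
superposition of Gaussians in \<open>y\<close> (\<open>nn_integral_subordination\<close>); all \<open>n\<close>-dimensional integrals then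
reduce to the Gaussian one.\<close>

section \<open>Gaussian integrals and subordination\<close>

lemma lborel_prod_coordinates:
  fixes f :: "'a::euclidean_space \<Rightarrow> real \<Rightarrow> complex"
  assumes int: "\<And>b. b \<in> Basis \<Longrightarrow> integrable lborel (f b)"
  shows "integrable lborel (\<lambda>x. \<Prod>b\<in>Basis. f b (x \<bullet> b))"
    and "(\<integral>x. (\<Prod>b\<in>Basis. f b (x \<bullet> b)) \<partial>lborel) = (\<Prod>b\<in>Basis. \<integral>s. f b s \<partial>lborel)"
proof -
  interpret product_sigma_finite "\<lambda>_::'a. lborel :: real measure"
    by standard
  have [measurable]: "f b \<in> borel_measurable borel" if "b \<in> Basis" for b
    using int[OF that] by (auto dest: borel_measurable_integrable)
  have meas: "(\<lambda>x. \<Prod>b\<in>Basis. f b (x \<bullet> b)) \<in> borel_measurable borel"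
    by measurable
  have T: "(\<lambda>f. \<Sum>b\<in>Basis. f b *\<^sub>R b) \<in> (\<Pi>\<^sub>M b\<in>(Basis::'a set). lborel) \<rightarrow>\<^sub>M borel"
    by measurable
  have eq: "(\<Prod>b\<in>Basis. f b ((\<Sum>c\<in>Basis. g c *\<^sub>R c) \<bullet> b)) = (\<Prod>b\<in>Basis. f b (g b))" for g
    by (intro prod.cong refl) (simp add: inner_sum_left inner_Basis if_distrib cong: if_cong)
  show "integrable lborel (\<lambda>x. \<Prod>b\<in>Basis. f b (x \<bullet> b))"
    by (subst lborel_eq, subst integrable_distr_eq[OF T meas])
       (simp add: eq product_integrable_prod int)
  show "(\<integral>x. (\<Prod>b\<in>Basis. f b (x \<bullet> b)) \<partial>lborel) = (\<Prod>b\<in>Basis. \<integral>s. f b s \<partial>lborel)"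
    by (subst lborel_eq, subst integral_distr[OF T meas])
       (simp add: eq product_integral_prod int)
qed

text \<open>The characteristic function of the standard normal distribution, after the substitution that turns
\<open>x\<^sup>2 / 2\<close> into \<open>t s\<^sup>2\<close>.\<close>

lemma gaussian_fourier_real:
  fixes a t :: real
  assumes t: "0 < t"
  shows "has_bochner_integral lborel (\<lambda>s. of_real (exp (- (t * s\<^sup>2))) * cis (a * s))
           (of_real (sqrt (pi / t) * exp (- (a\<^sup>2 / (4 * t)))))"
proof -
  define c where "c = sqrt (2 * t)"
  have c: "c > 0" "c\<^sup>2 = 2 * t" using t by (auto simp: c_def)
  \<comment> \<open>The character \<open>a s\<close> reads \<open>b x\<close> in the variable \<open>x = c s\<close>.\<close>
  define b where "b = a / c"
  have 1: "integrable std_normal_distribution (\<lambda>x. iexp (b * x))"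
    using prob_space.integrable_iexp[OF prob_space_normal_density[of 1 0]]
    by simp
  have 2: "(CLINT x|std_normal_distribution. iexp (b * x)) = of_real (exp (- b\<^sup>2 / 2))"
    using char_std_normal_distribution unfolding char_def by (metis (no_types))
  have "has_bochner_integral std_normal_distribution (\<lambda>x. iexp (b * x)) (of_real (exp (- b\<^sup>2 / 2)))"
    using 1 2 by (simp add: has_bochner_integral_iff)
  then have "has_bochner_integral lborel (\<lambda>x. std_normal_density x *\<^sub>R iexp (b * x)) (of_real (exp (- b\<^sup>2 / 2)))"
    by (simp add: has_bochner_integral_iff integrable_density integral_density del: of_real_mult)
  then have "has_bochner_integral lborel (\<lambda>x. std_normal_density (0 + c * x) *\<^sub>R iexp (b * (0 + c * x)))
     (of_real (exp (- b\<^sup>2 / 2)) /\<^sub>R \<bar>c\<bar>)"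
    using c(1) by (subst (asm) lborel_has_bochner_integral_real_affine_iff[where c=c and t=0]) auto
  then have "has_bochner_integral lborel (\<lambda>x. sqrt (2 * pi) *\<^sub>R (std_normal_density (0 + c * x) *\<^sub>R iexp (b * (0 + c * x))))
     (sqrt (2 * pi) *\<^sub>R (of_real (exp (- b\<^sup>2 / 2)) /\<^sub>R \<bar>c\<bar>))"
    by (rule has_bochner_integral_scaleR_right)
  moreover have "sqrt (2 * pi) *\<^sub>R (std_normal_density (0 + c * x) *\<^sub>R iexp (b * (0 + c * x))) =
      of_real (exp (- (t * x\<^sup>2))) * cis (a * x)" for x
  proof -
    have "b * (c * x) = a * x" using c by (simp add: b_def)
    then have "iexp (b * (0 + c * x)) = cis (a * x)"
      by (simp only: add_0 cis_conv_exp)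
    moreover have "(c * x)\<^sup>2 / 2 = t * x\<^sup>2" using c(2) by (simp add: power_mult_distrib)
    ultimately show ?thesis
      by (simp add: normal_density_def scaleR_conv_of_real real_sqrt_mult del: of_real_mult)
  qed
  moreover have "sqrt (2 * pi) *\<^sub>R (of_real (exp (- b\<^sup>2 / 2)) /\<^sub>R \<bar>c\<bar>) =
     (of_real (sqrt (pi / t) * exp (- (a\<^sup>2 / (4 * t)))) :: complex)"
  proof -
    have "b\<^sup>2 / 2 = a\<^sup>2 / (4 * t)" using c(2) by (simp add: b_def power_divide)
    moreover have "sqrt (2 * pi) / c = sqrt (pi / t)"
      using t by (simp add: c_def real_sqrt_divide[symmetric])
    ultimately show ?thesis using c(1)
      by (simp add: scaleR_conv_of_real field_simps flip: of_real_mult of_real_divide of_real_inverse)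
  qed
  ultimately show ?thesis by simp
qed

text \<open>Both the Gaussian and the character are products over the coordinates.\<close>

lemma gaussian_fourier:
  fixes x :: "real ^ 'n" and t :: real
  assumes t: "0 < t"
  shows "has_bochner_integral lborel (\<lambda>\<xi>. of_real (exp (- (t * (norm \<xi>)\<^sup>2))) * cis (x \<bullet> \<xi>))
           (of_real ((pi / t) powr (real CARD('n) / 2) * exp (- ((norm x)\<^sup>2 / (4 * t)))))"
proof -
  define f where "f b s = of_real (exp (- (t * s\<^sup>2))) * cis ((x \<bullet> b) * s)" for b :: "real ^ 'n" and s
  have f: "integrable lborel (f b)"
    "(\<integral>s. f b s \<partial>lborel) = of_real (sqrt (pi / t) * exp (- ((x \<bullet> b)\<^sup>2 / (4 * t))))" for b
    using gaussian_fourier_real[OF t, of "x \<bullet> b"] unfolding f_def[abs_def]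
    by (auto simp: has_bochner_integral_iff)
  have sq: "(norm y)\<^sup>2 = (\<Sum>b\<in>Basis. (y \<bullet> b)\<^sup>2)" for y :: "real ^ 'n"
    unfolding power2_norm_eq_inner by (subst euclidean_inner) (simp add: power2_eq_square)
  have "(\<Prod>b\<in>Basis. f b (\<xi> \<bullet> b)) = of_real (exp (- (t * (norm \<xi>)\<^sup>2))) * cis (x \<bullet> \<xi>)" for \<xi>
  proof -
    have "(\<Prod>b\<in>Basis. f b (\<xi> \<bullet> b)) =
       of_real (\<Prod>b\<in>Basis. exp (- (t * (\<xi> \<bullet> b)\<^sup>2))) * (\<Prod>b\<in>Basis. cis ((x \<bullet> b) * (\<xi> \<bullet> b)))"
      by (simp add: f_def prod.distrib)
    also have "(\<Prod>b\<in>Basis. exp (- (t * (\<xi> \<bullet> b)\<^sup>2))) = exp (- (t * (norm \<xi>)\<^sup>2))"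
      by (simp add: sq sum_distrib_left sum_negf flip: exp_sum)
    also have "(\<Prod>b\<in>Basis. cis ((x \<bullet> b) * (\<xi> \<bullet> b))) = cis (x \<bullet> \<xi>)"
      by (subst euclidean_inner) (simp add: cis_conv_exp sum_distrib_left flip: exp_sum)
    finally show ?thesis .
  qed
  moreover have "(\<Prod>b\<in>Basis. (\<integral>s. f b s \<partial>lborel)) =
      of_real ((pi / t) powr (real CARD('n) / 2) * exp (- ((norm x)\<^sup>2 / (4 * t))))"
  proof -
    have "(\<Prod>b\<in>(Basis :: (real^'n) set). sqrt (pi / t)) = (pi / t) powr (real CARD('n) / 2)"
      using t by (simp add: powr_half_sqrt[symmetric] powr_realpow[symmetric] powr_powr)
    moreover have "(\<Prod>b\<in>Basis. exp (- ((x \<bullet> b)\<^sup>2 / (4 * t)))) = exp (- ((norm x)\<^sup>2 / (4 * t)))"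
      by (simp add: sq sum_divide_distrib sum_negf flip: exp_sum)
    ultimately show ?thesis
      unfolding f by (simp only: of_real_prod[symmetric] prod.distrib)
  qed
  ultimately show ?thesis
    using lborel_prod_coordinates[of f, OF f(1)] by (simp add: has_bochner_integral_iff)
qed

lemma nn_integral_gaussian:
  assumes t: "0 < t"
  shows "(\<integral>\<^sup>+\<xi>. exp (- (t * (norm (\<xi> :: real ^ 'n))\<^sup>2)) \<partial>lborel) = (pi / t) powr (real CARD('n) / 2)"
proof -
  have "has_bochner_integral lborel (\<lambda>\<xi>::real^'n. complex_of_real (exp (- (t * (norm \<xi>)\<^sup>2))))
          (of_real ((pi / t) powr (real CARD('n) / 2)))"
    using gaussian_fourier[OF t, of "0 :: real ^ 'n"] by simp
  from has_bochner_integral_Re[OF this]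
  have *: "has_bochner_integral lborel (\<lambda>\<xi>::real^'n. exp (- (t * (norm \<xi>)\<^sup>2)))
          ((pi / t) powr (real CARD('n) / 2))"
    by (simp del: of_real_exp)
  show ?thesis
    using * by (subst nn_integral_eq_integral) (auto simp: has_bochner_integral_iff)
qed

lemma integrable_gaussian:
  "0 < t \<Longrightarrow> integrable lborel (\<lambda>\<xi> :: real ^ 'n. exp (- (t * (norm \<xi>)\<^sup>2)))"
  by (rule integrableI_nonneg) (auto simp: nn_integral_gaussian)

lemma nn_integral_gaussian_cos:
  fixes x :: "real ^ 'n"
  assumes t: "0 < t"
  shows "(\<integral>\<^sup>+\<xi>. exp (- (t * (norm \<xi>)\<^sup>2)) * (1 - cos (x \<bullet> \<xi>)) \<partial>lborel) =
         (pi / t) powr (real CARD('n) / 2) * (1 - exp (- ((norm x)\<^sup>2 / (4 * t))))"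
proof -
  have "has_bochner_integral lborel (\<lambda>\<xi>. Re (of_real (exp (- (t * (norm \<xi>)\<^sup>2))) * cis (0 \<bullet> \<xi>)) -
      Re (of_real (exp (- (t * (norm \<xi>)\<^sup>2))) * cis (x \<bullet> \<xi>)))
     (Re (of_real ((pi / t) powr (real CARD('n) / 2) * exp (- ((norm (0::real^'n))\<^sup>2 / (4 * t))))) -
      Re (of_real ((pi / t) powr (real CARD('n) / 2) * exp (- ((norm x)\<^sup>2 / (4 * t))))))"
    by (intro has_bochner_integral_diff has_bochner_integral_Re gaussian_fourier t)
  then have "has_bochner_integral lborel (\<lambda>\<xi>. exp (- (t * (norm \<xi>)\<^sup>2)) * (1 - cos (x \<bullet> \<xi>)))
     ((pi / t) powr (real CARD('n) / 2) * (1 - exp (- ((norm x)\<^sup>2 / (4 * t)))))"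
    by (simp add: algebra_simps del: of_real_mult of_real_exp)
  then show ?thesis
    by (subst nn_integral_eq_integral) (auto simp: has_bochner_integral_iff)
qed

text \<open>Writes \<open>a\<close> to the power \<open>- s\<close> as a superposition of exponentials \<open>exp (- r a)\<close>. With \<open>a = |y|\<^sup>2\<close> this
expresses powers of the norm through Gaussians.\<close>

lemma nn_integral_Gamma_scaled:
  assumes s: "0 < s" and a: "0 < a"
  shows "(\<integral>\<^sup>+r\<in>{0<..}. ennreal (r powr (s - 1) * exp (- (r * a))) \<partial>lborel) = ennreal (Gamma s * a powr (- s))"
proof -
  have "ennreal (Gamma s) = (\<integral>\<^sup>+t. ennreal (indicator {0..} t * t powr (s - 1) / exp t) \<partial>lborel)"
    by (rule Gamma_conv_nn_integral_real[OF s])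
  also have "\<dots> = \<bar>a\<bar> * (\<integral>\<^sup>+t. ennreal (indicator {0..} (0 + a * t) * (0 + a * t) powr (s - 1) / exp (0 + a * t)) \<partial>lborel)"
    by (rule nn_integral_real_affine) (use a in auto)
  also have "\<dots> = (\<integral>\<^sup>+t. ennreal (a powr s) * (ennreal (t powr (s - 1) * exp (- (t * a))) * indicator {0<..} t) \<partial>lborel)"
  proof (subst nn_integral_cmult[symmetric], measurable, intro nn_integral_cong)
    fix t :: real
    have "\<bar>a\<bar> * (indicator {0..} (0 + a * t) * (0 + a * t) powr (s - 1) / exp (0 + a * t)) =
        a powr s * (t powr (s - 1) * exp (- (t * a)) * indicator {0<..} t)"
    proof (cases "t > 0")
      case True
      then have "a * (a * t) powr (s - 1) = a powr s * t powr (s - 1)"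
        using a by (simp add: powr_mult powr_diff)
      then show ?thesis using True a
        by (simp add: exp_minus field_simps)
    qed (use a in \<open>auto simp: indicator_def mult_le_0_iff zero_le_mult_iff\<close>)
    then show "ennreal \<bar>a\<bar> * ennreal (indicator {0..} (0 + a * t) * (0 + a * t) powr (s - 1) / exp (0 + a * t)) =
      ennreal (a powr s) * (ennreal (t powr (s - 1) * exp (- (t * a))) * indicator {0<..} t)"
      by (simp flip: ennreal_mult' ennreal_mult'' ennreal_indicator)
  qed
  also have "\<dots> = ennreal (a powr s) * (\<integral>\<^sup>+t\<in>{0<..}. ennreal (t powr (s - 1) * exp (- (t * a))) \<partial>lborel)"
    by (subst nn_integral_cmult) auto
  finally have "ennreal (a powr (-s)) * ennreal (Gamma s) =
     (ennreal (a powr (-s)) * ennreal (a powr s)) * (\<integral>\<^sup>+t\<in>{0<..}. ennreal (t powr (s - 1) * exp (- (t * a))) \<partial>lborel)"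
    by (simp add: mult.assoc)
  also have "ennreal (a powr (-s)) * ennreal (a powr s) = 1"
    using a by (simp flip: ennreal_mult powr_add)
  finally show ?thesis using s
    by (simp add: mult.commute flip: ennreal_mult')
qed

section \<open>Lebesgue measure: translations, domination and Fubini's theorem\<close>

lemma lborel_distr_reflect:
  fixes c :: "'a::euclidean_space"
  shows "distr lborel borel ((-) c) = lborel"
proof -
  have "(\<lambda>x. c + (-1) *\<^sub>R x) = (-) c" by auto
  then show ?thesis
    by (subst (2) lborel_affine[of "-1" c]) (auto simp: density_1)
qed

lemma lborel_integral_translate:
  fixes f :: "'a::euclidean_space \<Rightarrow> 'b::{banach, second_countable_topology}"
  assumes [measurable]: "f \<in> borel_measurable borel"
  shows "(\<integral>x. f (a + x) \<partial>lborel) = (\<integral>x. f x \<partial>lborel)"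
  by (subst (2) lborel_distr_plus[of a, symmetric], subst integral_distr) auto

lemma lborel_integral_reflect:
  fixes f :: "'a::euclidean_space \<Rightarrow> 'b::{banach, second_countable_topology}"
  assumes [measurable]: "f \<in> borel_measurable borel"
  shows "(\<integral>x. f (a - x) \<partial>lborel) = (\<integral>x. f x \<partial>lborel)"
  by (subst (2) lborel_distr_reflect[of a, symmetric], subst integral_distr) auto

lemma lborel_integrable_translate:
  fixes f :: "'a::euclidean_space \<Rightarrow> 'b::{banach, second_countable_topology}"
  assumes f: "integrable lborel f"
  shows "integrable lborel (\<lambda>x. f (a + x))"
proof -
  have "integrable (distr lborel borel ((+) a)) f"
    using f by (simp add: lborel_distr_plus)
  then show ?thesis by (rule integrable_distr[rotated]) simp
qed

lemma lborel_integrable_reflect: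
  fixes f :: "'a::euclidean_space \<Rightarrow> 'b::{banach, second_countable_topology}"
  assumes f: "integrable lborel f"
  shows "integrable lborel (\<lambda>x. f (a - x))"
proof -
  have "integrable (distr lborel borel ((-) a)) f"
    using f by (simp add: lborel_distr_reflect)
  then show ?thesis by (rule integrable_distr[rotated]) simp
qed

lemma integrable_dominated:
  fixes f :: "'a::euclidean_space \<Rightarrow> 'b::{banach, second_countable_topology}"
  assumes "integrable lborel g" "f \<in> borel_measurable borel" "\<And>x. norm (f x) \<le> g x"
  shows "integrable lborel f"
proof (rule Bochner_Integration.integrable_bound[OF assms(1)])
  show "AE x in lborel. norm (f x) \<le> norm (g x)"
    using assms(3) by (intro AE_I2) (auto intro: order_trans[OF _ abs_ge_self])
qed (use assms(2) in simp)

text \<open>Fubini's theorem in the form in which it is used throughout: absolute convergence is checked by bounding the inner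
integral by an integrable function.\<close>

lemma lborel_swap_integrals:
  fixes k :: "'a::euclidean_space \<Rightarrow> 'b::euclidean_space \<Rightarrow> 'c::{banach, second_countable_topology}"
  assumes meas: "(\<lambda>(x, y). k x y) \<in> borel_measurable (borel \<Otimes>\<^sub>M borel)"
    and k: "\<And>x. integrable lborel (k x)"
    and g: "integrable lborel g" "\<And>x. (\<integral>y. norm (k x y) \<partial>lborel) \<le> g x"
  shows "(\<integral>x. (\<integral>y. k x y \<partial>lborel) \<partial>lborel) = (\<integral>y. (\<integral>x. k x y \<partial>lborel) \<partial>lborel)"
proof -
  have [measurable]: "(\<lambda>(x, y). k x y) \<in> borel_measurable (lborel \<Otimes>\<^sub>M lborel)"
    using meas by (simp cong: measurable_cong_sets sets_pair_measure_cong)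
  have "integrable (lborel \<Otimes>\<^sub>M lborel) (\<lambda>(x, y). k x y)"
  proof (rule lborel_pair.Fubini_integrable)
    show "integrable lborel (\<lambda>x. \<integral>y. norm (case (x, y) of (x, y) \<Rightarrow> k x y) \<partial>lborel)"
    proof (rule integrable_dominated[OF g(1)])
      show "norm (\<integral>y. norm (case (x, y) of (x, y) \<Rightarrow> k x y) \<partial>lborel) \<le> g x" for x
      proof -
        have "0 \<le> (\<integral>y. norm (k x y) \<partial>lborel)" by (intro integral_nonneg_AE AE_I2) simp
        then show ?thesis using g(2)[of x] by simp
      qed
    qed measurable
  qed (use k in simp_all)
  from lborel_pair.Fubini_integral[OF this] show ?thesis by simp
qed

section \<open>The weight of the space \<open>L\<^sub>\<alpha>\<close>\<close>

lemma powr_add_le: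
  fixes a b p :: real
  assumes "0 \<le> a" "0 \<le> b" "0 \<le> p"
  shows "(a + b) powr p \<le> 2 powr p * (a powr p + b powr p)"
proof -
  have "(a + b) powr p \<le> (2 * max a b) powr p"
    using assms by (intro powr_mono2) auto
  also have "\<dots> = 2 powr p * max a b powr p"
    using assms by (simp add: powr_mult)
  also have "max a b powr p \<le> a powr p + b powr p"
    by (cases "a \<le> b") auto
  finally show ?thesis by (simp add: mult_left_mono)
qed

lemma powr_square:
  fixes x a :: real
  assumes "0 \<le> x"
  shows "(x\<^sup>2) powr a = x powr (2 * a)"
proof -
  have "x\<^sup>2 = x powr 2" using assms by (cases "x = 0") auto
  then show ?thesis by (simp add: powr_powr)
qed

text \<open>The weight that defines \<open>L\<^sub>\<alpha>\<close>. It also measures the decay of all kernels that \<open>u\<close> is paired with: a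
kernel bounded by a multiple of the weight is integrable against \<open>u\<close>.\<close>

definition weight :: "real \<Rightarrow> real ^ 'n::finite \<Rightarrow> real" where
  "weight \<alpha> x = 1 / (1 + norm x powr (real CARD('n) + \<alpha>))"

lemma weight_pos [simp]: "0 < weight \<alpha> x" "0 \<le> weight \<alpha> x"
proof -
  have "0 < 1 + norm x powr (real CARD('a) + \<alpha>)" by (simp add: add_pos_nonneg)
  then show "0 < weight \<alpha> x" by (simp add: weight_def)
  then show "0 \<le> weight \<alpha> x" by simp
qed

lemma weight_le_1: "weight \<alpha> x \<le> 1"
  by (simp add: weight_def divide_le_eq_1 add_pos_nonneg)

lemma weight_minus [simp]: "weight \<alpha> (- x) = weight \<alpha> x"
  by (simp add: weight_def)

lemma weight_commute: "weight \<alpha> (x - y) = weight \<alpha> (y - x)"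
  by (simp add: weight_def norm_minus_commute)

lemma weight_measurable [measurable]: "weight \<alpha> \<in> borel_measurable borel"
  unfolding weight_def[abs_def] by measurable

text \<open>Translations change the weight only by a factor, because \<open>1 + |x + y|\<^sup>N\<close> is bounded by a multiple of
\<open>(1 + |x|\<^sup>N) (1 + |y|\<^sup>N)\<close>.\<close>

lemma weight_shift:
  fixes x y :: "real ^ 'n"
  assumes "0 < \<alpha>"
  shows "weight \<alpha> x \<le> 2 powr (real CARD('n) + \<alpha>) * (1 + norm y powr (real CARD('n) + \<alpha>)) * weight \<alpha> (x + y)"
proof -
  let ?N = "real CARD('n) + \<alpha>"
  have "norm (x + y) powr ?N \<le> (norm x + norm y) powr ?N"
    using assms by (intro powr_mono2 norm_triangle_ineq) auto
  also have "\<dots> \<le> 2 powr ?N * (norm x powr ?N + norm y powr ?N)"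
    using assms by (intro powr_add_le) auto
  finally have 1: "norm (x + y) powr ?N \<le> 2 powr ?N * (norm x powr ?N + norm y powr ?N)" .
  have "1 \<le> 2 powr ?N" using assms by (intro ge_one_powr_ge_zero) auto
  with 1 have "1 + norm (x + y) powr ?N \<le> 2 powr ?N * (1 + norm x powr ?N + norm y powr ?N)"
    by (simp add: algebra_simps)
  also have "\<dots> \<le> 2 powr ?N * ((1 + norm y powr ?N) * (1 + norm x powr ?N))"
    by (intro mult_left_mono) (auto simp: algebra_simps)
  finally show ?thesis
    unfolding weight_def by (simp add: field_simps add_pos_nonneg)
qed

lemma inverse_powr_le_weight:
  fixes y :: "real ^ 'n"
  assumes "0 < \<alpha>" "0 < e" "e \<le> norm y" 
  shows "1 / norm y powr (real CARD('n) + \<alpha>) \<le> (1 + 1 / e powr (real CARD('n) + \<alpha>)) * weight \<alpha> y"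
proof -
  let ?N = "real CARD('n) + \<alpha>"
  have "e powr ?N \<le> norm y powr ?N" using assms by (intro powr_mono2) auto
  moreover have "0 < e powr ?N" "0 < norm y powr ?N" using assms by auto
  ultimately show ?thesis unfolding weight_def
    by (simp add: field_simps add_pos_nonneg)
qed

text \<open>Subordination and Tonelli's theorem: an integral against \<open>g\<close> to a negative power is a superposition of
integrals against \<open>exp (- r g)\<close>. For \<open>g x = |x|\<^sup>2\<close> or \<open>g x = 1 + |x|\<^sup>2\<close> the latter are
Gaussian integrals.\<close>

lemma nn_integral_subordination:
  fixes f :: "real ^ 'n \<Rightarrow> real" and g :: "real ^ 'n \<Rightarrow> real"
  assumes [measurable]: "f \<in> borel_measurable borel" "g \<in> borel_measurable borel"
    and s: "0 < s" and f: "\<And>x. 0 \<le> f x" and g: "\<And>x. f x \<noteq> 0 \<Longrightarrow> 0 < g x"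
  shows "(\<integral>\<^sup>+x. ennreal (f x * g x powr (- s)) \<partial>lborel) * ennreal (Gamma s) =
    (\<integral>\<^sup>+r\<in>{0<..}. ennreal (r powr (s - 1)) * (\<integral>\<^sup>+x. ennreal (f x * exp (- (r * g x))) \<partial>lborel) \<partial>lborel)"
proof -
  have "(\<integral>\<^sup>+x. ennreal (f x * g x powr (- s)) \<partial>lborel) * ennreal (Gamma s) =
    (\<integral>\<^sup>+x. ennreal (f x * g x powr (- s)) * ennreal (Gamma s) \<partial>lborel)"
    by (subst nn_integral_multc) auto
  also have "\<dots> = (\<integral>\<^sup>+x. (\<integral>\<^sup>+r\<in>{0<..}. ennreal (f x * r powr (s - 1) * exp (- (r * g x))) \<partial>lborel) \<partial>lborel)"
  proof (intro nn_integral_cong)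
    fix x :: "real ^ 'n"
    show "ennreal (f x * g x powr (- s)) * ennreal (Gamma s) =
        (\<integral>\<^sup>+r\<in>{0<..}. ennreal (f x * r powr (s - 1) * exp (- (r * g x))) \<partial>lborel)"
    proof (cases "f x = 0")
      case False
      have "(\<integral>\<^sup>+r\<in>{0<..}. ennreal (f x * r powr (s - 1) * exp (- (r * g x))) \<partial>lborel) =
         (\<integral>\<^sup>+r. ennreal (f x) * (ennreal (r powr (s - 1) * exp (- (r * g x))) * indicator {0<..} r) \<partial>lborel)"
        using f[of x] by (intro nn_integral_cong) (auto simp: mult.assoc indicator_def simp flip: ennreal_mult')
      also have "\<dots> = ennreal (f x) * ennreal (Gamma s * g x powr (- s))"
        by (subst nn_integral_cmult) (auto simp: nn_integral_Gamma_scaled s g[OF False])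
      finally show ?thesis
        using f[of x] s by (simp add: mult_ac flip: ennreal_mult' ennreal_mult'')
    qed simp
  qed
  also have "\<dots> = (\<integral>\<^sup>+r. (\<integral>\<^sup>+x. ennreal (f x * r powr (s - 1) * exp (- (r * g x))) * indicator {0<..} r \<partial>lborel) \<partial>lborel)"
    by (rule lborel_pair.Fubini'[symmetric]) measurable
  also have "\<dots> = (\<integral>\<^sup>+r\<in>{0<..}. ennreal (r powr (s - 1)) * (\<integral>\<^sup>+x. ennreal (f x * exp (- (r * g x))) \<partial>lborel) \<partial>lborel)"
  proof (intro nn_integral_cong)
    fix r :: real
    have "(\<integral>\<^sup>+x. ennreal (f x * r powr (s - 1) * exp (- (r * g x))) * indicator {0<..} r \<partial>lborel) =
       (\<integral>\<^sup>+x. (ennreal (r powr (s - 1)) * indicator {0<..} r) * ennreal (f x * exp (- (r * g x))) \<partial>lborel)"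
      using f by (intro nn_integral_cong)
         (auto simp: indicator_def mult_ac simp flip: ennreal_mult' ennreal_mult'')
    also have "\<dots> = (ennreal (r powr (s - 1)) * indicator {0<..} r) * (\<integral>\<^sup>+x. ennreal (f x * exp (- (r * g x))) \<partial>lborel)"
      by (rule nn_integral_cmult) measurable
    finally show "(\<integral>\<^sup>+x. ennreal (f x * r powr (s - 1) * exp (- (r * g x))) * indicator {0<..} r \<partial>lborel) =
      ennreal (r powr (s - 1)) * (\<integral>\<^sup>+x. ennreal (f x * exp (- (r * g x))) \<partial>lborel) * indicator {0<..} r"
      by (simp add: mult_ac)
  qed
  finally show ?thesis .
qed

text \<open>The weight is comparable to \<open>(1 + |x|\<^sup>2)\<close> to the power \<open>- (n + \<alpha>) / 2\<close>, whose integral is the Gamma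
integral \<open>\<pi>\<^sup>n\<^sup>/\<^sup>2 \<Gamma>(\<alpha> / 2) / \<Gamma>((n + \<alpha>) / 2)\<close> by subordination.\<close>

lemma integrable_weight:
  assumes \<alpha>: "0 < \<alpha>"
  shows "integrable lborel (weight \<alpha> :: real ^ 'n \<Rightarrow> real)"
proof -
  let ?n = "real CARD('n)"
  let ?N = "?n + \<alpha>"
  let ?I = "\<integral>\<^sup>+x. ennreal (1 * (1 + (norm x)\<^sup>2) powr (- (?N / 2))) \<partial>(lborel :: (real^'n) measure)"
  have "?I * ennreal (Gamma (?N / 2)) =
    (\<integral>\<^sup>+r\<in>{0<..}. ennreal (r powr (?N / 2 - 1)) * (\<integral>\<^sup>+x. ennreal (1 * exp (- (r * (1 + (norm x)\<^sup>2)))) \<partial>(lborel :: (real^'n) measure)) \<partial>lborel)"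
    using \<alpha> by (intro nn_integral_subordination) (auto simp: add_pos_nonneg)
  also have "\<dots> = (\<integral>\<^sup>+r. ennreal (pi powr (?n / 2)) * (ennreal (r powr (\<alpha> / 2 - 1) * exp (- (r * 1))) * indicator {0<..} r) \<partial>lborel)"
  proof (intro nn_integral_cong)
    fix r :: real
    show "ennreal (r powr (?N / 2 - 1)) * (\<integral>\<^sup>+x. ennreal (1 * exp (- (r * (1 + (norm x)\<^sup>2)))) \<partial>(lborel :: (real^'n) measure)) * indicator {0<..} r
      = ennreal (pi powr (?n / 2)) * (ennreal (r powr (\<alpha> / 2 - 1) * exp (- (r * 1))) * indicator {0<..} r)"
    proof (cases "r > 0")
      case True
      have "(\<integral>\<^sup>+x. ennreal (1 * exp (- (r * (1 + (norm x)\<^sup>2)))) \<partial>(lborel :: (real^'n) measure)) =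
         (\<integral>\<^sup>+x. ennreal (exp (- r)) * ennreal (exp (- (r * (norm x)\<^sup>2))) \<partial>(lborel :: (real^'n) measure))"
        by (intro nn_integral_cong) (simp add: algebra_simps exp_diff exp_minus field_simps flip: ennreal_mult')
      also have "\<dots> = ennreal (exp (- r)) * ennreal ((pi / r) powr (?n / 2))"
        by (subst nn_integral_cmult) (auto simp: nn_integral_gaussian True)
      finally have eq: "(\<integral>\<^sup>+x. ennreal (1 * exp (- (r * (1 + (norm x)\<^sup>2)))) \<partial>(lborel :: (real^'n) measure)) =
         ennreal (exp (- r) * (pi / r) powr (?n / 2))" by (simp add: ennreal_mult')
      have "?N / 2 - 1 = (\<alpha> / 2 - 1) + ?n / 2" by (simp add: field_simps)
      then have "r powr (?N / 2 - 1) = r powr (\<alpha> / 2 - 1) * r powr (?n / 2)"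
        by (simp only: powr_add)
      then have "r powr (?N / 2 - 1) * (exp (- r) * (pi / r) powr (?n / 2)) =
          pi powr (?n / 2) * (r powr (\<alpha> / 2 - 1) * exp (- (r * 1)))"
        using True by (simp add: powr_divide)
      then show ?thesis using True eq
        by (simp flip: ennreal_mult' ennreal_mult'' del: mult_1)
    qed auto
  qed
  also have "\<dots> = ennreal (pi powr (?n / 2)) * ennreal (Gamma (\<alpha> / 2) * 1 powr (- (\<alpha> / 2)))"
    using \<alpha> by (subst nn_integral_cmult) (auto simp: nn_integral_Gamma_scaled[of "\<alpha> / 2" 1, simplified])
  finally have "?I * ennreal (Gamma (?N / 2)) < \<infinity>"
    by (simp add: ennreal_mult_less_top)
  moreover have "ennreal (Gamma (?N / 2)) \<noteq> 0"
  proof -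
    have "0 < Gamma (?N / 2)" using \<alpha> by (intro Gamma_real_pos) auto
    then show ?thesis by simp
  qed
  ultimately have I: "?I < \<infinity>"
    by (auto simp: ennreal_mult_less_top)
  have "integrable lborel (\<lambda>x::real^'n. 2 powr (?N/2) * (1 * (1 + (norm x)\<^sup>2) powr (- (?N / 2))))"
    using I by (intro integrable_mult_right integrableI_nonneg) auto
  then show ?thesis
  proof (rule Bochner_Integration.integrable_bound)
    show "AE x::real^'n in lborel. norm (weight \<alpha> x) \<le> norm (2 powr (?N/2) * (1 * (1 + (norm x)\<^sup>2) powr (- (?N / 2))))"
    proof (intro AE_I2)
      fix x :: "real ^ 'n"
      have "(1 + (norm x)\<^sup>2) powr (?N / 2) \<le> 2 powr (?N / 2) * (1 powr (?N/2) + ((norm x)\<^sup>2) powr (?N / 2))"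
        using \<alpha> by (intro powr_add_le) auto
      also have "((norm x)\<^sup>2) powr (?N / 2) = norm x powr ?N"
        by (subst powr_square) (simp_all add: add_divide_distrib)
      finally have *: "(1 + (norm x)\<^sup>2) powr (?N / 2) \<le> 2 powr (?N / 2) * (1 + norm x powr ?N)"
        by simp
      have "0 < (1 + (norm x)\<^sup>2) powr (?N / 2)"
        by (simp add: add_nonneg_eq_0_iff)
      moreover have "0 < 1 + norm x powr ?N" by (simp add: add_pos_nonneg)
      ultimately have "weight \<alpha> x \<le> 2 powr (?N/2) * ((1 + (norm x)\<^sup>2) powr (- (?N / 2)))"
        using * unfolding weight_def powr_minus by (simp add: field_simps)
      then show "norm (weight \<alpha> x) \<le> norm (2 powr (?N/2) * (1 * (1 + (norm x)\<^sup>2) powr (- (?N / 2))))"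
        by (simp add: abs_of_nonneg)
    qed
  qed simp
qed

text \<open>One of \<open>z\<close> and \<open>x - z\<close> has norm at least \<open>|x| / 2\<close>; the corresponding factor is bounded by a multiple of
\<open>weight \<alpha> x\<close>, and the other factor is integrable.\<close>

lemma weight_convolution:
  assumes \<alpha>: "0 < \<alpha>"
  obtains C where "0 < C"
    "\<And>x :: real ^ 'n. integrable lborel (\<lambda>z. weight \<alpha> z * weight \<alpha> (x - z))"
    "\<And>x :: real ^ 'n. (\<integral>z. weight \<alpha> z * weight \<alpha> (x - z) \<partial>lborel) \<le> C * weight \<alpha> x"
proof -
  let ?N = "real CARD('n) + \<alpha>"
  define J where "J = (\<integral>z. weight \<alpha> z \<partial>(lborel :: (real^'n) measure))"
  have J: "0 \<le> J" unfolding J_def by simp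
  have le: "weight \<alpha> z * weight \<alpha> (x - z) \<le> 2 powr ?N * weight \<alpha> x * (weight \<alpha> z + weight \<alpha> (x - z))" for x z :: "real ^ 'n"
  proof -
    have "norm x powr ?N \<le> (norm z + norm (x - z)) powr ?N"
      using \<alpha> by (intro powr_mono2) (auto intro: norm_triangle_sub)
    also have "\<dots> \<le> 2 powr ?N * (norm z powr ?N + norm (x - z) powr ?N)"
      using \<alpha> by (intro powr_add_le) auto
    finally have "1 + norm x powr ?N \<le> 2 powr ?N * (1 + norm z powr ?N) + 2 powr ?N * (1 + norm (x - z) powr ?N)"
      using ge_one_powr_ge_zero[of 2 ?N] \<alpha> by (simp add: algebra_simps)
    moreover have "1 + norm x powr ?N = 1 / weight \<alpha> x" for x :: "real ^ 'n"
      by (simp add: weight_def)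
    ultimately have "1 / weight \<alpha> x \<le> 2 powr ?N / weight \<alpha> z + 2 powr ?N / weight \<alpha> (x - z)"
      by simp
    then show ?thesis
      using weight_pos(1)[of \<alpha> x] weight_pos(1)[of \<alpha> z] weight_pos(1)[of \<alpha> "x - z"]
      by (simp add: field_simps)
  qed
  have w: "integrable lborel (\<lambda>z. weight \<alpha> (x - z))" "(\<integral>z. weight \<alpha> (x - z) \<partial>lborel) = J" for x :: "real ^ 'n"
    using lborel_integrable_reflect[OF integrable_weight[OF \<alpha>], of x] lborel_integral_reflect[of "weight \<alpha>" x]
    by (auto simp: J_def)
  have int2: "integrable lborel (\<lambda>z. 2 powr ?N * weight \<alpha> x * (weight \<alpha> z + weight \<alpha> (x - z)))" for x :: "real ^ 'n"
    by (intro integrable_mult_right Bochner_Integration.integrable_add integrable_weight \<alpha> w)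
  have int: "integrable lborel (\<lambda>z. weight \<alpha> z * weight \<alpha> (x - z))" for x :: "real ^ 'n"
    by (rule Bochner_Integration.integrable_bound[OF int2[of x]])
       (use le in \<open>auto simp: abs_mult intro!: AE_I2 order_trans[OF _ abs_ge_self]\<close>)
  have "(\<integral>z. weight \<alpha> z * weight \<alpha> (x - z) \<partial>lborel) \<le> (2 powr ?N * (2 * J) + 1) * weight \<alpha> x" for x :: "real ^ 'n"
  proof -
    have "(\<integral>z. weight \<alpha> z * weight \<alpha> (x - z) \<partial>lborel) \<le> (\<integral>z. 2 powr ?N * weight \<alpha> x * (weight \<alpha> z + weight \<alpha> (x - z)) \<partial>lborel)"
      by (rule integral_mono[OF int int2 le])
    also have "\<dots> = 2 powr ?N * weight \<alpha> x * (J + J)"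
      by (simp add: Bochner_Integration.integral_add integrable_weight \<alpha> w flip: J_def)
    also have "\<dots> \<le> (2 powr ?N * (2 * J) + 1) * weight \<alpha> x"
      using weight_pos(2)[of \<alpha> x] by (simp add: algebra_simps)
    finally show ?thesis .
  qed
  moreover have "0 < 2 powr ?N * (2 * J) + 1" using J by (intro add_nonneg_pos) auto
  ultimately show thesis using int that by blast
qed

section \<open>The symbol of the fractional Laplacian\<close>

lemma nn_integral_powr_split:
  fixes p q :: real
  assumes "-1 < p" "q < -1"
  shows "(\<integral>\<^sup>+r\<in>{0<..}. ennreal (if r \<le> 1 then r powr p else r powr q) \<partial>lborel) < \<infinity>"
proof -
  have "(\<integral>\<^sup>+r\<in>{0<..}. ennreal (if r \<le> 1 then r powr p else r powr q) \<partial>lborel) \<le>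
     (\<integral>\<^sup>+r. ennreal (r powr p) * indicator {0..1} r + ennreal (r powr q) * indicator {1..} r \<partial>lborel)"
    by (intro nn_integral_mono) (auto simp: indicator_def)
  also have "\<dots> = (\<integral>\<^sup>+r. ennreal (r powr p) * indicator {0..1} r \<partial>lborel) + (\<integral>\<^sup>+r. ennreal (r powr q) * indicator {1..} r \<partial>lborel)"
    by (rule nn_integral_add) auto
  also have "\<dots> < \<infinity>"
    using nn_integral_has_integral_lebesgue'[OF _ has_integral_powr_from_0[of p 1]]
      nn_integral_has_integral_lebesgue'[OF _ has_integral_powr_to_inf[of q 1]] assms by simp
  finally show ?thesis .
qed

text \<open>By subordination the integral becomes a one-dimensional integral over \<open>r\<close> in which \<open>\<xi>\<close> enters only
through \<open>|\<xi>|\<^sup>2 / r\<close>, so the scaling \<open>r \<mapsto> |\<xi>|\<^sup>2 r\<close> produces the factor \<open>|\<xi>|\<^sup>\<alpha>\<close>. The condition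
\<open>\<alpha> < 2\<close> is needed at large \<open>r\<close> and \<open>\<alpha> > 0\<close> at small \<open>r\<close>.\<close>

lemma fractional_symbol:
  assumes \<alpha>: "0 < \<alpha>" "\<alpha> < 2"
  obtains \<kappa> where "0 < \<kappa>"
    "\<And>\<xi> :: real ^ 'n. has_bochner_integral lborel
       (\<lambda>y. (1 - cos (\<xi> \<bullet> y)) / norm y powr (real CARD('n) + \<alpha>)) (\<kappa> * norm \<xi> powr \<alpha>)"
proof -
  let ?n = "real CARD('n)"
  let ?N = "?n + \<alpha>"
  define J where "J = (\<integral>\<^sup>+r\<in>{0<..}. ennreal (r powr (\<alpha> / 2 - 1) * (1 - exp (- (1 / (4 * r))))) \<partial>lborel)"
  have exp_bound: "1 - exp (- (1 / (4 * r))) \<le> 1 / (4 * r)" for r :: real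
    using exp_ge_add_one_self[of "- (1 / (4 * r))"] by simp
  \<comment> \<open>The factor \<open>1 - exp (- 1 / (4 r))\<close> is at most one near zero and at most \<open>1 / r\<close> at infinity.\<close>
  have "J \<le> (\<integral>\<^sup>+r\<in>{0<..}. ennreal (if r \<le> 1 then r powr (\<alpha> / 2 - 1) else r powr (\<alpha> / 2 - 2)) \<partial>lborel)"
    unfolding J_def
  proof (intro nn_integral_mono mult_right_mono)
    fix r :: real
    have "r powr (\<alpha> / 2 - 1) * (1 - exp (- (1 / (4 * r)))) \<le> r powr (\<alpha> / 2 - 1) * 1"
      by (intro mult_left_mono) auto
    moreover have "r powr (\<alpha> / 2 - 1) * (1 - exp (- (1 / (4 * r)))) \<le> r powr (\<alpha> / 2 - 2)" if "r > 1"
    proof -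
      have "r powr (\<alpha> / 2 - 1) * (1 - exp (- (1 / (4 * r)))) \<le> r powr (\<alpha> / 2 - 1) * (1 / r)"
        using that exp_bound[of r] by (intro mult_left_mono order_trans[OF exp_bound]) (auto simp: field_simps)
      also have "1 / r = r powr (-1)"
        using that by (simp add: powr_minus field_simps)
      also have "r powr (\<alpha> / 2 - 1) * r powr (-1) = r powr (\<alpha> / 2 - 2)"
        by (subst powr_add[symmetric]) simp
      finally show ?thesis .
    qed
    ultimately show "ennreal (r powr (\<alpha> / 2 - 1) * (1 - exp (- (1 / (4 * r))))) \<le>
      ennreal (if r \<le> 1 then r powr (\<alpha> / 2 - 1) else r powr (\<alpha> / 2 - 2))"
      by (auto intro!: ennreal_leI)
  qed auto
  also have "\<dots> < \<infinity>" using \<alpha> by (intro nn_integral_powr_split) auto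
  finally have J_fin: "J < \<infinity>" .
  \<comment> \<open>A lower bound for the integrand on \<open>[1, 2]\<close> shows that \<open>J\<close> does not vanish.\<close>
  have "0 < (\<integral>\<^sup>+r. ennreal (1 / 2 * (1 - exp (- (1 / 8)))) * indicator {1..2::real} r \<partial>lborel)"
    by (subst nn_integral_cmult_indicator) (auto simp: ennreal_zero_less_mult_iff)
  also have "\<dots> \<le> J"
    unfolding J_def
  proof (intro nn_integral_mono)
    fix r :: real
    have "1 / 2 * (1 - exp (- (1 / 8))) \<le> r powr (\<alpha> / 2 - 1) * (1 - exp (- (1 / (4 * r))))" if "1 \<le> r" "r \<le> 2"
    proof (intro mult_mono)
      have "1 / 2 \<le> r powr (-1)" using that by (simp add: powr_minus field_simps)
      also have "\<dots> \<le> r powr (\<alpha> / 2 - 1)" using that \<alpha> by (intro powr_mono) auto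
      finally show "1 / 2 \<le> r powr (\<alpha> / 2 - 1)" .
      show "1 - exp (- (1 / 8)) \<le> 1 - exp (- (1 / (4 * r)))" using that by (simp add: field_simps)
    qed auto
    then show "ennreal (1 / 2 * (1 - exp (- (1 / 8)))) * indicator {1..2::real} r \<le>
       ennreal (r powr (\<alpha> / 2 - 1) * (1 - exp (- (1 / (4 * r))))) * indicator {0<..} r"
      by (auto simp: indicator_def intro!: ennreal_leI)
  qed
  finally have J_pos: "0 < J" .
  define \<kappa> where "\<kappa> = pi powr (?n / 2) * enn2real J / Gamma (?N / 2)"
  have G: "0 < Gamma (?N / 2)" using \<alpha> by (simp add: Gamma_real_pos)
  have "0 < enn2real J" using J_pos J_fin by (simp add: enn2real_positive_iff)
  then have "0 < \<kappa>" using G by (simp add: \<kappa>_def)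
  moreover have "has_bochner_integral lborel
       (\<lambda>y. (1 - cos (\<xi> \<bullet> y)) / norm y powr ?N) (\<kappa> * norm \<xi> powr \<alpha>)" for \<xi> :: "real ^ 'n"
  proof (cases "\<xi> = 0")
    case False
    define b where "b = (norm \<xi>)\<^sup>2"
    have b: "0 < b" using False by (simp add: b_def)
    have scale: "(\<integral>\<^sup>+r\<in>{0<..}. ennreal (r powr (\<alpha> / 2 - 1) * (1 - exp (- (b / (4 * r))))) \<partial>lborel) =
        ennreal (b powr (\<alpha> / 2)) * J"
    proof -
      have "(\<integral>\<^sup>+r\<in>{0<..}. ennreal (r powr (\<alpha> / 2 - 1) * (1 - exp (- (b / (4 * r))))) \<partial>lborel) =
        \<bar>b\<bar> * (\<integral>\<^sup>+r. ennreal ((0 + b * r) powr (\<alpha> / 2 - 1) * (1 - exp (- (b / (4 * (0 + b * r)))))) *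
              indicator {0<..} (0 + b * r) \<partial>lborel)"
        by (rule nn_integral_real_affine) (use b in auto)
      also have "\<dots> = (\<integral>\<^sup>+r. ennreal (b powr (\<alpha> / 2)) * (ennreal (r powr (\<alpha> / 2 - 1) * (1 - exp (- (1 / (4 * r))))) * indicator {0<..} r) \<partial>lborel)"
      proof (subst nn_integral_cmult[symmetric], measurable, intro nn_integral_cong)
        fix r :: real
        have "\<bar>b\<bar> * ((0 + b * r) powr (\<alpha> / 2 - 1) * (1 - exp (- (b / (4 * (0 + b * r))))) * indicator {0<..} (0 + b * r)) =
          b powr (\<alpha> / 2) * (r powr (\<alpha> / 2 - 1) * (1 - exp (- (1 / (4 * r)))) * indicator {0<..} r)"
        proof (cases "r > 0")
          case True
          then have "b * (b * r) powr (\<alpha> / 2 - 1) = b powr (\<alpha> / 2) * r powr (\<alpha> / 2 - 1)"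
            using b by (simp add: powr_mult powr_diff)
          then show ?thesis using True b by simp
        qed (use b in \<open>auto simp: indicator_def zero_less_mult_iff\<close>)
        then show "ennreal \<bar>b\<bar> * (ennreal ((0 + b * r) powr (\<alpha> / 2 - 1) * (1 - exp (- (b / (4 * (0 + b * r)))))) * indicator {0<..} (0 + b * r)) =
          ennreal (b powr (\<alpha> / 2)) * (ennreal (r powr (\<alpha> / 2 - 1) * (1 - exp (- (1 / (4 * r))))) * indicator {0<..} r)"
          by (simp flip: ennreal_mult' ennreal_mult'' ennreal_indicator)
      qed
      also have "\<dots> = ennreal (b powr (\<alpha> / 2)) * J"
        unfolding J_def by (rule nn_integral_cmult) measurable
      finally show ?thesis .
    qed
    let ?I = "\<integral>\<^sup>+y. ennreal ((1 - cos (\<xi> \<bullet> y)) * ((norm y)\<^sup>2) powr (- (?N / 2))) \<partial>lborel"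
    have "?I * ennreal (Gamma (?N / 2)) =
      (\<integral>\<^sup>+r\<in>{0<..}. ennreal (r powr (?N / 2 - 1)) * (\<integral>\<^sup>+y. ennreal ((1 - cos (\<xi> \<bullet> y)) * exp (- (r * (norm y)\<^sup>2))) \<partial>lborel) \<partial>lborel)"
      using \<alpha> by (intro nn_integral_subordination) auto
    also have "\<dots> = (\<integral>\<^sup>+r. ennreal (pi powr (?n / 2)) * (ennreal (r powr (\<alpha> / 2 - 1) * (1 - exp (- (b / (4 * r))))) * indicator {0<..} r) \<partial>lborel)"
    proof (intro nn_integral_cong)
      fix r :: real
      show "ennreal (r powr (?N / 2 - 1)) * (\<integral>\<^sup>+y. ennreal ((1 - cos (\<xi> \<bullet> y)) * exp (- (r * (norm y)\<^sup>2))) \<partial>lborel) * indicator {0<..} r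
        = ennreal (pi powr (?n / 2)) * (ennreal (r powr (\<alpha> / 2 - 1) * (1 - exp (- (b / (4 * r))))) * indicator {0<..} r)"
      proof (cases "r > 0")
        case True
        have eq: "(\<integral>\<^sup>+y. ennreal ((1 - cos (\<xi> \<bullet> y)) * exp (- (r * (norm y)\<^sup>2))) \<partial>lborel) =
           ennreal ((pi / r) powr (?n / 2) * (1 - exp (- (b / (4 * r)))))"
          using nn_integral_gaussian_cos[OF True, of \<xi>] by (simp add: b_def mult.commute)
        have "?N / 2 - 1 = (\<alpha> / 2 - 1) + ?n / 2" by (simp add: field_simps)
        then have "r powr (?N / 2 - 1) = r powr (\<alpha> / 2 - 1) * r powr (?n / 2)"
          by (simp only: powr_add)
        then have key: "r powr (?N / 2 - 1) * ((pi / r) powr (?n / 2) * (1 - exp (- (b / (4 * r))))) =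
            pi powr (?n / 2) * (r powr (\<alpha> / 2 - 1) * (1 - exp (- (b / (4 * r)))))"
          using True by (simp add: powr_divide)
        have "indicator {0<..} r = (1::ennreal)" using True by simp
        then show ?thesis
          by (simp only: eq mult_1_right ennreal_mult'[OF powr_ge_zero, symmetric] key)
      qed auto
    qed
    also have "\<dots> = ennreal (pi powr (?n / 2)) * (ennreal (b powr (\<alpha> / 2)) * J)"
      unfolding scale[symmetric] by (rule nn_integral_cmult) measurable
    also have "\<dots> = ennreal (\<kappa> * norm \<xi> powr \<alpha>) * ennreal (Gamma (?N / 2))"
    proof -
      have b': "b powr (\<alpha> / 2) = norm \<xi> powr \<alpha>"
        by (simp add: b_def powr_square)
      have J: "J = ennreal (enn2real J)" using J_fin by simp
      have key: "\<kappa> * norm \<xi> powr \<alpha> * Gamma (?N / 2) = pi powr (?n / 2) * (norm \<xi> powr \<alpha> * enn2real J)"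
        using G by (simp add: \<kappa>_def)
      show ?thesis
        by (subst J) (simp only: b' ennreal_mult'[OF powr_ge_zero, symmetric] ennreal_mult''[OF less_imp_le[OF G], symmetric] key)
    qed
    finally have "ennreal (Gamma (?N / 2)) * ?I = ennreal (Gamma (?N / 2)) * ennreal (\<kappa> * norm \<xi> powr \<alpha>)"
      by (simp add: mult.commute)
    then have I: "?I = ennreal (\<kappa> * norm \<xi> powr \<alpha>)"
      using G by (simp only: ennreal_mult_cancel_left) auto
    have eq: "(1 - cos (\<xi> \<bullet> y)) * ((norm y)\<^sup>2) powr (- (?N / 2)) = (1 - cos (\<xi> \<bullet> y)) / norm y powr ?N" for y
    proof -
      have "2 * - (?N / 2) = - ?N" by (simp add: add_divide_distrib)
      then have "((norm y)\<^sup>2) powr (- (?N / 2)) = norm y powr (- ?N)"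
        by (simp only: powr_square[OF norm_ge_zero])
      then show ?thesis by (simp only: powr_minus divide_inverse)
    qed
    show ?thesis
      by (rule has_bochner_integral_nn_integral)
         (use I eq \<open>0 < \<kappa>\<close> in auto)
  qed (simp add: has_bochner_integral_zero)
  ultimately show thesis using that by blast
qed

lemma one_minus_cos_ge:
  fixes s :: real
  assumes "\<bar>s\<bar> \<le> 1"
  shows "s\<^sup>2 / 4 \<le> 1 - cos s"
proof -
  have sin: "r / 2 \<le> sin r" if "0 \<le> r" "r \<le> 1" for r :: real
  proof -
    have "cos (pi / 3) \<le> cos y" if "0 \<le> y" "y \<le> 1" for y
      using that pi_gt3 by (intro cos_monotone_0_pi_le) auto
    then have "(\<lambda>x. sin x - x / 2) 0 \<le> (\<lambda>x. sin x - x / 2) r"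
      using that
      by (intro DERIV_nonneg_imp_nondecreasing[of 0 r "\<lambda>x. sin x - x / 2"])
         (auto simp: cos_60 intro!: exI derivative_eq_intros)
    then show ?thesis by simp
  qed
  have "(\<lambda>x. 1 - cos x - x\<^sup>2 / 4) 0 \<le> (\<lambda>x. 1 - cos x - x\<^sup>2 / 4) \<bar>s\<bar>"
    by (intro DERIV_nonneg_imp_nondecreasing[of 0 "\<bar>s\<bar>" "\<lambda>x. 1 - cos x - x\<^sup>2 / 4"])
       (use assms sin in \<open>auto intro!: exI derivative_eq_intros\<close>)
  then show ?thesis by simp
qed

text \<open>Near the origin \<open>|y|\<^sup>2\<close> is dominated by the sum of \<open>4 (1 - cos y\<^sub>i)\<close> over the coordinates, which reduces
the claim to \<open>fractional_symbol\<close> for the basis vectors; away from the origin the weight dominates.\<close>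

lemma integrable_levy:
  assumes \<alpha>: "0 < \<alpha>" "\<alpha> < 2"
  shows "integrable lborel (\<lambda>y :: real ^ 'n. min 1 ((norm y)\<^sup>2) / norm y powr (real CARD('n) + \<alpha>))"
proof -
  let ?N = "real CARD('n) + \<alpha>"
  obtain \<kappa> where \<kappa>: "\<And>\<xi> :: real ^ 'n. has_bochner_integral lborel
       (\<lambda>y. (1 - cos (\<xi> \<bullet> y)) / norm y powr ?N) (\<kappa> * norm \<xi> powr \<alpha>)"
    using fractional_symbol[OF \<alpha>, where 'n='n] by blast
  have "integrable lborel (\<lambda>y::real^'n. 2 * weight \<alpha> y + 4 * (\<Sum>b\<in>Basis. (1 - cos (b \<bullet> y)) / norm y powr ?N))"
    using \<kappa> by (auto intro!: Bochner_Integration.integrable_add integrable_mult_right Bochner_Integration.integrable_sum integrable_weight \<alpha>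
        simp: has_bochner_integral_iff)
  then show ?thesis
  proof (rule Bochner_Integration.integrable_bound, measurable, intro AE_I2)
    fix y :: "real ^ 'n"
    let ?S = "\<Sum>b\<in>Basis. (1 - cos (b \<bullet> y)) / norm y powr ?N"
    have S: "0 \<le> ?S" by (intro sum_nonneg divide_nonneg_nonneg) auto
    have "min 1 ((norm y)\<^sup>2) / norm y powr ?N \<le> 2 * weight \<alpha> y + 4 * ?S"
    proof (cases "1 \<le> norm y")
      case True
      then have "min 1 ((norm y)\<^sup>2) / norm y powr ?N \<le> 1 / norm y powr ?N"
        by (intro divide_right_mono) auto
      also have "\<dots> \<le> 2 * weight \<alpha> y" using inverse_powr_le_weight[of \<alpha> 1 y] True \<alpha> by simp
      finally show ?thesis using S by simp
    next
      case False
      have "(norm y)\<^sup>2 = (\<Sum>b\<in>Basis. (b \<bullet> y)\<^sup>2)"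
        unfolding power2_norm_eq_inner by (subst euclidean_inner) (simp add: power2_eq_square inner_commute)
      also have "\<dots> \<le> (\<Sum>b\<in>Basis. 4 * (1 - cos (b \<bullet> y)))"
      proof (intro sum_mono)
        fix b :: "real ^ 'n" assume "b \<in> Basis"
        then have "\<bar>b \<bullet> y\<bar> \<le> 1" using Basis_le_norm[of b y] False by (simp add: inner_commute)
        from one_minus_cos_ge[OF this] show "(b \<bullet> y)\<^sup>2 \<le> 4 * (1 - cos (b \<bullet> y))" by simp
      qed
      finally have "(norm y)\<^sup>2 / norm y powr ?N \<le> (\<Sum>b\<in>Basis. 4 * (1 - cos (b \<bullet> y))) / norm y powr ?N"
        by (intro divide_right_mono) auto
      also have "\<dots> = 4 * ?S" by (simp add: sum_distrib_left sum_divide_distrib)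
      finally have "(norm y)\<^sup>2 / norm y powr ?N \<le> 4 * ?S" .
      moreover have "min 1 ((norm y)\<^sup>2) / norm y powr ?N \<le> (norm y)\<^sup>2 / norm y powr ?N"
        by (intro divide_right_mono) auto
      moreover have "0 \<le> weight \<alpha> y" by simp
      ultimately show ?thesis by linarith
    qed
    then show "norm (min 1 ((norm y)\<^sup>2) / norm y powr ?N) \<le> norm (2 * weight \<alpha> y + 4 * ?S)"
      using S by (simp add: abs_of_nonneg)
  qed
qed

section \<open>The fractional Laplacian as an absolutely convergent integral\<close>

definition second_diff :: "(real ^ 'n::finite \<Rightarrow> real) \<Rightarrow> real ^ 'n \<Rightarrow> real ^ 'n \<Rightarrow> real" where
  "second_diff f x y = 2 * f x - f (x + y) - f (x - y)"

text \<open>The singular integral of the fractional Laplacian, without its constant, averaged over \<open>y\<close> and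
\<open>- y\<close>. The first-order terms cancel, so the integral converges absolutely.\<close>

definition sym_lap :: "real \<Rightarrow> (real ^ 'n::finite \<Rightarrow> real) \<Rightarrow> real ^ 'n \<Rightarrow> real" where
  "sym_lap \<alpha> f x = (\<integral>y. second_diff f x y / (2 * norm y powr (real CARD('n) + \<alpha>)) \<partial>lborel)"

text \<open>The quantitative regularity under which the integral \<open>sym_lap\<close> converges absolutely and inherits the
decay of the function.\<close>

definition tame :: "real \<Rightarrow> real \<Rightarrow> (real ^ 'n::finite \<Rightarrow> real) \<Rightarrow> bool" where
  "tame \<alpha> C f \<longleftrightarrow> continuous_on UNIV f \<and> (\<forall>x. \<bar>f x\<bar> \<le> C * weight \<alpha> x) \<and>
     (\<forall>x y. norm y \<le> 1 \<longrightarrow> \<bar>second_diff f x y\<bar> \<le> C * (norm y)\<^sup>2 * weight \<alpha> x)"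

lemma tame_measurable: "tame \<alpha> C f \<Longrightarrow> f \<in> borel_measurable borel"
  by (auto simp: tame_def intro: borel_measurable_continuous_onI)

lemma second_diff_measurable [measurable]:
  assumes [measurable]: "f \<in> borel_measurable borel"
  shows "(\<lambda>(x, y). second_diff f x y) \<in> borel_measurable (borel \<Otimes>\<^sub>M borel)"
    "second_diff f x \<in> borel_measurable borel" "(\<lambda>x. second_diff f x y) \<in> borel_measurable borel"
  unfolding second_diff_def[abs_def] by measurable

lemma sym_lap_measurable [measurable]:
  assumes [measurable]: "f \<in> borel_measurable borel"
  shows "sym_lap \<alpha> f \<in> borel_measurable borel"
  unfolding sym_lap_def[abs_def] second_diff_def[abs_def] by measurable

lemma tame_nonneg:
  fixes f :: "real ^ 'n \<Rightarrow> real"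
  assumes "tame \<alpha> C f"
  shows "0 \<le> C"
proof -
  have "\<bar>f 0\<bar> \<le> C * weight \<alpha> (0 :: real ^ 'n)" using assms by (simp add: tame_def)
  then have "0 \<le> C * weight \<alpha> (0 :: real ^ 'n)" by (rule order_trans[OF abs_ge_zero])
  then show ?thesis using weight_pos(1)[of \<alpha> "0 :: real ^ 'n"] by (simp add: zero_le_mult_iff not_le)
qed

text \<open>For \<open>|y| \<le> 1\<close> the integrand is bounded by the Levy weight times \<open>weight \<alpha> x\<close>, and for
\<open>|y| > 1\<close> by products of weights, whose integrals are controlled by \<open>weight_convolution\<close>. The bound
in \<open>x\<close> makes the integrand integrable in both variables jointly.\<close>

lemma tame_levy_integrand:
  fixes f :: "real ^ 'n \<Rightarrow> real"
  assumes \<alpha>: "0 < \<alpha>" "\<alpha> < 2" and f: "tame \<alpha> C f"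
  obtains K where
    "\<And>x. integrable lborel (\<lambda>y. second_diff f x y / (2 * norm y powr (real CARD('n) + \<alpha>)))"
    "\<And>x. (\<integral>y. \<bar>second_diff f x y / (2 * norm y powr (real CARD('n) + \<alpha>))\<bar> \<partial>lborel) \<le> K * weight \<alpha> x"
proof -
  let ?N = "real CARD('n) + \<alpha>"
  have [measurable]: "f \<in> borel_measurable borel" by (rule tame_measurable[OF f])
  have C: "0 \<le> C" by (rule tame_nonneg[OF f])
  define lev where "lev y = min 1 ((norm y)\<^sup>2) / norm y powr ?N" for y :: "real ^ 'n"
  have lev: "integrable lborel lev" unfolding lev_def[abs_def] by (rule integrable_levy[OF \<alpha>])
  have lev0: "0 \<le> lev y" for y by (simp add: lev_def)
  obtain C1 where C1: "0 < C1" "\<And>x :: real ^ 'n. integrable lborel (\<lambda>z. weight \<alpha> z * weight \<alpha> (x - z))"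
    "\<And>x :: real ^ 'n. (\<integral>z. weight \<alpha> z * weight \<alpha> (x - z) \<partial>lborel) \<le> C1 * weight \<alpha> x"
    using weight_convolution[OF \<alpha>(1), where 'n='n] by blast
  have C1': "integrable lborel (\<lambda>z. weight \<alpha> z * weight \<alpha> (x + z))"
    "(\<integral>z. weight \<alpha> z * weight \<alpha> (x + z) \<partial>lborel) \<le> C1 * weight \<alpha> x" for x :: "real ^ 'n"
    using lborel_integrable_reflect[OF C1(2)[of x], of 0] C1(3)[of x]
      lborel_integral_reflect[of "\<lambda>z. weight \<alpha> z * weight \<alpha> (x - z)" 0] by (simp_all)
  \<comment> \<open>Dominates the integrand; the four terms come from the small \<open>y\<close> and from the three values in the
    second difference at large \<open>y\<close>.\<close>
  define B where "B x y = C * (weight \<alpha> x * lev y + 2 * (2 * weight \<alpha> x * weight \<alpha> y + weight \<alpha> y * weight \<alpha> (x + y) + weight \<alpha> y * weight \<alpha> (x - y)))"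
    for x y :: "real ^ 'n"
  have B: "integrable lborel (B x)" for x
    unfolding B_def[abs_def]
    by (intro integrable_mult_right Bochner_Integration.integrable_add lev C1 C1' integrable_weight \<alpha>)
  have half: "a / 2 \<le> a" if "0 \<le> a" for a :: real using that by simp
  have le: "\<bar>second_diff f x y / (2 * norm y powr ?N)\<bar> \<le> B x y" for x y
  proof -
    have "\<bar>second_diff f x y\<bar> / norm y powr ?N \<le> B x y"
    proof (cases "norm y \<le> 1")
      case True
      then have "\<bar>second_diff f x y\<bar> \<le> C * (norm y)\<^sup>2 * weight \<alpha> x" using f by (auto simp: tame_def)
      then have "\<bar>second_diff f x y\<bar> / norm y powr ?N \<le> C * (norm y)\<^sup>2 * weight \<alpha> x / norm y powr ?N"
        by (intro divide_right_mono) auto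
      also have "\<dots> = C * (weight \<alpha> x * lev y)"
        using True by (simp add: lev_def min_absorb2 power_le_one)
      also have "\<dots> \<le> B x y" unfolding B_def
        using C by (intro mult_left_mono) (auto intro!: add_nonneg_nonneg mult_nonneg_nonneg)
      finally show ?thesis .
    next
      case False
      have fb: "\<bar>f z\<bar> \<le> C * weight \<alpha> z" for z using f by (auto simp: tame_def)
      have "\<bar>second_diff f x y\<bar> \<le> 2 * \<bar>f x\<bar> + \<bar>f (x + y)\<bar> + \<bar>f (x - y)\<bar>" unfolding second_diff_def by linarith
      also have "\<dots> \<le> C * (2 * weight \<alpha> x + weight \<alpha> (x + y) + weight \<alpha> (x - y))"
        using fb[of x] fb[of "x + y"] fb[of "x - y"] by (simp add: algebra_simps)
      finally have "\<bar>second_diff f x y\<bar> * (1 / norm y powr ?N) \<le>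
         (C * (2 * weight \<alpha> x + weight \<alpha> (x + y) + weight \<alpha> (x - y))) * (2 * weight \<alpha> y)"
        using inverse_powr_le_weight[of \<alpha> 1 y] False \<alpha> C
        by (intro mult_mono) (auto intro!: mult_nonneg_nonneg add_nonneg_nonneg)
      also have "\<dots> \<le> B x y"
        unfolding B_def using mult_nonneg_nonneg[OF C mult_nonneg_nonneg[OF weight_pos(2)[of \<alpha> x] lev0[of y]]]
        by (simp add: algebra_simps)
      finally show ?thesis by simp
    qed
    then have "\<bar>second_diff f x y\<bar> / norm y powr ?N / 2 \<le> B x y"
      by (rule order_trans[rotated]) (rule half, simp)
    then show ?thesis by (simp add: abs_mult mult.commute)
  qed
  have int: "integrable lborel (\<lambda>y. second_diff f x y / (2 * norm y powr ?N))" for x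
    by (rule Bochner_Integration.integrable_bound[OF B[of x]])
       (use le in \<open>auto intro!: AE_I2 order_trans[OF _ abs_ge_self]\<close>)
  define K where "K = C * ((\<integral>y. lev y \<partial>lborel) + 2 * (2 * (\<integral>y. weight \<alpha> y \<partial>(lborel :: (real^'n) measure)) + C1 + C1))"
  have "(\<integral>y. \<bar>second_diff f x y / (2 * norm y powr ?N)\<bar> \<partial>lborel) \<le> K * weight \<alpha> x" for x
  proof -
    have "(\<integral>y. \<bar>second_diff f x y / (2 * norm y powr ?N)\<bar> \<partial>lborel) \<le> (\<integral>y. B x y \<partial>lborel)"
      using le by (intro integral_mono B integrable_abs int)
    also have "\<dots> = C * (weight \<alpha> x * (\<integral>y. lev y \<partial>lborel) + 2 * (2 * weight \<alpha> x * (\<integral>y. weight \<alpha> y \<partial>(lborel :: (real^'n) measure)) +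
       (\<integral>y. weight \<alpha> y * weight \<alpha> (x + y) \<partial>lborel) + (\<integral>y. weight \<alpha> y * weight \<alpha> (x - y) \<partial>lborel)))"
      unfolding B_def
      by (simp add: Bochner_Integration.integral_add lev C1 C1' integrable_weight \<alpha>)
    also have "\<dots> \<le> C * (weight \<alpha> x * (\<integral>y. lev y \<partial>lborel) + 2 * (2 * weight \<alpha> x * (\<integral>y. weight \<alpha> y \<partial>(lborel :: (real^'n) measure)) +
       C1 * weight \<alpha> x + C1 * weight \<alpha> x))"
      using C1 C1' C by (intro mult_left_mono add_mono) auto
    also have "\<dots> = K * weight \<alpha> x" by (simp add: K_def algebra_simps)
    finally show ?thesis .
  qed
  with int show thesis by (rule that)
qed

lemma tame_imp_integrable:
  assumes "0 < \<alpha>" "tame \<alpha> C f"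
  shows "integrable lborel f"
proof (rule Bochner_Integration.integrable_bound)
  show "integrable lborel (\<lambda>x. C * weight \<alpha> x)" by (intro integrable_mult_right integrable_weight assms)
  show "AE x in lborel. norm (f x) \<le> norm (C * weight \<alpha> x)"
  proof (intro AE_I2)
    fix x
    have "\<bar>f x\<bar> \<le> C * weight \<alpha> x" using assms(2) by (simp add: tame_def)
    then show "norm (f x) \<le> norm (C * weight \<alpha> x)" by simp
  qed
qed (use tame_measurable[OF assms(2)] in simp)

lemma sym_lap_bound:
  fixes f :: "real ^ 'n \<Rightarrow> real"
  assumes \<alpha>: "0 < \<alpha>" "\<alpha> < 2" and f: "tame \<alpha> C f"
  obtains K where "0 \<le> K" "\<And>x. \<bar>sym_lap \<alpha> f x\<bar> \<le> K * weight \<alpha> x"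
proof -
  obtain K where "\<And>x. integrable lborel (\<lambda>y. second_diff f x y / (2 * norm y powr (real CARD('n) + \<alpha>)))"
    and K: "\<And>x. (\<integral>y. \<bar>second_diff f x y / (2 * norm y powr (real CARD('n) + \<alpha>))\<bar> \<partial>lborel) \<le> K * weight \<alpha> x"
    using tame_levy_integrand[OF \<alpha> f] by blast
  have "\<bar>sym_lap \<alpha> f x\<bar> \<le> \<bar>K\<bar> * weight \<alpha> x" for x
  proof -
    have "\<bar>sym_lap \<alpha> f x\<bar> \<le> K * weight \<alpha> x"
      unfolding sym_lap_def
      using integral_abs_bound[of lborel "\<lambda>y. second_diff f x y / (2 * norm y powr (real CARD('n) + \<alpha>))"] K[of x]
      by (rule order_trans)
    also have "\<dots> \<le> \<bar>K\<bar> * weight \<alpha> x" by (intro mult_right_mono) auto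
    finally show ?thesis .
  qed
  then show thesis using that[of "\<bar>K\<bar>"] by simp
qed

lemma cis_integrable:
  fixes f :: "real ^ 'n \<Rightarrow> real"
  assumes "integrable lborel f"
  shows "integrable lborel (\<lambda>x. of_real (f x) * cis (- (x \<bullet> \<xi>)))"
proof (rule Bochner_Integration.integrable_bound[OF assms])
  have [measurable]: "f \<in> borel_measurable borel" using borel_measurable_integrable[OF assms] by simp
  show "(\<lambda>x. of_real (f x) * cis (- (x \<bullet> \<xi>))) \<in> borel_measurable lborel"
    unfolding cis_conv_exp by measurable
qed (auto simp: norm_mult)

lemma integral_cis_shift:
  fixes f :: "real ^ 'n \<Rightarrow> real"
  assumes "integrable lborel f"
  shows "integrable lborel (\<lambda>x. of_real (f (x + y)) * cis (- (x \<bullet> \<xi>)))"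
    "(\<integral>x. of_real (f (x + y)) * cis (- (x \<bullet> \<xi>)) \<partial>lborel) =
       cis (y \<bullet> \<xi>) * (\<integral>x. of_real (f x) * cis (- (x \<bullet> \<xi>)) \<partial>lborel)"
proof -
  let ?F = "\<lambda>x. of_real (f x) * cis (- (x \<bullet> \<xi>))"
  have eq: "of_real (f (x + y)) * cis (- (x \<bullet> \<xi>)) = cis (y \<bullet> \<xi>) * ?F (y + x)" for x
    by (simp add: inner_add_left cis_mult add.commute mult.left_commute)
  have int: "integrable lborel ?F" by (rule cis_integrable[OF assms])
  show "integrable lborel (\<lambda>x. of_real (f (x + y)) * cis (- (x \<bullet> \<xi>)))"
    unfolding eq by (intro integrable_mult_right lborel_integrable_translate int)
  show "(\<integral>x. of_real (f (x + y)) * cis (- (x \<bullet> \<xi>)) \<partial>lborel) = cis (y \<bullet> \<xi>) * (\<integral>x. ?F x \<partial>lborel)"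
    unfolding eq using borel_measurable_integrable[OF int]
    by (simp add: lborel_integral_translate[of ?F])
qed

text \<open>Fubini's theorem and translation invariance: the second difference in direction \<open>y\<close> multiplies the
Fourier transform by \<open>2 - 2 cos (\<xi> \<bullet> y)\<close>.\<close>

lemma sym_lap_fourier:
  fixes f :: "real ^ 'n \<Rightarrow> real"
  assumes \<alpha>: "0 < \<alpha>" "\<alpha> < 2" and f: "tame \<alpha> C f"
    and \<kappa>: "has_bochner_integral lborel
       (\<lambda>y. (1 - cos (\<xi> \<bullet> y)) / norm y powr (real CARD('n) + \<alpha>)) (\<kappa> * norm \<xi> powr \<alpha>)"
  shows "(\<integral>x. of_real (sym_lap \<alpha> f x) * cis (- (x \<bullet> \<xi>)) \<partial>lborel) =
    of_real (\<kappa> * norm \<xi> powr \<alpha>) * (\<integral>x. of_real (f x) * cis (- (x \<bullet> \<xi>)) \<partial>lborel)"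
proof -
  let ?N = "real CARD('n) + \<alpha>"
  let ?h = "\<lambda>x y. second_diff f x y / (2 * norm y powr ?N)"
  let ?F = "\<integral>x. of_real (f x) * cis (- (x \<bullet> \<xi>)) \<partial>lborel"
  have [measurable]: "f \<in> borel_measurable borel" by (rule tame_measurable[OF f])
  obtain K where K: "\<And>x. integrable lborel (?h x)"
    "\<And>x. (\<integral>y. \<bar>?h x y\<bar> \<partial>lborel) \<le> K * weight \<alpha> x"
    using tame_levy_integrand[OF \<alpha> f] by blast
  have nm: "norm (of_real (?h x y) * cis (- (x \<bullet> \<xi>))) = \<bar>?h x y\<bar>" for x y
    by (simp only: norm_mult norm_of_real norm_cis mult_1_right)
  have "(\<integral>x. of_real (sym_lap \<alpha> f x) * cis (- (x \<bullet> \<xi>)) \<partial>lborel) =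
     (\<integral>x. (\<integral>y. of_real (?h x y) * cis (- (x \<bullet> \<xi>)) \<partial>lborel) \<partial>lborel)"
    unfolding sym_lap_def by (simp only: integral_mult_left_zero integral_complex_of_real)
  also have "\<dots> = (\<integral>y. (\<integral>x. of_real (?h x y) * cis (- (x \<bullet> \<xi>)) \<partial>lborel) \<partial>lborel)"
  proof (rule lborel_swap_integrals)
    show "(\<lambda>(x, y). of_real (?h x y) * cis (- (x \<bullet> \<xi>))) \<in> borel_measurable (borel \<Otimes>\<^sub>M borel)"
      unfolding cis_conv_exp second_diff_def by measurable
    show "integrable lborel (\<lambda>y. of_real (?h x y) * cis (- (x \<bullet> \<xi>)))" for x
      by (intro integrable_mult_left impI integrable_of_real K(1))
    show "integrable lborel (\<lambda>x. K * weight \<alpha> x)" by (intro integrable_mult_right integrable_weight \<alpha>)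
    show "(\<integral>y. norm (of_real (?h x y) * cis (- (x \<bullet> \<xi>))) \<partial>lborel) \<le> K * weight \<alpha> x" for x
      unfolding nm by (rule K(2))
  qed
  also have "\<dots> = (\<integral>y. of_real ((1 - cos (\<xi> \<bullet> y)) / norm y powr ?N) * ?F \<partial>lborel)"
  proof (intro Bochner_Integration.integral_cong refl)
    fix y :: "real ^ 'n"
    note fi = tame_imp_integrable[OF \<alpha>(1) f]
    let ?c = "\<lambda>z x. of_real (f (x + z)) * cis (- (x \<bullet> \<xi>))"
    have c: "integrable lborel (?c z)" "(\<integral>x. ?c z x \<partial>lborel) = cis (z \<bullet> \<xi>) * ?F" for z
      using integral_cis_shift[OF fi, of z \<xi>] by auto
    have "(\<integral>x. of_real (second_diff f x y) * cis (- (x \<bullet> \<xi>)) \<partial>lborel) =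
      (\<integral>x. 2 * ?c 0 x - ?c y x - ?c (- y) x \<partial>lborel)"
      by (intro Bochner_Integration.integral_cong refl) (simp add: second_diff_def algebra_simps)
    also have "\<dots> = 2 * ?F - cis (y \<bullet> \<xi>) * ?F - cis ((- y) \<bullet> \<xi>) * ?F"
      using c[of 0] c[of y] c[of "- y"] by simp
    also have "\<dots> = of_real (2 * (1 - cos (\<xi> \<bullet> y))) * ?F"
    proof -
      have "cis (y \<bullet> \<xi>) + cis ((- y) \<bullet> \<xi>) = of_real (2 * cos (\<xi> \<bullet> y))"
        by (simp add: complex_eq_iff inner_commute)
      then have "2 - cis (y \<bullet> \<xi>) - cis ((- y) \<bullet> \<xi>) = of_real (2 * (1 - cos (\<xi> \<bullet> y)))"
        by (simp add: algebra_simps)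
      then show ?thesis by (simp only: left_diff_distrib[symmetric])
    qed
    finally have eq: "(\<integral>x. of_real (second_diff f x y) * cis (- (x \<bullet> \<xi>)) \<partial>lborel) = of_real (2 * (1 - cos (\<xi> \<bullet> y))) * ?F" .
    have "(\<integral>x. of_real (?h x y) * cis (- (x \<bullet> \<xi>)) \<partial>lborel) =
      (\<integral>x. of_real (1 / (2 * norm y powr ?N)) * (of_real (second_diff f x y) * cis (- (x \<bullet> \<xi>))) \<partial>lborel)"
      by (intro Bochner_Integration.integral_cong refl) simp
    also have "\<dots> = of_real (1 / (2 * norm y powr ?N)) * (of_real (2 * (1 - cos (\<xi> \<bullet> y))) * ?F)"
      by (simp only: integral_mult_right_zero eq)
    also have "\<dots> = of_real (1 / (2 * norm y powr ?N) * (2 * (1 - cos (\<xi> \<bullet> y)))) * ?F"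
      by (simp only: of_real_mult mult.assoc)
    also have "1 / (2 * norm y powr ?N) * (2 * (1 - cos (\<xi> \<bullet> y))) = (2 * (1 - cos (\<xi> \<bullet> y))) / (2 * norm y powr ?N)"
      by (simp only: times_divide_eq_left mult_1_left)
    also have "\<dots> = (1 - cos (\<xi> \<bullet> y)) / norm y powr ?N" by (rule mult_divide_mult_cancel_left) simp
    finally show "(\<integral>x. of_real (?h x y) * cis (- (x \<bullet> \<xi>)) \<partial>lborel) = of_real ((1 - cos (\<xi> \<bullet> y)) / norm y powr ?N) * ?F" .
  qed
  also have "\<dots> = (\<integral>y. of_real ((1 - cos (\<xi> \<bullet> y)) / norm y powr ?N) \<partial>lborel) * ?F"
    by (rule integral_mult_left_zero)
  also have "(\<integral>y. of_real ((1 - cos (\<xi> \<bullet> y)) / norm y powr ?N) \<partial>lborel) = complex_of_real (\<kappa> * norm \<xi> powr \<alpha>)"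
    using has_bochner_integral_integral_eq[OF \<kappa>] by (simp only: integral_complex_of_real)
  finally show ?thesis .
qed

text \<open>On the complement of a ball the integral may be averaged with its reflection in \<open>x\<close>; the symmetric
integrand is integrable on the whole space, so dominated convergence removes the ball.\<close>

lemma pv_integral_eq_sym_lap:
  fixes f :: "real ^ 'n \<Rightarrow> real"
  assumes \<alpha>: "0 < \<alpha>" "\<alpha> < 2" and f: "tame \<alpha> C f"
  shows "pv_integral \<alpha> f x = sym_lap \<alpha> f x"
proof -
  let ?N = "real CARD('n) + \<alpha>"
  let ?h = "\<lambda>y. second_diff f x y / (2 * norm y powr ?N)"
  define P where "P e = (LINT z:(UNIV - ball x e)|lebesgue. (f x - f z) / norm (x - z) powr ?N)" for e
  have [measurable]: "f \<in> borel_measurable borel" by (rule tame_measurable[OF f])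
  have [measurable]: "ball z e \<in> sets borel" for z :: "real ^ 'n" and e by simp
  obtain K where K: "integrable lborel ?h"
    using tame_levy_integrand[OF \<alpha> f] by blast
  have C: "0 \<le> C" by (rule tame_nonneg[OF f])
  have P: "P e = (\<integral>y. indicator (UNIV - ball 0 e) y * ?h y \<partial>lborel)" if e: "0 < e" for e
  proof -
    let ?g = "\<lambda>y. indicator (UNIV - ball 0 e) y * ((f x - f (x + y)) / norm y powr ?N)"
    have [measurable]: "?g \<in> borel_measurable borel" by measurable
    have "P e = (\<integral>z. indicator (UNIV - ball x e) z *\<^sub>R ((f x - f z) / norm (x - z) powr ?N) \<partial>lborel)"
      unfolding P_def set_lebesgue_integral_def
      by (rule integral_completion) measurable
    also have "\<dots> = (\<integral>y. indicator (UNIV - ball x e) (x + y) *\<^sub>R ((f x - f (x + y)) / norm (x - (x + y)) powr ?N) \<partial>lborel)"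
      by (rule lborel_integral_translate[symmetric]) measurable
    also have "\<dots> = (\<integral>y. ?g y \<partial>lborel)"
      by (intro Bochner_Integration.integral_cong refl) (auto simp: indicator_def dist_norm)
    finally have P1: "P e = (\<integral>y. ?g y \<partial>lborel)" .
    have gi: "integrable lborel ?g"
    proof (rule Bochner_Integration.integrable_bound)
      show "integrable lborel (\<lambda>y. 2 * C * ((1 + 1 / e powr ?N) * weight \<alpha> y))"
        using \<alpha> by (intro integrable_mult_right integrable_weight)
      show "AE y in lborel. norm (?g y) \<le> norm (2 * C * ((1 + 1 / e powr ?N) * weight \<alpha> y))"
      proof (intro AE_I2)
        fix y :: "real ^ 'n"
        have fb: "\<bar>f z\<bar> \<le> C" for z
        proof -
          have "\<bar>f z\<bar> \<le> C * weight \<alpha> z" using f by (auto simp: tame_def)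
          also have "\<dots> \<le> C * 1" by (intro mult_left_mono weight_le_1 C)
          finally show ?thesis by simp
        qed
        have "\<bar>f x - f (x + y)\<bar> * (1 / norm y powr ?N) \<le> (2 * C) * ((1 + 1 / e powr ?N) * weight \<alpha> y)" if "e \<le> norm y"
          using fb[of x] fb[of "x + y"] inverse_powr_le_weight[of \<alpha> e y] that e \<alpha> C by (intro mult_mono) auto
        moreover have "0 \<le> 2 * C * ((1 + 1 / e powr ?N) * weight \<alpha> y)"
          using C by (intro mult_nonneg_nonneg add_nonneg_nonneg) auto
        ultimately have "norm (?g y) \<le> 2 * C * ((1 + 1 / e powr ?N) * weight \<alpha> y)"
          by (auto simp: indicator_def abs_mult)
        then show "norm (?g y) \<le> norm (2 * C * ((1 + 1 / e powr ?N) * weight \<alpha> y))"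
          by (rule order_trans) simp
      qed
    qed measurable
    have meas: "?g \<in> borel_measurable borel" by measurable
    have "P e = ((\<integral>y. ?g y \<partial>lborel) + (\<integral>y. ?g (0 - y) \<partial>lborel)) / 2"
      unfolding lborel_integral_reflect[OF meas, of 0] P1 by simp
    also have "\<dots> = (\<integral>y. (?g y + ?g (0 - y)) / 2 \<partial>lborel)"
      using gi lborel_integrable_reflect[OF gi, of 0] by (simp add: Bochner_Integration.integral_add)
    also have "\<dots> = (\<integral>y. indicator (UNIV - ball 0 e) y * ?h y \<partial>lborel)"
      by (intro Bochner_Integration.integral_cong refl)
         (auto simp: indicator_def second_diff_def add_divide_distrib[symmetric] field_simps)
    finally show ?thesis .
  qed
  have "(P \<longlongrightarrow> sym_lap \<alpha> f x) (at_right 0)"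
  proof (rule tendsto_at_right_sequentially[of 0 1])
    fix S :: "nat \<Rightarrow> real"
    assume S: "\<And>n. 0 < S n" "S \<longlonglongrightarrow> 0"
    have "(\<lambda>n. \<integral>y. indicator (UNIV - ball 0 (S n)) y * ?h y \<partial>lborel) \<longlonglongrightarrow> sym_lap \<alpha> f x"
      unfolding sym_lap_def
    proof (rule integral_dominated_convergence[where w="\<lambda>y. \<bar>?h y\<bar>"])
      show "integrable lborel (\<lambda>y. \<bar>?h y\<bar>)" by (intro integrable_abs K)
      show "AE y in lborel. (\<lambda>n. indicator (UNIV - ball 0 (S n)) y * ?h y) \<longlonglongrightarrow> ?h y"
      proof (intro AE_I2)
        fix y :: "real ^ 'n"
        show "(\<lambda>n. indicator (UNIV - ball 0 (S n)) y * ?h y) \<longlonglongrightarrow> ?h y"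
        proof (cases "y = 0")
          case False
          then have "eventually (\<lambda>n. S n < norm y) sequentially"
            using S(2) by (intro order_tendstoD) auto
          then have "eventually (\<lambda>n. indicator (UNIV - ball 0 (S n)) y * ?h y = ?h y) sequentially"
            by (rule eventually_mono) auto
          then show ?thesis by (rule tendsto_eventually)
        qed simp
      qed
      show "AE y in lborel. norm (indicator (UNIV - ball 0 (S n)) y * ?h y) \<le> \<bar>?h y\<bar>" for n
        by (intro AE_I2) (auto simp: indicator_def)
    qed measurable
    then show "(\<lambda>n. P (S n)) \<longlonglongrightarrow> sym_lap \<alpha> f x" by (simp only: P[OF S(1)])
  qed simp
  then show ?thesis
    unfolding pv_integral_def P_def[symmetric] by (intro tendsto_Lim) auto
qed

section \<open>Schwartz functions\<close>

text \<open>The mean value theorem, applied first to \<open>\<lambda>s. p s + p (- s)\<close> and then to \<open>p'\<close>.\<close>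

lemma second_difference_bound:
  fixes p p' p'' :: "real \<Rightarrow> real"
  assumes p: "\<And>s. \<bar>s\<bar> \<le> 1 \<Longrightarrow> (p has_real_derivative p' s) (at s)"
    and p': "\<And>s. \<bar>s\<bar> \<le> 1 \<Longrightarrow> (p' has_real_derivative p'' s) (at s)"
    and B: "\<And>s. \<bar>s\<bar> \<le> 1 \<Longrightarrow> \<bar>p'' s\<bar> \<le> B"
  shows "\<bar>2 * p 0 - p 1 - p (-1)\<bar> \<le> 2 * B"
proof -
  have m: "((\<lambda>s. p (- s)) has_real_derivative - p' (- s)) (at s)" if "\<bar>s\<bar> \<le> 1" for s
    using p[of "- s"] that by (simp add: DERIV_mirror)
  have "\<exists>z. 0 < z \<and> z < 1 \<and> (p 1 + p (- 1)) - (p 0 + p (- 0)) = (1 - 0) * (p' z - p' (- z))"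
    by (intro MVT2[of 0 1 "\<lambda>s. p s + p (- s)"])
       (auto intro!: derivative_eq_intros p m)
  then obtain z where z: "0 < z" "z < 1" "p 1 + p (- 1) - 2 * p 0 = p' z - p' (- z)" by auto
  have "\<exists>y. - z < y \<and> y < z \<and> p' z - p' (- z) = (z - (- z)) * p'' y"
    using z by (intro MVT2) (auto intro!: p')
  then obtain y where y: "- z < y" "y < z" "p' z - p' (- z) = 2 * z * p'' y" by auto
  have "2 * p 0 - p 1 - p (-1) = - (2 * z * p'' y)" using z y by linarith
  then have "\<bar>2 * p 0 - p 1 - p (-1)\<bar> = 2 * z * \<bar>p'' y\<bar>"
    using z by (simp add: abs_mult)
  also have "\<dots> \<le> 2 * 1 * B"
    using z y B[of y] by (intro mult_mono) auto
  finally show ?thesis by simp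
qed

lemma frechet_derivative_partial:
  fixes f :: "real ^ 'n \<Rightarrow> real"
  assumes "f differentiable (at x)"
  shows "(f has_derivative (\<lambda>h. \<Sum>i\<in>UNIV. h $ i * partial i f x)) (at x)"
proof -
  have D: "(f has_derivative frechet_derivative f (at x)) (at x)"
    using assms by (simp add: frechet_derivative_works)
  then have "linear (frechet_derivative f (at x))"
    by (rule has_derivative_linear)
  then have "frechet_derivative f (at x) = (\<lambda>h. \<Sum>i\<in>UNIV. h $ i * partial i f x)"
    apply (intro ext)
    subgoal for h
    by (subst basis_expansion[of h, symmetric])
       (simp add: linear_sum linear_scale partial_def scalar_mult_eq_scaleR)
    done
  with D show ?thesis by simp
qed

lemma partial_line_derivative:
  fixes f :: "real ^ 'n \<Rightarrow> real"
  assumes "f differentiable (at (x + s *\<^sub>R y))"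
  shows "((\<lambda>s. f (x + s *\<^sub>R y)) has_real_derivative (\<Sum>i\<in>UNIV. y $ i * partial i f (x + s *\<^sub>R y))) (at s)"
proof -
  have "((\<lambda>s. f (x + s *\<^sub>R y)) has_derivative
     (\<lambda>h. \<Sum>i\<in>UNIV. (h *\<^sub>R y) $ i * partial i f (x + s *\<^sub>R y))) (at s)"
    by (rule has_derivative_compose[of "\<lambda>s. x + s *\<^sub>R y" "\<lambda>h. h *\<^sub>R y" s UNIV f, OF _ frechet_derivative_partial[OF assms]])
       (auto intro!: derivative_eq_intros)
  moreover have "(\<lambda>h. \<Sum>i\<in>UNIV. (h *\<^sub>R y) $ i * partial i f (x + s *\<^sub>R y)) =
      (*) (\<Sum>i\<in>UNIV. y $ i * partial i f (x + s *\<^sub>R y))"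
    by (auto simp: fun_eq_iff sum_distrib_left mult_ac)
  ultimately show ?thesis
    unfolding has_field_derivative_def by simp
qed

text \<open>The seminorms have integer exponents, while the weight has the exponent \<open>n + \<alpha>\<close>; the exponents zero
and \<open>\<lceil>n + \<alpha>\<rceil>\<close> together dominate it.\<close>

lemma schwartz_decay:
  fixes f :: "real ^ 'n \<Rightarrow> real"
  assumes \<alpha>: "0 < \<alpha>" and f: "f \<in> schwartz"
  obtains M where "0 \<le> M" "\<And>x. \<bar>partials is f x\<bar> \<le> M * weight \<alpha> x"
proof -
  let ?N = "real CARD('n) + \<alpha>"
  define g where "g = partials is f"
  define K where "K = nat \<lceil>?N\<rceil>"
  have K: "?N \<le> real K" unfolding K_def using \<alpha> by linarith
  have b: "bounded (range (\<lambda>x. norm x ^ k * g x))" for k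
    using f unfolding schwartz_def g_def by blast
  obtain M0 where M0: "\<And>x. \<bar>g x\<bar> \<le> M0" using b[of 0] by (auto simp: bounded_iff)
  obtain M1 where M1: "\<And>x. \<bar>norm x ^ K * g x\<bar> \<le> M1" using b[of K] by (auto simp: bounded_iff)
  have M: "0 \<le> M0" "0 \<le> M1" using M0[of 0] M1[of 0] by auto
  have "\<bar>g x\<bar> \<le> (2 * M0 + M1) * weight \<alpha> x" for x
  proof -
    have "norm x powr ?N \<le> 1 + norm x ^ K"
    proof (cases "norm x \<le> 1")
      case True
      then have "norm x powr ?N \<le> 1" using \<alpha> by (intro powr_le1) auto
      then show ?thesis by (simp add: add_increasing2)
    next
      case False
      then have "norm x powr ?N \<le> norm x powr K" using K by (intro powr_mono) auto
      also have "\<dots> = norm x ^ K" using False by (intro powr_realpow) auto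
      finally show ?thesis by simp
    qed
    then have "(1 + norm x powr ?N) * \<bar>g x\<bar> \<le> (2 + norm x ^ K) * \<bar>g x\<bar>"
      by (intro mult_right_mono) auto
    also have "\<dots> = 2 * \<bar>g x\<bar> + \<bar>norm x ^ K * g x\<bar>" by (simp add: algebra_simps abs_mult)
    also have "\<dots> \<le> 2 * M0 + M1" using M0[of x] M1[of x] by linarith
    finally show ?thesis unfolding weight_def
      by (simp add: field_simps add_pos_nonneg)
  qed
  then show thesis using that[of "2 * M0 + M1"] M by (simp add: g_def)
qed

text \<open>The second difference in direction \<open>y\<close> is controlled by the second derivative along the segment from
\<open>x - y\<close> to \<open>x + y\<close>, on which the weight is comparable to its value at \<open>x\<close>.\<close>

lemma schwartz_imp_tame:
  fixes f :: "real ^ 'n \<Rightarrow> real"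
  assumes \<alpha>: "0 < \<alpha>" and f: "f \<in> schwartz"
  obtains C where "tame \<alpha> C f"
proof -
  let ?N = "real CARD('n) + \<alpha>"
  have diff: "partials is f differentiable (at x)" for "is" x
    using f unfolding schwartz_def smooth_def by (auto simp: differentiable_on_def)
  obtain M0 where M0: "0 \<le> M0" "\<And>x. \<bar>f x\<bar> \<le> M0 * weight \<alpha> x"
    using schwartz_decay[OF \<alpha> f, of "[]"] by (auto simp: partials_def)
  have "\<exists>M. \<forall>x. \<bar>partial i (partial j f) x\<bar> \<le> M * weight \<alpha> x" for i j
    using schwartz_decay[OF \<alpha> f, of "[i, j]"] by (auto simp: partials_def)
  then obtain M where M: "\<And>i j x. \<bar>partial i (partial j f) x\<bar> \<le> M i j * weight \<alpha> x" by metis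
  define S where "S = (\<Sum>j\<in>UNIV. \<Sum>i\<in>UNIV. \<bar>M i j\<bar>)"
  have S: "0 \<le> S" unfolding S_def by (intro sum_nonneg) auto
  define A where "A = 2 powr ?N * 2"
  have A: "0 \<le> A" by (simp add: A_def)
  have d2: "\<bar>second_diff f x y\<bar> \<le> 2 * (S * A) * (norm y)\<^sup>2 * weight \<alpha> x" if y: "norm y \<le> 1" for x y
  proof -
    define p where "p s = f (x + s *\<^sub>R y)" for s
    define p' where "p' s = (\<Sum>j\<in>UNIV. y $ j * partial j f (x + s *\<^sub>R y))" for s
    define p'' where "p'' s = (\<Sum>j\<in>UNIV. y $ j * (\<Sum>i\<in>UNIV. y $ i * partial i (partial j f) (x + s *\<^sub>R y)))" for s
    have "\<bar>2 * p 0 - p 1 - p (-1)\<bar> \<le> 2 * ((norm y)\<^sup>2 * (S * (A * weight \<alpha> x)))"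
    proof (rule second_difference_bound)
      fix s :: real assume s: "\<bar>s\<bar> \<le> 1"
      show "(p has_real_derivative p' s) (at s)"
        unfolding p_def[abs_def] p'_def
        by (rule partial_line_derivative) (use diff[of "[]"] in \<open>simp add: partials_def\<close>)
      show "(p' has_real_derivative p'' s) (at s)"
        unfolding p'_def[abs_def] p''_def
        by (intro DERIV_sum DERIV_cmult partial_line_derivative)
           (use diff[of "[i]" for i] in \<open>simp add: partials_def\<close>)
      have "weight \<alpha> (x + s *\<^sub>R y) \<le> 2 powr ?N * (1 + norm (- (s *\<^sub>R y)) powr ?N) * weight \<alpha> (x + s *\<^sub>R y + - (s *\<^sub>R y))"
        by (rule weight_shift[OF \<alpha>])
      also have "\<dots> \<le> A * weight \<alpha> x"
      proof -
        have "norm (- (s *\<^sub>R y)) \<le> 1" using s y by (simp add: mult_le_one)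
        then have "norm (- (s *\<^sub>R y)) powr ?N \<le> 1" using \<alpha> by (intro powr_le1) auto
        then show ?thesis unfolding A_def by (intro mult_mono mult_left_mono) auto
      qed
      finally have w: "weight \<alpha> (x + s *\<^sub>R y) \<le> A * weight \<alpha> x" .
      have yi: "\<bar>y $ i\<bar> \<le> norm y" for i by (rule component_le_norm_cart)
      have "\<bar>p'' s\<bar> \<le> (\<Sum>j\<in>UNIV. \<Sum>i\<in>UNIV. \<bar>y $ j\<bar> * (\<bar>y $ i\<bar> * \<bar>partial i (partial j f) (x + s *\<^sub>R y)\<bar>))"
        unfolding p''_def
        by (intro order_trans[OF sum_abs] sum_mono) (simp add: abs_mult sum_distrib_left[symmetric] mult_left_mono sum_abs order_trans[OF sum_abs] sum_mono)
      also have "\<dots> \<le> (\<Sum>j\<in>UNIV. \<Sum>i\<in>UNIV. norm y * (norm y * (\<bar>M i j\<bar> * (A * weight \<alpha> x))))"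
      proof (intro sum_mono mult_mono yi)
        fix i j
        have "\<bar>partial i (partial j f) (x + s *\<^sub>R y)\<bar> \<le> \<bar>M i j\<bar> * weight \<alpha> (x + s *\<^sub>R y)"
          by (rule order_trans[OF M]) (intro mult_right_mono, auto)
        also have "\<dots> \<le> \<bar>M i j\<bar> * (A * weight \<alpha> x)" using w by (intro mult_left_mono) auto
        finally show "\<bar>partial i (partial j f) (x + s *\<^sub>R y)\<bar> \<le> \<bar>M i j\<bar> * (A * weight \<alpha> x)" .
      qed auto
      also have "\<dots> = (norm y)\<^sup>2 * (S * (A * weight \<alpha> x))"
        by (simp add: S_def sum_distrib_left sum_distrib_right power2_eq_square mult_ac)
      finally show "\<bar>p'' s\<bar> \<le> (norm y)\<^sup>2 * (S * (A * weight \<alpha> x))" .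
    qed
    then show ?thesis by (simp add: p_def second_diff_def mult_ac)
  qed
  have "continuous_on UNIV f"
    using diff[of "[]"] by (intro differentiable_imp_continuous_on) (auto simp: differentiable_on_def partials_def)
  moreover have "\<bar>f x\<bar> \<le> (M0 + 2 * (S * A)) * weight \<alpha> x" for x
    using S A by (intro order_trans[OF M0(2)] mult_right_mono) auto
  moreover have "\<bar>second_diff f x y\<bar> \<le> (M0 + 2 * (S * A)) * (norm y)\<^sup>2 * weight \<alpha> x" if "norm y \<le> 1" for x y
    using M0(1) by (intro order_trans[OF d2[OF that]] mult_right_mono) auto
  ultimately show thesis using that[of "M0 + 2 * (S * A)"] unfolding tame_def by blast
qed

section \<open>Bump functions\<close>

text \<open>The derivatives of \<open>exp (- 1 / t)\<close>, extended by zero, are combinations of these functions; the index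
\<open>k\<close> makes the family closed under differentiation.\<close>

definition flat_exp :: "nat \<Rightarrow> real \<Rightarrow> real" where
  "flat_exp k t = (if 0 < t then exp (- (1 / t)) / t ^ k else 0)"

lemma flat_exp_tendsto_0: "(flat_exp k \<longlongrightarrow> 0) (at 0)"
proof -
  have "((\<lambda>x. x ^ k / exp x) \<longlongrightarrow> (0::real)) at_top" by (rule tendsto_power_div_exp_0)
  then have "((\<lambda>t. inverse t ^ k / exp (inverse t)) \<longlongrightarrow> (0::real)) (at_right 0)"
    by (rule filterlim_compose[OF _ filterlim_inverse_at_top_right])
  moreover have "eventually (\<lambda>t. inverse t ^ k / exp (inverse t) = flat_exp k t) (at_right 0)"
    by (rule eventually_at_right_less[THEN eventually_mono])
       (simp add: flat_exp_def exp_minus field_simps)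
  ultimately have "(flat_exp k \<longlongrightarrow> 0) (at_right 0)" by (rule Lim_transform_eventually)
  moreover have "(flat_exp k \<longlongrightarrow> 0) (at_left 0)"
    by (rule tendsto_eventually) (auto simp: flat_exp_def eventually_at_filter)
  ultimately show ?thesis by (simp add: filterlim_split_at)
qed

lemma flat_derivative:
  "(flat_exp k has_real_derivative flat_exp (k + 2) t - real k * flat_exp (k + 1) t) (at t)"
proof -
  consider "t > 0" | "t < 0" | "t = 0" by linarith
  then show ?thesis
  proof cases
    case 1
    have "((\<lambda>t. exp (- (1 / t)) / t ^ k) has_real_derivative flat_exp (k + 2) t - real k * flat_exp (k + 1) t) (at t)"
    proof -
      have "((\<lambda>t. exp (- (1 / t)) / t ^ k) has_real_derivative
         (exp (- (1 / t)) * (1 / t\<^sup>2) * t ^ k - exp (- (1 / t)) * (real k * t ^ (k - 1))) / (t ^ k * t ^ k)) (at t)"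
        using 1 by (auto intro!: derivative_eq_intros simp: power2_eq_square)
      moreover have "(exp (- (1 / t)) * (1 / t\<^sup>2) * t ^ k - exp (- (1 / t)) * (real k * t ^ (k - 1))) / (t ^ k * t ^ k) =
          flat_exp (k + 2) t - real k * flat_exp (k + 1) t"
        using 1 by (cases k) (auto simp: flat_exp_def field_simps power2_eq_square)
      ultimately show ?thesis by simp
    qed
    then show ?thesis
      by (rule has_field_derivative_transform_within_open[where S="{0<..}"]) (use 1 in \<open>auto simp: flat_exp_def\<close>)
  next
    case 2
    have "((\<lambda>t. 0) has_real_derivative flat_exp (k + 2) t - real k * flat_exp (k + 1) t) (at t)"
      using 2 by (auto simp: flat_exp_def)
    then show ?thesis
      by (rule has_field_derivative_transform_within_open[where S="{..<0}"]) (use 2 in \<open>auto simp: flat_exp_def\<close>)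
  next
    case 3
    have "((\<lambda>h. (flat_exp k (0 + h) - flat_exp k 0) / h) \<longlongrightarrow> 0) (at 0)"
      by (rule Lim_transform_eventually[OF flat_exp_tendsto_0[of "k + 1"]])
         (auto simp: flat_exp_def eventually_at_filter)
    then show ?thesis unfolding DERIV_def using 3 by (simp add: flat_exp_def)
  qed
qed

text \<open>A class of functions supported in the closed ball of radius \<open>e\<close> about \<open>b\<close> that is closed under
partial derivatives. Closure under multiplication by coordinates is what the chain rule requires. Smoothness
of every member then follows by induction on the number of derivatives.\<close>

inductive_set bumps :: "real ^ 'n::finite \<Rightarrow> real \<Rightarrow> (real ^ 'n \<Rightarrow> real) set"
  for b :: "real ^ 'n::finite" and e :: real where
  bumps_flat: "(\<lambda>x. flat_exp k (e\<^sup>2 - (x - b) \<bullet> (x - b))) \<in> bumps b e"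
| bumps_mult: "f \<in> bumps b e \<Longrightarrow> (\<lambda>x. (x - b) $ i * f x) \<in> bumps b e"
| bumps_add: "f \<in> bumps b e \<Longrightarrow> g \<in> bumps b e \<Longrightarrow> (\<lambda>x. f x + g x) \<in> bumps b e"
| bumps_scale: "f \<in> bumps b e \<Longrightarrow> (\<lambda>x. c * f x) \<in> bumps b e"

text \<open>The induction gives differentiability and closure under partial derivatives at once, since the product rule
needs both for the factor.\<close>

lemma bumps_derivative:
  assumes "f \<in> bumps b e"
  shows "\<exists>D. (\<forall>x. (f has_derivative D x) (at x)) \<and> (\<forall>j. (\<lambda>x. D x (axis j 1)) \<in> bumps b e)"
  using assms
proof induction
  case (bumps_flat k)
  define d where "d x = flat_exp (k + 2) (e\<^sup>2 - (x - b) \<bullet> (x - b)) - real k * flat_exp (k + 1) (e\<^sup>2 - (x - b) \<bullet> (x - b))" for x :: "real ^ 'a"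
  have 1: "((\<lambda>x. flat_exp k (e\<^sup>2 - (x - b) \<bullet> (x - b))) has_derivative (\<lambda>h. d x * (- 2 * ((x - b) \<bullet> h)))) (at x)" for x
    unfolding d_def
    by (rule has_derivative_compose[of "\<lambda>x. e\<^sup>2 - (x - b) \<bullet> (x - b)" _ x UNIV "flat_exp k", OF _ flat_derivative[unfolded has_field_derivative_def]])
       (auto intro!: derivative_eq_intros simp: inner_commute)
  have 2: "(\<lambda>x. d x * (- 2 * ((x - b) \<bullet> axis j 1))) \<in> bumps b e" for j
  proof -
    have "(\<lambda>x. (- 2) * ((x - b) $ j * (flat_exp (k + 2) (e\<^sup>2 - (x - b) \<bullet> (x - b)) + (- real k) * flat_exp (k + 1) (e\<^sup>2 - (x - b) \<bullet> (x - b))))) \<in> bumps b e"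
      by (intro bumps.intros)
    also have "(\<lambda>x. (- 2) * ((x - b) $ j * (flat_exp (k + 2) (e\<^sup>2 - (x - b) \<bullet> (x - b)) + (- real k) * flat_exp (k + 1) (e\<^sup>2 - (x - b) \<bullet> (x - b))))) =
       (\<lambda>x. d x * (- 2 * ((x - b) \<bullet> axis j 1)))"
      by (auto simp: fun_eq_iff d_def inner_axis algebra_simps)
    finally show ?thesis .
  qed
  show ?case using 1 2 by (intro exI[of _ "\<lambda>x h. d x * (- 2 * ((x - b) \<bullet> h))"]) blast
next
  case (bumps_mult f i)
  then obtain D where D: "\<And>x. (f has_derivative D x) (at x)" "\<And>j. (\<lambda>x. D x (axis j 1)) \<in> bumps b e" by blast
  have 1: "((\<lambda>x. (x - b) $ i * f x) has_derivative (\<lambda>h. (x - b) $ i * D x h + h $ i * f x)) (at x)" for x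
    by (auto intro!: derivative_eq_intros D bounded_linear.has_derivative[OF bounded_linear_vec_nth] simp del: vector_minus_component)
  have 2: "(\<lambda>x. (x - b) $ i * D x (axis j 1) + axis j 1 $ i * f x) \<in> bumps b e" for j
    by (intro bumps.intros D bumps_mult)
  show ?case using 1 2 by (intro exI[of _ "\<lambda>x h. (x - b) $ i * D x h + h $ i * f x"]) blast
next
  case (bumps_add f g)
  then obtain D E where D: "\<And>x. (f has_derivative D x) (at x)" "\<And>j. (\<lambda>x. D x (axis j 1)) \<in> bumps b e"
    and E: "\<And>x. (g has_derivative E x) (at x)" "\<And>j. (\<lambda>x. E x (axis j 1)) \<in> bumps b e" by blast
  show ?case using D E
    by (intro exI[of _ "\<lambda>x h. D x h + E x h"]) (auto intro!: derivative_eq_intros bumps.intros)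
next
  case (bumps_scale f c)
  then obtain D where D: "\<And>x. (f has_derivative D x) (at x)" "\<And>j. (\<lambda>x. D x (axis j 1)) \<in> bumps b e" by blast
  show ?case using D
    by (intro exI[of _ "\<lambda>x h. c * D x h"]) (auto intro!: derivative_eq_intros bumps.intros)
qed

lemma bumps_differentiable: "f \<in> bumps b e \<Longrightarrow> f differentiable (at x)"
  using bumps_derivative by (metis differentiable_def)

lemma bumps_partial: "f \<in> bumps b e \<Longrightarrow> partial j f \<in> bumps b e"
proof -
  assume "f \<in> bumps b e"
  then obtain D where D: "\<And>x. (f has_derivative D x) (at x)" "(\<lambda>x. D x (axis j 1)) \<in> bumps b e"
    using bumps_derivative by blast
  have "partial j f = (\<lambda>x. D x (axis j 1))"
    by (intro ext) (simp add: partial_def frechet_derivative_at[OF D(1), symmetric])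
  with D show ?thesis by simp
qed

lemma bumps_partials: "f \<in> bumps b e \<Longrightarrow> partials is f \<in> bumps b e"
  unfolding partials_def by (induction "is") (auto intro: bumps_partial)

lemma bumps_support:
  assumes "f \<in> bumps b e" "0 < e" "e \<le> norm (x - b)"
  shows "f x = 0"
  using assms(1)
proof induction
  case (bumps_flat k)
  have "e\<^sup>2 \<le> (norm (x - b))\<^sup>2" using assms by (intro power_mono) auto
  then show ?case by (simp add: flat_exp_def power2_norm_eq_inner)
qed auto

lemma bumps_smooth: "f \<in> bumps b e \<Longrightarrow> smooth f"
  unfolding smooth_def differentiable_on_def
  using bumps_partials bumps_differentiable differentiable_at_withinI by blast

lemma bumps_test_function: 
  assumes "f \<in> bumps b e" "0 < e"
  shows "f \<in> test_functions"
proof -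
  have "{x. f x \<noteq> 0} \<subseteq> cball b e"
  proof (intro subsetI, rule ccontr)
    fix x assume "x \<in> {x. f x \<noteq> 0}" "x \<notin> cball b e"
    then show False using bumps_support[OF assms, of x] by (simp add: dist_norm norm_minus_commute)
  qed
  then have "bounded {x. f x \<noteq> 0}" by (rule bounded_subset[OF bounded_cball])
  then show ?thesis using bumps_smooth[OF assms(1)] by (simp add: test_functions_def)
qed

lemma bumps_schwartz:
  assumes "f \<in> bumps b e" "0 < e"
  shows "f \<in> schwartz"
proof -
  have "bounded (range (\<lambda>x. norm x ^ k * partials is f x))" for k "is"
  proof -
    let ?g = "\<lambda>x. norm x ^ k * partials is f x"
    have g: "partials is f \<in> bumps b e" by (rule bumps_partials[OF assms(1)])
    have "continuous_on UNIV (partials is f)"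
      using bumps_differentiable[OF g] by (intro differentiable_imp_continuous_on) (auto simp: differentiable_on_def)
    then have "continuous_on (cball b e) ?g"
      by (intro continuous_intros) (auto intro: continuous_on_subset)
    then have "bounded (?g ` cball b e)"
      by (intro compact_imp_bounded compact_continuous_image) auto
    moreover have "range ?g \<subseteq> insert 0 (?g ` cball b e)"
    proof (intro subsetI, elim rangeE)
      fix z x assume z: "z = ?g x"
      show "z \<in> insert 0 (?g ` cball b e)"
      proof (cases "x \<in> cball b e")
        case False
        then have "partials is f x = 0"
          using bumps_support[OF g assms(2), of x] by (simp add: dist_norm norm_minus_commute)
        then show ?thesis using z by simp
      qed (use z in blast)
    qed
    ultimately show ?thesis by (meson bounded_insert bounded_subset)
  qed
  then show ?thesis using bumps_smooth[OF assms(1)] by (simp add: schwartz_def)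
qed

definition bump :: "real \<Rightarrow> real ^ 'n::finite \<Rightarrow> real" where
  "bump e x = flat_exp 0 (e\<^sup>2 - x \<bullet> x)"

text \<open>Translates of the reflected bump occur in convolutions, and they have to be test functions.\<close>

lemma bump_translate: "(\<lambda>x. bump e (b - x)) \<in> bumps b e"
proof -
  have "(b - x) \<bullet> (b - x) = (x - b) \<bullet> (x - b)" for x by (simp add: inner_diff inner_commute)
  then have "(\<lambda>x. bump e (b - x)) = (\<lambda>x. flat_exp 0 (e\<^sup>2 - (x - b) \<bullet> (x - b)))"
    by (simp add: bump_def)
  then show ?thesis by (simp add: bumps_flat)
qed

lemma bump_minus [simp]: "bump e (- x) = bump e x"
  by (simp add: bump_def)

lemma bump_bumps: "bump e \<in> bumps 0 e"
  using bump_translate[of e 0] by simp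

lemma bump_nonneg [simp]: "0 \<le> bump e x"
  by (simp add: bump_def flat_exp_def)

lemma bump_eq_0: "0 < e \<Longrightarrow> e \<le> norm x \<Longrightarrow> bump e x = 0"
  using bumps_support[OF bump_bumps, of e x] by simp

lemma bump_continuous: "continuous_on UNIV (bump e)"
  using bumps_differentiable[OF bump_bumps[of e]]
  by (intro differentiable_imp_continuous_on) (auto simp: differentiable_on_def)

lemma bump_measurable [measurable]: "bump e \<in> borel_measurable borel"
  by (rule borel_measurable_continuous_onI[OF bump_continuous])

section \<open>The normalizing constant\<close>

lemma integral_continuous_pos:
  fixes f :: "'a::euclidean_space \<Rightarrow> real"
  assumes f: "continuous_on UNIV f" "\<And>x. 0 \<le> f x" "integrable lborel f" and x: "0 < f x"
  shows "0 < (\<integral>x. f x \<partial>lborel)"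
proof (rule ccontr)
  have nn: "0 \<le> (\<integral>x. f x \<partial>lborel)" by (intro integral_nonneg_AE AE_I2 f(2))
  assume "\<not> 0 < (\<integral>x. f x \<partial>lborel)"
  then have "(\<integral>x. f x \<partial>lborel) = 0"
    using nn by linarith
  then have ae: "AE x in lborel. f x = 0"
    using integral_nonneg_eq_0_iff_AE[OF f(3)] f(2) by simp
  have "open {x. 0 < f x}" using f(1) by (simp add: open_Collect_less continuous_on_const)
  moreover have "{x. 0 < f x} \<noteq> {}" using x by auto
  ultimately have "\<not> negligible {x. 0 < f x}" by (rule open_not_negligible)
  moreover have "negligible {x. 0 < f x}"
    unfolding negligible_iff_null_sets
  proof (rule AE_iff_null_sets[THEN iffD2])
    show "{x. 0 < f x} \<in> sets lebesgue" using \<open>open {x. 0 < f x}\<close> by auto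
    show "AE x in lebesgue. x \<notin> {x. 0 < f x}"
      using AE_completion[OF ae] by eventually_elim simp
  qed
  ultimately show False by simp
qed

lemma bump_integrable:
  assumes "0 < e"
  shows "integrable lborel (bump e :: real ^ 'n \<Rightarrow> real)"
proof -
  obtain C where "tame 1 C (bump e :: real ^ 'n \<Rightarrow> real)"
    using schwartz_imp_tame[OF _ bumps_schwartz[OF bump_bumps assms], of 1] by auto
  then show ?thesis using tame_imp_integrable[of 1] by simp
qed

lemma bump_integral_pos:
  assumes "0 < e"
  shows "0 < (\<integral>x. bump e (x :: real ^ 'n) \<partial>lborel)"
  by (rule integral_continuous_pos[OF bump_continuous bump_nonneg bump_integrable[OF assms], of 0])
     (use assms in \<open>simp add: bump_def flat_exp_def\<close>)

text \<open>Every candidate constant \<open>C\<close> multiplies the Fourier transform by \<open>C \<kappa> |\<xi>|\<^sup>\<alpha>\<close>, where \<open>\<kappa>\<close> comes from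
\<open>fractional_symbol\<close>; so \<open>1 / \<kappa>\<close> is one possible value. It is the only one as soon as some Schwartz function has a
Fourier transform that does not vanish at some \<open>\<xi> \<noteq> 0\<close>. The bump function on the unit ball is one: for
\<open>|\<xi>| = 1\<close>, the cosine is positive on its support.\<close>

lemma frac_const_pos:
  assumes \<alpha>: "0 < \<alpha>" "\<alpha> < 2"
  shows "0 < frac_const TYPE('n::finite) \<alpha>"
proof -
  let ?S = "schwartz :: (real ^ 'n \<Rightarrow> real) set"
  obtain \<kappa> where \<kappa>: "0 < \<kappa>" "\<And>\<xi> :: real ^ 'n. has_bochner_integral lborel
       (\<lambda>y. (1 - cos (\<xi> \<bullet> y)) / norm y powr (real CARD('n) + \<alpha>)) (\<kappa> * norm \<xi> powr \<alpha>)"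
    using fractional_symbol[OF \<alpha>, where 'n='n] by blast
  have fourier_lborel: "fourier g \<xi> = (\<integral>x. of_real (g x) * cis (- (x \<bullet> \<xi>)) \<partial>lborel)"
    if [measurable]: "g \<in> borel_measurable borel" for g and \<xi> :: "real ^ 'n"
    unfolding fourier_def cis_conv_exp by (rule integral_completion) measurable
  have key: "fourier (\<lambda>x. C * pv_integral \<alpha> \<phi> x) \<xi> = of_real (C * \<kappa> * norm \<xi> powr \<alpha>) * fourier \<phi> \<xi>"
    if \<phi>: "\<phi> \<in> ?S" for C \<phi> \<xi>
  proof -
    obtain M where M: "tame \<alpha> M \<phi>" using schwartz_imp_tame[OF \<alpha>(1) \<phi>] .
    have [measurable]: "\<phi> \<in> borel_measurable borel" by (rule tame_measurable[OF M])
    have "fourier (\<lambda>x. C * pv_integral \<alpha> \<phi> x) \<xi> = (\<integral>x. of_real (C * sym_lap \<alpha> \<phi> x) * cis (- (x \<bullet> \<xi>)) \<partial>lborel)"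
      by (subst fourier_lborel) (simp_all add: pv_integral_eq_sym_lap[OF \<alpha> M])
    also have "\<dots> = of_real C * (\<integral>x. of_real (sym_lap \<alpha> \<phi> x) * cis (- (x \<bullet> \<xi>)) \<partial>lborel)"
      by (simp only: of_real_mult mult.assoc integral_mult_right_zero)
    also have "\<dots> = of_real (C * \<kappa> * norm \<xi> powr \<alpha>) * fourier \<phi> \<xi>"
      by (simp add: sym_lap_fourier[OF \<alpha> M \<kappa>(2)] fourier_lborel)
    finally show ?thesis .
  qed
  define \<rho> where "\<rho> = (bump 1 :: real ^ 'n \<Rightarrow> real)"
  have \<rho>: "\<rho> \<in> ?S" unfolding \<rho>_def by (rule bumps_schwartz[OF bump_bumps]) simp
  \<comment> \<open>Any unit vector will do; on the support of \<open>\<rho>\<close> the inner product is then at most \<open>1 < \<pi> / 2\<close>.\<close>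
  define \<xi> where "\<xi> = (axis undefined 1 :: real ^ 'n)"
  have \<xi>: "norm \<xi> = 1" by (simp add: \<xi>_def)
  have int: "integrable lborel (\<lambda>x. of_real (\<rho> x) * cis (- (x \<bullet> \<xi>)))"
    by (rule cis_integrable) (simp add: \<rho>_def bump_integrable)
  have "Re (fourier \<rho> \<xi>) = (\<integral>x. \<rho> x * cos (x \<bullet> \<xi>) \<partial>lborel)"
    using int by (subst fourier_lborel) (simp_all add: \<rho>_def flip: integral_Re)
  also have "0 < \<dots>"
  proof (rule integral_continuous_pos[of _ 0])
    show "continuous_on UNIV (\<lambda>x. \<rho> x * cos (x \<bullet> \<xi>))"
      unfolding \<rho>_def by (intro continuous_intros bump_continuous)
    show "0 \<le> \<rho> x * cos (x \<bullet> \<xi>)" for x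
    proof (cases "norm x < 1")
      case True
      have "\<bar>x \<bullet> \<xi>\<bar> \<le> norm x * norm \<xi>" by (rule Cauchy_Schwarz_ineq2)
      then have "\<bar>x \<bullet> \<xi>\<bar> \<le> 1" using True \<xi> by simp
      then have "0 \<le> cos (x \<bullet> \<xi>)" using pi_gt3 by (intro cos_ge_zero) linarith+
      then show ?thesis by (simp add: \<rho>_def)
    qed (simp add: \<rho>_def bump_eq_0)
    show "integrable lborel (\<lambda>x. \<rho> x * cos (x \<bullet> \<xi>))"
      using integrable_Re[OF int] by simp
    show "0 < \<rho> 0 * cos (0 \<bullet> \<xi>)" by (simp add: \<rho>_def bump_def flat_exp_def)
  qed
  finally have nz: "fourier \<rho> \<xi> \<noteq> 0" by auto
  have "frac_const TYPE('n) \<alpha> = 1 / \<kappa>"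
    unfolding frac_const_def
  proof (rule the_equality)
    show "1 / \<kappa> > 0 \<and> (\<forall>\<phi>\<in>?S. \<forall>\<xi>. fourier (\<lambda>x. 1 / \<kappa> * pv_integral \<alpha> \<phi> x) \<xi> = norm \<xi> powr \<alpha> * fourier \<phi> \<xi>)"
      using \<kappa>(1) by (auto simp only: key) auto
    fix C assume "C > 0 \<and> (\<forall>\<phi>\<in>?S. \<forall>\<xi>. fourier (\<lambda>x. C * pv_integral \<alpha> \<phi> x) \<xi> = norm \<xi> powr \<alpha> * fourier \<phi> \<xi>)"
    then have "fourier (\<lambda>x. C * pv_integral \<alpha> \<rho> x) \<xi> = norm \<xi> powr \<alpha> * fourier \<rho> \<xi>" using \<rho> by blast
    then have "of_real (C * \<kappa>) = (1::complex)" using nz \<xi> by (simp add: key[OF \<rho>])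
    then have "C * \<kappa> = 1" using of_real_eq_1_iff by blast
    then show "C = 1 / \<kappa>" using \<kappa>(1) by (simp add: field_simps)
  qed
  then show ?thesis using \<kappa>(1) by simp
qed

section \<open>Functions annihilated by \<alpha>-harmonic functions\<close>

text \<open>The convolution of an inverse Fourier transform \<open>f\<close> of \<open>m\<close> with an integrable function, again by
Fubini's theorem.\<close>

lemma convolution_fourier:
  fixes f h m :: "real ^ 'n \<Rightarrow> real"
  assumes m: "integrable lborel m" and h: "integrable lborel h"
    and F: "\<And>x. of_real (f x) = (\<integral>\<xi>. of_real (m \<xi>) * cis (x \<bullet> \<xi>) \<partial>lborel)"
  shows "of_real (\<integral>w. f (x - w) * h w \<partial>lborel) =
    (\<integral>\<xi>. of_real (m \<xi>) * cis (x \<bullet> \<xi>) * (\<integral>w. of_real (h w) * cis (- (w \<bullet> \<xi>)) \<partial>lborel) \<partial>lborel)"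
proof -
  have [measurable]: "m \<in> borel_measurable borel" "h \<in> borel_measurable borel"
    using borel_measurable_integrable[OF m] borel_measurable_integrable[OF h] by auto
  let ?k = "\<lambda>w \<xi>. of_real (m \<xi>) * cis ((x - w) \<bullet> \<xi>) * of_real (h w)"
  have nm: "norm (?k w \<xi>) = \<bar>h w\<bar> * \<bar>m \<xi>\<bar>" for w \<xi>
    by (simp only: norm_mult norm_of_real norm_cis mult_1_right mult.commute)
  have "complex_of_real (\<integral>w. f (x - w) * h w \<partial>lborel) = (\<integral>w. of_real (f (x - w)) * of_real (h w) \<partial>lborel)"
    by (simp only: integral_complex_of_real[symmetric] of_real_mult)
  also have "\<dots> = (\<integral>w. (\<integral>\<xi>. ?k w \<xi> \<partial>lborel) \<partial>lborel)"
    by (simp only: F integral_mult_left_zero)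
  also have "\<dots> = (\<integral>\<xi>. (\<integral>w. ?k w \<xi> \<partial>lborel) \<partial>lborel)"
  proof (rule lborel_swap_integrals)
    show meas: "(\<lambda>(w, \<xi>). ?k w \<xi>) \<in> borel_measurable (borel \<Otimes>\<^sub>M borel)"
      unfolding cis_conv_exp by measurable
    show "integrable lborel (?k w)" for w
    proof (rule integrable_dominated)
      show "integrable lborel (\<lambda>\<xi>. \<bar>h w\<bar> * \<bar>m \<xi>\<bar>)" by (intro integrable_mult_right integrable_abs m)
      show "?k w \<in> borel_measurable borel" unfolding cis_conv_exp by measurable
    qed (simp only: nm)
    show "integrable lborel (\<lambda>w. \<bar>h w\<bar> * (\<integral>\<xi>. \<bar>m \<xi>\<bar> \<partial>lborel))"
      by (intro integrable_mult_left integrable_abs h)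
    show "(\<integral>\<xi>. norm (?k w \<xi>) \<partial>lborel) \<le> \<bar>h w\<bar> * (\<integral>\<xi>. \<bar>m \<xi>\<bar> \<partial>lborel)" for w
      by (simp only: nm integral_mult_right_zero order_refl)
  qed
  also have "\<dots> = (\<integral>\<xi>. of_real (m \<xi>) * cis (x \<bullet> \<xi>) * (\<integral>w. of_real (h w) * cis (- (w \<bullet> \<xi>)) \<partial>lborel) \<partial>lborel)"
  proof (intro Bochner_Integration.integral_cong refl)
    fix \<xi>
    have "?k w \<xi> = (of_real (m \<xi>) * cis (x \<bullet> \<xi>)) * (of_real (h w) * cis (- (w \<bullet> \<xi>)))" for w
    proof -
      have "cis ((x - w) \<bullet> \<xi>) = cis (x \<bullet> \<xi>) * cis (- (w \<bullet> \<xi>))"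
        by (simp add: cis_mult inner_diff_left)
      then show ?thesis by (simp only: mult_ac)
    qed
    then show "(\<integral>w. ?k w \<xi> \<partial>lborel) = of_real (m \<xi>) * cis (x \<bullet> \<xi>) * (\<integral>w. of_real (h w) * cis (- (w \<bullet> \<xi>)) \<partial>lborel)"
      by (simp only: integral_mult_right_zero)
  qed
  finally show ?thesis .
qed

lemma sym_lap_integrable:
  fixes f :: "real ^ 'n \<Rightarrow> real"
  assumes \<alpha>: "0 < \<alpha>" "\<alpha> < 2" and f: "tame \<alpha> C f"
  shows "integrable lborel (sym_lap \<alpha> f)"
proof -
  have [measurable]: "f \<in> borel_measurable borel" by (rule tame_measurable[OF f])
  obtain K where K: "0 \<le> K" "\<And>x. \<bar>sym_lap \<alpha> f x\<bar> \<le> K * weight \<alpha> x" using sym_lap_bound[OF \<alpha> f] by blast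
  show ?thesis
    by (rule integrable_dominated[where g="\<lambda>x. K * weight \<alpha> x"])
       (use K integrable_weight[OF \<alpha>(1)] in auto)
qed

text \<open>The identity \<open>f * (-\<Delta>)\<^sup>\<alpha>\<^sup>/\<^sup>2 \<phi> = ((-\<Delta>)\<^sup>\<alpha>\<^sup>/\<^sup>2 f) * \<phi>\<close>, read off on the Fourier side. The function \<open>g\<close>
plays the role of the fractional Laplacian of \<open>f\<close>, up to the constant \<open>\<kappa>\<close>.\<close>

lemma convolution_sym_lap:
  fixes f g m \<phi> :: "real ^ 'n \<Rightarrow> real"
  assumes \<alpha>: "0 < \<alpha>" "\<alpha> < 2" and \<phi>: "tame \<alpha> C \<phi>"
    and \<kappa>: "\<And>\<xi> :: real ^ 'n. has_bochner_integral lborel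
       (\<lambda>y. (1 - cos (\<xi> \<bullet> y)) / norm y powr (real CARD('n) + \<alpha>)) (\<kappa> * norm \<xi> powr \<alpha>)"
    and m: "integrable lborel m" "integrable lborel (\<lambda>\<xi>. norm \<xi> powr \<alpha> * m \<xi>)"
    and F: "\<And>x. of_real (f x) = (\<integral>\<xi>. of_real (m \<xi>) * cis (x \<bullet> \<xi>) \<partial>lborel)"
    and G: "\<And>x. of_real (g x) = (\<integral>\<xi>. of_real (norm \<xi> powr \<alpha> * m \<xi>) * cis (x \<bullet> \<xi>) \<partial>lborel)"
  shows "(\<integral>w. f (x - w) * sym_lap \<alpha> \<phi> w \<partial>lborel) = \<kappa> * (\<integral>w. g (x - w) * \<phi> w \<partial>lborel)"
proof -
  let ?\<phi> = "\<lambda>\<xi>. \<integral>w. of_real (\<phi> w) * cis (- (w \<bullet> \<xi>)) \<partial>lborel"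
  have "complex_of_real (\<integral>w. f (x - w) * sym_lap \<alpha> \<phi> w \<partial>lborel) =
    (\<integral>\<xi>. of_real (m \<xi>) * cis (x \<bullet> \<xi>) * (of_real (\<kappa> * norm \<xi> powr \<alpha>) * ?\<phi> \<xi>) \<partial>lborel)"
    unfolding convolution_fourier[OF m(1) sym_lap_integrable[OF \<alpha> \<phi>] F] sym_lap_fourier[OF \<alpha> \<phi> \<kappa>] ..
  also have "\<dots> = (\<integral>\<xi>. of_real \<kappa> * (of_real (norm \<xi> powr \<alpha> * m \<xi>) * cis (x \<bullet> \<xi>) * ?\<phi> \<xi>) \<partial>lborel)"
    by (simp only: of_real_mult mult_ac)
  also have "\<dots> = of_real \<kappa> * complex_of_real (\<integral>w. g (x - w) * \<phi> w \<partial>lborel)"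
    unfolding convolution_fourier[OF m(2) tame_imp_integrable[OF \<alpha>(1) \<phi>] G] by (rule integral_mult_right_zero)
  finally show ?thesis by (simp only: of_real_mult[symmetric] of_real_eq_iff)
qed

lemma weight_reflect:
  fixes a :: "real ^ 'n"
  assumes "0 < \<alpha>"
  obtains A where "0 \<le> A" "\<And>x. weight \<alpha> (a - x) \<le> A * weight \<alpha> x"
proof -
  let ?N = "real CARD('n) + \<alpha>"
  have "weight \<alpha> (a - x) \<le> 2 powr ?N * (1 + norm a powr ?N) * weight \<alpha> x" for x
    using weight_shift[OF assms, of "x - a" a] by (simp add: weight_commute)
  then show thesis by (rule that[rotated]) auto
qed

lemma weight_weighted_integrable:
  fixes u g :: "real ^ 'n \<Rightarrow> real"
  assumes \<alpha>: "0 < \<alpha>" and [measurable]: "u \<in> borel_measurable borel" "g \<in> borel_measurable borel"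
    and u: "integrable lborel (\<lambda>x. u x * weight \<alpha> x)"
    and g: "\<And>x. \<bar>g x\<bar> \<le> C * weight \<alpha> x"
  shows "integrable lborel (\<lambda>x. u x * g (a - x))"
proof -
  obtain A where A: "0 \<le> A" "\<And>x. weight \<alpha> (a - x) \<le> A * weight \<alpha> x" using weight_reflect[OF \<alpha>] by blast
  show ?thesis
  proof (rule Bochner_Integration.integrable_bound)
    show "integrable lborel (\<lambda>x. \<bar>C\<bar> * A * \<bar>u x * weight \<alpha> x\<bar>)" by (intro integrable_mult_right integrable_abs u)
    show "AE x in lborel. norm (u x * g (a - x)) \<le> norm (\<bar>C\<bar> * A * \<bar>u x * weight \<alpha> x\<bar>)"
    proof (intro AE_I2)
      fix x
      have "\<bar>g (a - x)\<bar> \<le> C * weight \<alpha> (a - x)" by (rule g)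
      also have "\<dots> \<le> \<bar>C\<bar> * weight \<alpha> (a - x)" by (intro mult_right_mono) auto
      also have "\<dots> \<le> \<bar>C\<bar> * (A * weight \<alpha> x)" by (intro mult_left_mono A) auto
      finally have "\<bar>u x\<bar> * \<bar>g (a - x)\<bar> \<le> \<bar>u x\<bar> * (\<bar>C\<bar> * (A * weight \<alpha> x))" by (rule mult_left_mono) auto
      then show "norm (u x * g (a - x)) \<le> norm (\<bar>C\<bar> * A * \<bar>u x * weight \<alpha> x\<bar>)"
        using A(1) by (simp add: abs_mult mult_ac)
    qed
  qed measurable
qed

text \<open>By Fubini's theorem the integral is a superposition of pairings of \<open>u\<close> with reflected translates of
\<open>sym_lap \<alpha> \<phi>\<close>. Absolute convergence is where the decay of \<open>f\<close> by the weight enters: the convolution of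
two functions dominated by the weight is dominated by the weight, and \<open>u\<close> is integrable against it.\<close>

lemma harmonic_convolution:
  fixes u f \<phi> :: "real ^ 'n \<Rightarrow> real"
  assumes \<alpha>: "0 < \<alpha>" "\<alpha> < 2" and \<phi>: "tame \<alpha> C \<phi>"
    and [measurable]: "u \<in> borel_measurable borel" "f \<in> borel_measurable borel"
    and u: "integrable lborel (\<lambda>x. u x * weight \<alpha> x)"
    and f: "\<And>x. \<bar>f x\<bar> \<le> B * weight \<alpha> x"
    and H: "\<And>b. (\<integral>x. u x * sym_lap \<alpha> \<phi> (b - x) \<partial>lborel) = 0"
  shows "(\<integral>x. u x * (\<integral>w. f (a - x - w) * sym_lap \<alpha> \<phi> w \<partial>lborel) \<partial>lborel) = 0"
proof -
  have [measurable]: "\<phi> \<in> borel_measurable borel" by (rule tame_measurable[OF \<phi>])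
  obtain K where K: "0 \<le> K" "\<And>x. \<bar>sym_lap \<alpha> \<phi> x\<bar> \<le> K * weight \<alpha> x" using sym_lap_bound[OF \<alpha> \<phi>] by blast
  obtain C1 where C1: "0 < C1" "\<And>x :: real ^ 'n. integrable lborel (\<lambda>z. weight \<alpha> z * weight \<alpha> (x - z))"
    "\<And>x :: real ^ 'n. (\<integral>z. weight \<alpha> z * weight \<alpha> (x - z) \<partial>lborel) \<le> C1 * weight \<alpha> x"
    using weight_convolution[OF \<alpha>(1), where 'n='n] by blast
  obtain A where A: "0 \<le> A" "\<And>x. weight \<alpha> (a - x) \<le> A * weight \<alpha> x" using weight_reflect[OF \<alpha>(1)] by blast
  let ?k = "\<lambda>x z. u x * (f z * sym_lap \<alpha> \<phi> (a - x - z))"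
  let ?W = "\<lambda>x z. \<bar>u x\<bar> * (\<bar>B\<bar> * K * (weight \<alpha> z * weight \<alpha> (a - x - z)))"
  have kW: "\<bar>?k x z\<bar> \<le> ?W x z" for x z
  proof -
    have "\<bar>f z\<bar> * \<bar>sym_lap \<alpha> \<phi> (a - x - z)\<bar> \<le> (\<bar>B\<bar> * weight \<alpha> z) * (K * weight \<alpha> (a - x - z))"
      by (intro mult_mono K order_trans[OF f] mult_right_mono) auto
    then have "\<bar>u x\<bar> * (\<bar>f z\<bar> * \<bar>sym_lap \<alpha> \<phi> (a - x - z)\<bar>) \<le> \<bar>u x\<bar> * ((\<bar>B\<bar> * weight \<alpha> z) * (K * weight \<alpha> (a - x - z)))"
      by (rule mult_left_mono) auto
    then show ?thesis by (simp add: abs_mult mult_ac)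
  qed
  have W: "integrable lborel (?W x)" for x
    by (intro integrable_mult_right C1)
  have k: "integrable lborel (?k x)" for x
    by (rule integrable_dominated[OF W[of x]]) (measurable, simp only: real_norm_def kW)
  have "(\<integral>x. u x * (\<integral>w. f (a - x - w) * sym_lap \<alpha> \<phi> w \<partial>lborel) \<partial>lborel) = (\<integral>x. (\<integral>z. ?k x z \<partial>lborel) \<partial>lborel)"
  proof (intro Bochner_Integration.integral_cong refl)
    fix x
    have "(\<integral>w. f (a - x - w) * sym_lap \<alpha> \<phi> w \<partial>lborel) = (\<integral>z. f z * sym_lap \<alpha> \<phi> (a - x - z) \<partial>lborel)"
      by (subst lborel_integral_reflect[of "\<lambda>w. f (a - x - w) * sym_lap \<alpha> \<phi> w" "a - x", symmetric]) auto
    then show "u x * (\<integral>w. f (a - x - w) * sym_lap \<alpha> \<phi> w \<partial>lborel) = (\<integral>z. ?k x z \<partial>lborel)"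
      by (simp only: integral_mult_right_zero)
  qed
  also have "\<dots> = (\<integral>z. (\<integral>x. ?k x z \<partial>lborel) \<partial>lborel)"
  proof (rule lborel_swap_integrals[OF _ k])
    show "(\<lambda>(x, z). ?k x z) \<in> borel_measurable (borel \<Otimes>\<^sub>M borel)" by measurable
    show "integrable lborel (\<lambda>x. \<bar>B\<bar> * K * C1 * A * \<bar>u x * weight \<alpha> x\<bar>)"
      by (intro integrable_mult_right integrable_abs u)
    fix x :: "real ^ 'n"
    have "(\<integral>z. norm (?k x z) \<partial>lborel) \<le> (\<integral>z. ?W x z \<partial>lborel)"
      using kW by (intro integral_mono integrable_norm k W) (simp only: real_norm_def)
    also have "\<dots> = \<bar>u x\<bar> * (\<bar>B\<bar> * K * (\<integral>z. weight \<alpha> z * weight \<alpha> (a - x - z) \<partial>lborel))"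
      by (simp only: integral_mult_right_zero)
    also have "\<dots> \<le> \<bar>u x\<bar> * (\<bar>B\<bar> * K * (C1 * (A * weight \<alpha> x)))"
      using C1(1) K(1) by (intro mult_left_mono order_trans[OF C1(3)] A) auto
    also have "\<dots> = \<bar>B\<bar> * K * C1 * A * \<bar>u x * weight \<alpha> x\<bar>"
      by (simp add: abs_mult mult_ac)
    finally show "(\<integral>z. norm (?k x z) \<partial>lborel) \<le> \<bar>B\<bar> * K * C1 * A * \<bar>u x * weight \<alpha> x\<bar>" .
  qed
  also have "\<dots> = (\<integral>z. f z * (\<integral>x. u x * sym_lap \<alpha> \<phi> ((a - z) - x) \<partial>lborel) \<partial>lborel)"
  proof (intro Bochner_Integration.integral_cong refl)
    fix z
    have "?k x z = f z * (u x * sym_lap \<alpha> \<phi> ((a - z) - x))" for x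
      by (simp add: algebra_simps)
    then show "(\<integral>x. ?k x z \<partial>lborel) = f z * (\<integral>x. u x * sym_lap \<alpha> \<phi> ((a - z) - x) \<partial>lborel)"
      by (simp only: integral_mult_right_zero)
  qed
  also have "\<dots> = 0" by (simp add: H)
  finally show ?thesis .
qed

lemma bump_average:
  fixes g :: "real ^ 'n \<Rightarrow> real"
  assumes e: "0 < e" and [measurable]: "g \<in> borel_measurable borel" and B: "\<And>x. \<bar>g x\<bar> \<le> B"
    and \<delta>: "\<And>w. norm w \<le> e \<Longrightarrow> \<bar>g (z - w) - c\<bar> \<le> \<delta>"
  shows "\<bar>(\<integral>w. g (z - w) * bump e w \<partial>lborel) / (\<integral>w. bump e w \<partial>(lborel :: (real^'n) measure)) - c\<bar> \<le> \<delta>"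
proof -
  define I where "I = (\<integral>w. bump e w \<partial>(lborel :: (real^'n) measure))"
  have I: "0 < I" unfolding I_def by (rule bump_integral_pos[OF e])
  note bi = bump_integrable[OF e, where 'n='n]
  have gi: "integrable lborel (\<lambda>w. g (z - w) * bump e w)"
  proof (rule Bochner_Integration.integrable_bound)
    show "integrable lborel (\<lambda>w :: real^'n. \<bar>B\<bar> * bump e w)" by (intro integrable_mult_right bi)
    show "AE w in lborel. norm (g (z - w) * bump e w) \<le> norm (\<bar>B\<bar> * bump e w)"
      by (intro AE_I2) (auto simp: abs_mult intro!: mult_right_mono order_trans[OF B])
  qed measurable
  have "\<bar>(\<integral>w. g (z - w) * bump e w \<partial>lborel) - c * I\<bar> = \<bar>\<integral>w. g (z - w) * bump e w - c * bump e w \<partial>lborel\<bar>"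
    using gi bi by (simp add: I_def)
  also have "\<dots> \<le> (\<integral>w. \<bar>g (z - w) * bump e w - c * bump e w\<bar> \<partial>lborel)"
    by (rule integral_abs_bound)
  also have "\<dots> \<le> (\<integral>w. \<delta> * bump e w \<partial>(lborel :: (real^'n) measure))"
  proof (intro integral_mono integrable_abs Bochner_Integration.integrable_diff gi integrable_mult_right bi)
    fix w :: "real ^ 'n"
    show "\<bar>g (z - w) * bump e w - c * bump e w\<bar> \<le> \<delta> * bump e w"
    proof (cases "norm w \<le> e")
      case True
      have "g (z - w) * bump e w - c * bump e w = (g (z - w) - c) * bump e w" by (simp add: algebra_simps)
      then show ?thesis using \<delta>[OF True] by (simp add: abs_mult mult_right_mono)
    qed (use bump_eq_0[OF e, of w] in simp)
  qed
  also have "\<dots> = \<delta> * I" by (simp add: I_def)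
  finally have "\<bar>(\<integral>w. g (z - w) * bump e w \<partial>lborel) - c * I\<bar> \<le> \<delta> * I" .
  moreover have "(\<integral>w. g (z - w) * bump e w \<partial>lborel) / I - c = ((\<integral>w. g (z - w) * bump e w \<partial>lborel) - c * I) / I"
    using I by (simp add: field_simps)
  ultimately show ?thesis using I unfolding I_def[symmetric] by (simp add: abs_divide field_simps)
qed

text \<open>The averages of \<open>g\<close> over shrinking bumps converge to \<open>g\<close> by continuity. They are dominated by
a multiple of the weight uniformly, since the weight is comparable at points of distance at most one.\<close>

lemma mollified_limit:
  fixes u g :: "real ^ 'n \<Rightarrow> real"
  assumes \<alpha>: "0 < \<alpha>"
    and [measurable]: "u \<in> borel_measurable borel"
    and u: "integrable lborel (\<lambda>x. u x * weight \<alpha> x)"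
    and gc: "continuous_on UNIV g" and g: "\<And>x. \<bar>g x\<bar> \<le> B * weight \<alpha> x"
    and H: "\<And>e. 0 < e \<Longrightarrow> (\<integral>x. u x * (\<integral>w. g (a - x - w) * bump e w \<partial>lborel) \<partial>lborel) = 0"
  shows "(\<integral>x. u x * g (a - x) \<partial>lborel) = 0"
proof -
  let ?N = "real CARD('n) + \<alpha>"
  have [measurable]: "g \<in> borel_measurable borel" by (rule borel_measurable_continuous_onI[OF gc])
  have gB: "\<bar>g x\<bar> \<le> \<bar>B\<bar>" for x
  proof -
    have "\<bar>g x\<bar> \<le> \<bar>B\<bar> * weight \<alpha> x" by (rule order_trans[OF g]) (intro mult_right_mono, auto)
    also have "\<dots> \<le> \<bar>B\<bar> * 1" by (intro mult_left_mono weight_le_1) auto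
    finally show ?thesis by simp
  qed
  define e where "e k = 1 / real (Suc k)" for k
  have e: "0 < e k" "e k \<le> 1" for k by (auto simp: e_def)
  have e0: "e \<longlonglongrightarrow> 0" unfolding e_def by (rule LIMSEQ_Suc[OF lim_1_over_n])
  define avg where "avg k z = (\<integral>w. g (z - w) * bump (e k) w \<partial>lborel) / (\<integral>w. bump (e k) w \<partial>(lborel :: (real^'n) measure))" for k z
  have [measurable]: "avg k \<in> borel_measurable borel" for k unfolding avg_def[abs_def] by measurable
  have avg_lim: "(\<lambda>k. avg k z) \<longlonglongrightarrow> g z" for z
  proof (rule LIMSEQ_I)
    fix r :: real assume r: "0 < r"
    have "isCont g z" using gc by (simp add: continuous_on_eq_continuous_at)
    then obtain d where d: "0 < d" "\<And>y. dist y z < d \<Longrightarrow> dist (g y) (g z) < r / 2"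
      unfolding continuous_at_eps_delta using r half_gt_zero by blast
    obtain K where K: "\<And>k. K \<le> k \<Longrightarrow> e k < d"
      using order_tendstoD(2)[OF e0 d(1)] by (auto simp: eventually_sequentially)
    have "norm (avg k z - g z) < r" if "K \<le> k" for k
    proof -
      have "\<bar>avg k z - g z\<bar> \<le> r / 2" unfolding avg_def
      proof (rule bump_average[OF e(1) _ gB])
        fix w :: "real ^ 'n" assume "norm w \<le> e k"
        then have "dist (z - w) z < d" using K[OF that] by (simp add: dist_norm)
        then show "\<bar>g (z - w) - g z\<bar> \<le> r / 2" using d(2)[of "z - w"] by (simp add: dist_real_def)
      qed measurable
      then show ?thesis using r by simp
    qed
    then show "\<exists>K. \<forall>k\<ge>K. norm (avg k z - g z) < r" by blast
  qed
  define A where "A = \<bar>B\<bar> * (2 powr ?N * 2)"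
  have avg_bound: "\<bar>avg k z\<bar> \<le> A * weight \<alpha> z" for k z
  proof -
    have "\<bar>avg k z - 0\<bar> \<le> A * weight \<alpha> z" unfolding avg_def
    proof (rule bump_average[OF e(1) _ gB])
      fix w :: "real ^ 'n" assume w: "norm w \<le> e k"
      then have "norm w \<le> 1" using e(2)[of k] by simp
      then have 1: "norm w powr ?N \<le> 1" using \<alpha> by (intro powr_le1) auto
      have "weight \<alpha> (z - w) \<le> 2 powr ?N * (1 + norm w powr ?N) * weight \<alpha> (z - w + w)" by (rule weight_shift[OF \<alpha>])
      also have "\<dots> \<le> 2 powr ?N * 2 * weight \<alpha> z" using 1 by (intro mult_mono mult_left_mono) auto
      finally have "\<bar>B\<bar> * weight \<alpha> (z - w) \<le> \<bar>B\<bar> * (2 powr ?N * 2 * weight \<alpha> z)" by (rule mult_left_mono) auto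
      moreover have "\<bar>g (z - w)\<bar> \<le> \<bar>B\<bar> * weight \<alpha> (z - w)" by (rule order_trans[OF g]) (intro mult_right_mono, auto)
      ultimately show "\<bar>g (z - w) - 0\<bar> \<le> A * weight \<alpha> z" unfolding A_def by (simp add: mult_ac)
    qed measurable
    then show ?thesis by simp
  qed
  have "0 \<le> A" unfolding A_def by auto
  obtain D where D: "0 \<le> D" "\<And>x. weight \<alpha> (a - x) \<le> D * weight \<alpha> x" using weight_reflect[OF \<alpha>] by blast
  have "(\<lambda>k. \<integral>x. u x * avg k (a - x) \<partial>lborel) \<longlonglongrightarrow> (\<integral>x. u x * g (a - x) \<partial>lborel)"
  proof (rule integral_dominated_convergence[where w="\<lambda>x. A * D * \<bar>u x * weight \<alpha> x\<bar>"])
    show "integrable lborel (\<lambda>x. A * D * \<bar>u x * weight \<alpha> x\<bar>)" by (intro integrable_mult_right integrable_abs u)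
    show "AE x in lborel. (\<lambda>k. u x * avg k (a - x)) \<longlonglongrightarrow> u x * g (a - x)"
      by (intro AE_I2 tendsto_intros avg_lim)
    show "AE x in lborel. norm (u x * avg k (a - x)) \<le> A * D * \<bar>u x * weight \<alpha> x\<bar>" for k
    proof (intro AE_I2)
      fix x
      have "\<bar>avg k (a - x)\<bar> \<le> A * (D * weight \<alpha> x)"
        by (rule order_trans[OF avg_bound]) (intro mult_left_mono D \<open>0 \<le> A\<close>)
      then have "\<bar>u x\<bar> * \<bar>avg k (a - x)\<bar> \<le> \<bar>u x\<bar> * (A * (D * weight \<alpha> x))" by (rule mult_left_mono) auto
      then show "norm (u x * avg k (a - x)) \<le> A * D * \<bar>u x * weight \<alpha> x\<bar>" by (simp add: abs_mult mult_ac)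
    qed
  qed measurable
  moreover have "(\<integral>x. u x * avg k (a - x) \<partial>lborel) = 0" for k
  proof -
    have "(\<integral>x. u x * avg k (a - x) \<partial>lborel) =
      (\<integral>x. u x * (\<integral>w. g (a - x - w) * bump (e k) w \<partial>lborel) / (\<integral>w. bump (e k) w \<partial>(lborel :: (real^'n) measure)) \<partial>lborel)"
      unfolding avg_def by simp
    also have "\<dots> = 0" unfolding integral_divide_zero by (simp add: H[OF e(1)])
    finally show ?thesis .
  qed
  ultimately have "(\<lambda>k. 0) \<longlonglongrightarrow> (\<integral>x. u x * g (a - x) \<partial>lborel)" by simp
  then show ?thesis using LIMSEQ_unique[OF tendsto_const] by metis
qed

text \<open>The substitute for the statement that the Fourier transform of \<open>u\<close> is supported at the origin: \<open>u\<close>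
annihilates all translates of those \<open>g\<close> that are, up to a constant, the fractional Laplacian of a function \<open>f\<close> with the decay
of the weight.\<close>

lemma harmonic_annihilates:
  fixes u f g m :: "real ^ 'n \<Rightarrow> real"
  assumes \<alpha>: "0 < \<alpha>" "\<alpha> < 2"
    and [measurable]: "u \<in> borel_measurable borel" "f \<in> borel_measurable borel"
    and u: "integrable lborel (\<lambda>x. u x * weight \<alpha> x)"
    and H: "\<And>b e. 0 < e \<Longrightarrow> (\<integral>x. u x * sym_lap \<alpha> (bump e) (b - x) \<partial>lborel) = 0"
    and m: "integrable lborel m" "integrable lborel (\<lambda>\<xi>. norm \<xi> powr \<alpha> * m \<xi>)"
    and F: "\<And>x. of_real (f x) = (\<integral>\<xi>. of_real (m \<xi>) * cis (x \<bullet> \<xi>) \<partial>lborel)"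
    and G: "\<And>x. of_real (g x) = (\<integral>\<xi>. of_real (norm \<xi> powr \<alpha> * m \<xi>) * cis (x \<bullet> \<xi>) \<partial>lborel)"
    and f: "\<And>x. \<bar>f x\<bar> \<le> B * weight \<alpha> x"
    and gc: "continuous_on UNIV g" and g: "\<And>x. \<bar>g x\<bar> \<le> B' * weight \<alpha> x"
  shows "(\<integral>x. u x * g (a - x) \<partial>lborel) = 0"
proof (rule mollified_limit[OF \<alpha>(1) _ u gc g])
  obtain \<kappa> where \<kappa>: "0 < \<kappa>" "\<And>\<xi> :: real ^ 'n. has_bochner_integral lborel
       (\<lambda>y. (1 - cos (\<xi> \<bullet> y)) / norm y powr (real CARD('n) + \<alpha>)) (\<kappa> * norm \<xi> powr \<alpha>)"
    using fractional_symbol[OF \<alpha>, where 'n='n] by blast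
  fix e :: real assume e: "0 < e"
  obtain M where M: "tame \<alpha> M (bump e :: real ^ 'n \<Rightarrow> real)"
    using schwartz_imp_tame[OF \<alpha>(1) bumps_schwartz[OF bump_bumps e]] .
  have "\<kappa> * (\<integral>x. u x * (\<integral>w. g (a - x - w) * bump e w \<partial>lborel) \<partial>lborel) =
    (\<integral>x. u x * (\<integral>w. f (a - x - w) * sym_lap \<alpha> (bump e) w \<partial>lborel) \<partial>lborel)"
    unfolding convolution_sym_lap[OF \<alpha> M \<kappa>(2) m F G]
    by (simp only: integral_mult_right_zero[symmetric] mult_ac)
  also have "\<dots> = 0" by (rule harmonic_convolution[OF \<alpha> M _ _ u f H[OF e]]) measurable
  finally show "(\<integral>x. u x * (\<integral>w. g (a - x - w) * bump e w \<partial>lborel) \<partial>lborel) = 0" using \<kappa>(1) by simp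
qed measurable

section \<open>Bounds for the heat kernel\<close>

definition heat :: "real \<Rightarrow> real ^ 'n::finite \<Rightarrow> real" where
  "heat t x = (4 * pi * t) powr (- (real CARD('n) / 2)) * exp (- ((norm x)\<^sup>2 / (4 * t)))"

lemma heat_nonneg [simp]: "0 \<le> heat t x"
  by (simp add: heat_def)

lemma heat_measurable [measurable]: "heat t \<in> borel_measurable borel"
  unfolding heat_def[abs_def] by measurable

lemma heat_continuous: "0 < t \<Longrightarrow> continuous_on UNIV (heat t)"
  unfolding heat_def[abs_def] by (intro continuous_intros) auto

lemma heat_fourier:
  fixes x :: "real ^ 'n"
  assumes t: "0 < t"
  shows "has_bochner_integral lborel
    (\<lambda>\<xi>. of_real ((4 * pi * pi) powr (- (real CARD('n) / 2)) * exp (- (t * (norm \<xi>)\<^sup>2))) * cis (x \<bullet> \<xi>))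
    (of_real (heat t x))"
proof -
  let ?c = "(4 * pi * pi) powr (- (real CARD('n) / 2))"
  have "has_bochner_integral lborel (\<lambda>\<xi>. of_real ?c * (of_real (exp (- (t * (norm \<xi>)\<^sup>2))) * cis (x \<bullet> \<xi>)))
    (of_real ?c * of_real ((pi / t) powr (real CARD('n) / 2) * exp (- ((norm x)\<^sup>2 / (4 * t)))))"
    by (intro has_bochner_integral_mult_right gaussian_fourier t)
  moreover have "?c * ((pi / t) powr (real CARD('n) / 2) * exp (- ((norm x)\<^sup>2 / (4 * t)))) = heat t x"
  proof -
    have "(pi / t) powr (real CARD('n) / 2) = (t / pi) powr (- (real CARD('n) / 2))"
      using t by (simp add: powr_minus powr_divide)
    then have "?c * (pi / t) powr (real CARD('n) / 2) = (4 * pi * pi * (t / pi)) powr (- (real CARD('n) / 2))"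
      using t by (simp only:) (subst powr_mult, auto)
    also have "4 * pi * pi * (t / pi) = 4 * pi * t" by simp
    finally show ?thesis by (simp add: heat_def mult.assoc[symmetric] del: mult.assoc)
  qed
  ultimately show ?thesis by (simp only: of_real_mult[symmetric] mult.assoc[symmetric])
qed

lemma power_le_exp:
  fixes Q :: real
  assumes "0 \<le> Q"
  shows "Q ^ k \<le> real k ^ k * exp Q"
proof (cases "k = 0")
  case False
  have "(Q / k) ^ k \<le> exp (Q / k) ^ k"
  proof (rule power_mono)
    show "Q / k \<le> exp (Q / k)" using exp_ge_add_one_self[of "Q / k"] by linarith
  qed (use assms in simp)
  also have "\<dots> = exp Q" using False by (simp flip: exp_of_nat_mult)
  finally show ?thesis using False by (simp add: power_divide field_simps)
qed (use assms in simp)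

text \<open>The bound is that of the scaling \<open>G\<^sub>\<tau>(x) = \<tau>\<^sup>-\<^sup>n\<^sup>/\<^sup>2 G\<^sub>1(x / \<surd>\<tau>)\<close> together with the decay of \<open>G\<^sub>1\<close> faster than any
power. The factor with \<open>|x|\<^sup>2 / (4 \<tau>)\<close> absorbs the polynomials that appear in the derivatives of the
heat kernel. The lower bound \<open>s\<close> for \<open>\<tau>\<close> makes the constant uniform at the origin.\<close>

lemma heat_bound:
  assumes \<alpha>: "0 < \<alpha>" and s: "0 < s"
  obtains C where "0 \<le> C" "\<And>\<tau> x :: real ^ 'n. s \<le> \<tau> \<Longrightarrow>
    (1 + ((norm x)\<^sup>2 / (4 * \<tau>))\<^sup>2) * heat \<tau> x \<le> C * \<tau> powr (\<alpha> / 2) * weight \<alpha> x"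
proof -
  let ?n = "real CARD('n)"
  let ?N = "?n + \<alpha>"
  \<comment> \<open>An integer exponent above \<open>N / 2\<close>, for which the exponential dominates the power.\<close>
  define k where "k = nat \<lceil>?N / 2\<rceil>"
  have k: "?N / 2 \<le> real k" unfolding k_def by linarith
  define C0 where "C0 = 2 + 2 * (2 ^ 2) + real k ^ k + real (k + 2) ^ (k + 2)"
  have C0: "(1 + Q\<^sup>2) * (1 + Q powr (?N / 2)) * exp (- Q) \<le> C0" if Q: "0 \<le> Q" for Q
  proof -
    have "Q powr (?N / 2) \<le> 1 + Q ^ k"
    proof (cases "Q \<le> 1")
      case True
      then have "Q powr (?N / 2) \<le> 1" using \<alpha> Q by (intro powr_le1) auto
      then show ?thesis using Q by (simp add: add_increasing2)
    next
      case False
      then have "Q powr (?N / 2) \<le> Q powr k" using k by (intro powr_mono) auto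
      also have "\<dots> = Q ^ k" using False by (intro powr_realpow) auto
      finally show ?thesis by simp
    qed
    then have "(1 + Q\<^sup>2) * (1 + Q powr (?N / 2)) \<le> (1 + Q\<^sup>2) * (2 + Q ^ k)"
      by (intro mult_left_mono) auto
    also have "\<dots> = 2 + 2 * Q ^ 2 + Q ^ k + Q ^ (k + 2)" by (simp add: algebra_simps power_add power2_eq_square)
    also have "\<dots> \<le> 2 * exp Q + 2 * (real 2 ^ 2 * exp Q) + real k ^ k * exp Q + real (k + 2) ^ (k + 2) * exp Q"
      using Q by (intro add_mono mult_left_mono power_le_exp) auto
    also have "\<dots> = C0 * exp Q" by (simp add: C0_def algebra_simps)
    finally show ?thesis by (simp add: exp_minus field_simps)
  qed
  have C0_pos: "0 \<le> C0" unfolding C0_def by auto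
  define C1 where "C1 = s powr (- (?N / 2)) + 4 powr (?N / 2)"
  have C1: "0 \<le> C1" by (simp add: C1_def)
  define C where "C = (4 * pi) powr (- (?n / 2)) * (C0 * C1)"
  have "(1 + ((norm x)\<^sup>2 / (4 * \<tau>))\<^sup>2) * heat \<tau> x \<le> C * \<tau> powr (\<alpha> / 2) * weight \<alpha> x"
    if \<tau>: "s \<le> \<tau>" for \<tau> and x :: "real ^ 'n"
  proof -
    define Q where "Q = (norm x)\<^sup>2 / (4 * \<tau>)"
    have \<tau>0: "0 < \<tau>" using s \<tau> by simp
    have Q0: "0 \<le> Q" using \<tau>0 by (simp add: Q_def)
    define X where "X = norm x powr ?N"
    have X0: "0 \<le> X" by (simp add: X_def)
    have QX: "Q powr (?N / 2) = X / (4 powr (?N / 2) * \<tau> powr (?N / 2))"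
      unfolding Q_def X_def using \<tau>0 by (simp add: powr_divide powr_mult powr_square add_divide_distrib)
    have "1 + X \<le> C1 * \<tau> powr (?N / 2) * (1 + Q powr (?N / 2))"
    proof -
      have "1 = s powr (- (?N / 2)) * s powr (?N / 2)" using s by (simp flip: powr_add)
      also have "\<dots> \<le> s powr (- (?N / 2)) * \<tau> powr (?N / 2)"
        using s \<tau> \<alpha> by (intro mult_left_mono powr_mono2) auto
      finally have 1: "1 \<le> s powr (- (?N / 2)) * \<tau> powr (?N / 2)" .
      have 2: "X = 4 powr (?N / 2) * (\<tau> powr (?N / 2) * Q powr (?N / 2))"
        using \<tau>0 by (simp add: QX)
      have "1 + X \<le> s powr (- (?N / 2)) * \<tau> powr (?N / 2) + 4 powr (?N / 2) * (\<tau> powr (?N / 2) * Q powr (?N / 2))"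
        using 1 2 by linarith
      also have "\<dots> \<le> C1 * \<tau> powr (?N / 2) * (1 + Q powr (?N / 2))"
        unfolding C1_def by (simp add: algebra_simps)
      finally show ?thesis .
    qed
    then have "(1 + Q\<^sup>2) * exp (- Q) * (1 + X) \<le> (1 + Q\<^sup>2) * exp (- Q) * (C1 * \<tau> powr (?N / 2) * (1 + Q powr (?N / 2)))"
      by (intro mult_left_mono) auto
    also have "\<dots> = ((1 + Q\<^sup>2) * (1 + Q powr (?N / 2)) * exp (- Q)) * (C1 * \<tau> powr (?N / 2))"
      by (simp only: mult_ac)
    also have "\<dots> \<le> C0 * (C1 * \<tau> powr (?N / 2))"
      using C1 by (intro mult_right_mono C0 Q0) auto
    finally have *: "(1 + Q\<^sup>2) * exp (- Q) * (1 + X) \<le> C0 * (C1 * \<tau> powr (?N / 2))" .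
    have "(1 + Q\<^sup>2) * heat \<tau> x * (1 + X) = (4 * pi * \<tau>) powr (- (?n / 2)) * ((1 + Q\<^sup>2) * exp (- Q) * (1 + X))"
      unfolding heat_def Q_def[symmetric] by (simp only: mult_ac)
    also have "\<dots> \<le> (4 * pi * \<tau>) powr (- (?n / 2)) * (C0 * (C1 * \<tau> powr (?N / 2)))"
      using * by (rule mult_left_mono) auto
    also have "\<dots> = C * (\<tau> powr (- (?n / 2)) * \<tau> powr (?N / 2))"
      using \<tau>0 by (simp add: C_def powr_mult)
    also have "\<tau> powr (- (?n / 2)) * \<tau> powr (?N / 2) = \<tau> powr (\<alpha> / 2)"
      by (simp add: field_simps flip: powr_add)
    finally have "(1 + Q\<^sup>2) * heat \<tau> x * (1 + X) \<le> C * \<tau> powr (\<alpha> / 2)" .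
    then show ?thesis unfolding weight_def Q_def[symmetric] X_def[symmetric]
      using X0 by (simp add: field_simps add_pos_nonneg)
  qed
  then show thesis using that[of C] C0_pos C1 by (simp add: C_def)
qed

lemma heat_le:
  assumes \<alpha>: "0 < \<alpha>" and s: "0 < s"
  obtains C where "0 \<le> C" "\<And>\<tau> x :: real ^ 'n. s \<le> \<tau> \<Longrightarrow> heat \<tau> x \<le> C * \<tau> powr (\<alpha> / 2) * weight \<alpha> x"
proof -
  obtain C where C: "0 \<le> C" "\<And>\<tau> x :: real ^ 'n. s \<le> \<tau> \<Longrightarrow>
    (1 + ((norm x)\<^sup>2 / (4 * \<tau>))\<^sup>2) * heat \<tau> x \<le> C * \<tau> powr (\<alpha> / 2) * weight \<alpha> x"
    using heat_bound[OF \<alpha> s, where 'n='n] by blast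
  have "heat \<tau> x \<le> C * \<tau> powr (\<alpha> / 2) * weight \<alpha> x" if "s \<le> \<tau>" for \<tau> and x :: "real ^ 'n"
    using mult_right_mono[of 1 "1 + ((norm x)\<^sup>2 / (4 * \<tau>))\<^sup>2" "heat \<tau> x"] C(2)[OF that, of x]
    by (auto intro: order_trans)
  with C(1) show thesis by (rule that)
qed

text \<open>In this form the time derivative is immediate.\<close>

lemma heat_exp:
  fixes x :: "real ^ 'n"
  shows "0 < t \<Longrightarrow> heat t x = exp (- (real CARD('n) / 2) * ln (4 * pi * t) - (norm x)\<^sup>2 / 4 / t)"
  by (simp add: heat_def powr_def flip: exp_add)

lemma heat_time_derivative:
  fixes x :: "real ^ 'n"
  assumes t: "0 < t"
  shows "((\<lambda>t. heat t x) has_real_derivative heat t x * ((norm x)\<^sup>2 / 4 / t\<^sup>2 - real CARD('n) / 2 / t)) (at t)"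
proof -
  have "((\<lambda>t. exp (- a * ln (c * t) - b / t)) has_real_derivative exp (- a * ln (c * t) - b / t) * (b / t\<^sup>2 - a / t)) (at t)"
    if "0 < c" for a b c :: real
    using t that by (auto intro!: derivative_eq_intros simp: field_simps power2_eq_square)
  from this[of "4 * pi" "real CARD('n) / 2" "(norm x)\<^sup>2 / 4"]
  have "((\<lambda>t. exp (- (real CARD('n) / 2) * ln (4 * pi * t) - (norm x)\<^sup>2 / 4 / t))
     has_real_derivative heat t x * ((norm x)\<^sup>2 / 4 / t\<^sup>2 - real CARD('n) / 2 / t)) (at t)"
    by (simp only: heat_exp[OF t]) simp
  then show ?thesis
    by (rule has_field_derivative_transform_within_open[where S="{0<..}"]) (use t in \<open>auto simp only: heat_exp[of _ x] greaterThan_iff open_greaterThan\<close>)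
qed

text \<open>Two time derivatives of the heat kernel give a factor \<open>\<tau>\<^sup>-\<^sup>2\<close> times a quadratic polynomial in
\<open>|x|\<^sup>2 / (4 \<tau>)\<close>, so \<open>heat_bound\<close> yields the exponent \<open>\<alpha> / 2 - 2\<close>.\<close>

lemma heat_time_difference_bound:
  assumes \<alpha>: "0 < \<alpha>" "\<alpha> < 2" and st: "0 < s" "s < t"
  obtains C where "0 \<le> C"
    "\<And>r x :: real ^ 'n. 0 \<le> r \<Longrightarrow> \<bar>heat (r + s) x - 2 * heat (r + (s + t) / 2) x + heat (r + t) x\<bar>
       \<le> C * (r + s) powr (\<alpha> / 2 - 2) * weight \<alpha> x"
proof -
  let ?n = "real CARD('n)"
  obtain C where C: "0 \<le> C" "\<And>\<tau> x :: real ^ 'n. s \<le> \<tau> \<Longrightarrow>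
    (1 + ((norm x)\<^sup>2 / (4 * \<tau>))\<^sup>2) * heat \<tau> x \<le> C * \<tau> powr (\<alpha> / 2) * weight \<alpha> x"
    using heat_bound[OF \<alpha>(1) st(1), where 'n='n] by blast
  define d where "d = (t - s) / 2"
  have d: "0 < d" using st by (simp add: d_def)
  define K where "K = 4 + ?n\<^sup>2 / 2 + ?n / 2"
  have K: "0 \<le> K" by (simp add: K_def)
  have "\<bar>heat (r + s) x - 2 * heat (r + (s + t) / 2) x + heat (r + t) x\<bar>
       \<le> (2 * (d\<^sup>2 * (K * C))) * (r + s) powr (\<alpha> / 2 - 2) * weight \<alpha> x" if r: "0 \<le> r" for r and x :: "real ^ 'n"
  proof -
    define q where "q = (norm x)\<^sup>2 / 4"
    have q0: "0 \<le> q" by (simp add: q_def)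
    \<comment> \<open>The three times are \<open>T (- 1)\<close>, \<open>T 0\<close> and \<open>T 1\<close>.\<close>
    define T where "T \<sigma> = r + (s + t) / 2 + \<sigma> * d" for \<sigma>
    have T: "r + s \<le> T \<sigma>" "0 < T \<sigma>" if "\<bar>\<sigma>\<bar> \<le> 1" for \<sigma>
    proof -
      have "- d \<le> \<sigma> * d" using mult_right_mono[of "- 1" \<sigma> d] that d by (simp add: abs_le_iff)
      then show "r + s \<le> T \<sigma>" unfolding T_def d_def by (simp add: field_simps)
      then show "0 < T \<sigma>" using r st by linarith
    qed
    have dT: "(T has_real_derivative d) (at \<sigma>)" for \<sigma>
      unfolding T_def[abs_def] by (auto intro!: derivative_eq_intros)
    let ?w = "\<lambda>\<tau>. q / \<tau>\<^sup>2 - ?n / 2 / \<tau>"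
    define p where "p \<sigma> = heat (T \<sigma>) x" for \<sigma>
    define p' where "p' \<sigma> = heat (T \<sigma>) x * ?w (T \<sigma>) * d" for \<sigma>
    define p'' where "p'' \<sigma> = d\<^sup>2 * (heat (T \<sigma>) x * ((?w (T \<sigma>))\<^sup>2 - 2 * q / (T \<sigma>) ^ 3 + ?n / 2 / (T \<sigma>)\<^sup>2))" for \<sigma>
    have "\<bar>2 * p 0 - p 1 - p (-1)\<bar> \<le> 2 * (d\<^sup>2 * (K * (C * (r + s) powr (\<alpha> / 2 - 2) * weight \<alpha> x)))"
    proof (rule second_difference_bound)
      fix \<sigma> :: real assume \<sigma>: "\<bar>\<sigma>\<bar> \<le> 1"
      define \<tau> where "\<tau> = T \<sigma>"
      have \<tau>: "0 < \<tau>" "r + s \<le> \<tau>" using T[OF \<sigma>] by (auto simp: \<tau>_def)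
      have dh: "((\<lambda>\<sigma>. heat (T \<sigma>) x) has_real_derivative heat \<tau> x * ?w \<tau> * d) (at \<sigma>)"
        using DERIV_chain2[OF heat_time_derivative[of "T \<sigma>" x] dT] \<tau>(1) by (simp add: \<tau>_def q_def)
      then show "(p has_real_derivative p' \<sigma>) (at \<sigma>)"
        by (simp add: p_def[abs_def] p'_def \<tau>_def)
      have "((\<lambda>\<tau>. q / \<tau>\<^sup>2 - b / \<tau>) has_real_derivative (- 2 * q / \<tau> ^ 3 + b / \<tau>\<^sup>2)) (at \<tau>)" for b :: real
        using \<tau>(1) by (auto intro!: derivative_eq_intros simp: field_simps power2_eq_square power3_eq_cube)
      then have dw: "((\<lambda>\<sigma>. ?w (T \<sigma>)) has_real_derivative (- 2 * q / \<tau> ^ 3 + ?n / 2 / \<tau>\<^sup>2) * d) (at \<sigma>)"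
        unfolding \<tau>_def by (rule DERIV_chain2[OF _ dT])
      have "((\<lambda>\<sigma>. heat (T \<sigma>) x * ?w (T \<sigma>) * d) has_real_derivative
         (heat \<tau> x * ?w \<tau> * d * ?w \<tau> + heat \<tau> x * ((- 2 * q / \<tau> ^ 3 + ?n / 2 / \<tau>\<^sup>2) * d)) * d) (at \<sigma>)"
        using DERIV_cmult_right[OF DERIV_mult[OF dh dw], of d] by (simp add: \<tau>_def algebra_simps)
      then show "(p' has_real_derivative p'' \<sigma>) (at \<sigma>)"
        by (simp add: p'_def[abs_def] p''_def \<tau>_def algebra_simps power2_eq_square)
      define Q where "Q = (norm x)\<^sup>2 / (4 * \<tau>)"
      have Q: "q = Q * \<tau>" using \<tau>(1) by (simp add: Q_def q_def)
      have Q0: "0 \<le> Q" using \<tau>(1) by (simp add: Q_def)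
      have eq: "(?w \<tau>)\<^sup>2 - 2 * q / \<tau> ^ 3 + ?n / 2 / \<tau>\<^sup>2 = ((Q - ?n / 2)\<^sup>2 - 2 * Q + ?n / 2) / \<tau>\<^sup>2"
        using \<tau>(1) unfolding Q by (simp add: field_simps power2_eq_square power3_eq_cube)
      have "\<bar>(Q - ?n / 2)\<^sup>2 - 2 * Q + ?n / 2\<bar> \<le> K * (1 + Q\<^sup>2)"
      proof -
        have 1: "(Q - ?n / 2)\<^sup>2 \<le> 2 * Q\<^sup>2 + ?n\<^sup>2 / 2"
          using zero_le_power2[of "Q + ?n / 2"] by (simp add: power2_eq_square field_simps)
        have 2: "2 * Q \<le> 1 + Q\<^sup>2" using zero_le_power2[of "Q - 1"] by (simp add: power2_eq_square field_simps)
        have 3: "0 \<le> (Q - ?n / 2)\<^sup>2" by simp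
        have "\<bar>(Q - ?n / 2)\<^sup>2 - 2 * Q + ?n / 2\<bar> \<le> 2 * Q\<^sup>2 + ?n\<^sup>2 / 2 + (1 + Q\<^sup>2) + ?n / 2"
          using 1 2 3 Q0 zero_le_power2[of Q] zero_le_power2[of ?n] of_nat_0_le_iff[of "CARD('n)"]
          by (intro abs_leI) linarith+
        also have "\<dots> \<le> K * 1 + K * Q\<^sup>2"
        proof (intro order_trans[OF _ add_mono[OF order_refl mult_right_mono[of 3 K]]])
          show "2 * Q\<^sup>2 + ?n\<^sup>2 / 2 + (1 + Q\<^sup>2) + ?n / 2 \<le> K * 1 + 3 * Q\<^sup>2" by (simp add: K_def)
        qed (auto simp: K_def add_nonneg_nonneg)
        finally show ?thesis by (simp add: algebra_simps)
      qed
      then have "heat \<tau> x * (\<bar>(Q - ?n / 2)\<^sup>2 - 2 * Q + ?n / 2\<bar> / \<tau>\<^sup>2) \<le> heat \<tau> x * (K * (1 + Q\<^sup>2) / \<tau>\<^sup>2)"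
        by (intro mult_left_mono divide_right_mono) auto
      also have "\<dots> = K * ((1 + Q\<^sup>2) * heat \<tau> x) / \<tau>\<^sup>2" by simp
      also have "\<dots> \<le> K * (C * \<tau> powr (\<alpha> / 2) * weight \<alpha> x) / \<tau>\<^sup>2"
        unfolding Q_def using \<tau> r by (intro divide_right_mono mult_left_mono K C(2)) auto
      also have "\<dots> = K * (C * (\<tau> powr (\<alpha> / 2) / \<tau>\<^sup>2) * weight \<alpha> x)" by simp
      also have "\<tau> powr (\<alpha> / 2) / \<tau>\<^sup>2 = \<tau> powr (\<alpha> / 2 - 2)"
        using \<tau>(1) by (simp add: powr_diff)
      also have "K * (C * \<tau> powr (\<alpha> / 2 - 2) * weight \<alpha> x) \<le> K * (C * (r + s) powr (\<alpha> / 2 - 2) * weight \<alpha> x)"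
        using \<tau> r st \<alpha> by (intro mult_left_mono mult_right_mono powr_mono2' K C(1)) auto
      finally have main: "heat \<tau> x * (\<bar>(Q - ?n / 2)\<^sup>2 - 2 * Q + ?n / 2\<bar> / \<tau>\<^sup>2) \<le> K * (C * (r + s) powr (\<alpha> / 2 - 2) * weight \<alpha> x)" .
      have p'': "\<bar>p'' \<sigma>\<bar> = d\<^sup>2 * (heat \<tau> x * (\<bar>(Q - ?n / 2)\<^sup>2 - 2 * Q + ?n / 2\<bar> / \<tau>\<^sup>2))"
        unfolding p''_def \<tau>_def[symmetric] eq by (simp add: abs_mult)
      show "\<bar>p'' \<sigma>\<bar> \<le> d\<^sup>2 * (K * (C * (r + s) powr (\<alpha> / 2 - 2) * weight \<alpha> x))"
        unfolding p'' by (rule mult_left_mono[OF main]) simp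
    qed
    moreover have "T 0 = r + (s + t) / 2" "T 1 = r + t" "T (-1) = r + s"
      unfolding T_def d_def by (simp_all add: field_simps)
    then have "p 0 = heat (r + (s + t) / 2) x" "p 1 = heat (r + t) x" "p (-1) = heat (r + s) x"
      by (simp_all add: p_def)
    ultimately show ?thesis by (simp add: mult_ac abs_minus_commute)
  qed
  moreover have "0 \<le> 2 * (d\<^sup>2 * (K * C))" using K C(1) by auto
  ultimately show thesis using that by blast
qed

section \<open>Second time differences of the heat kernel as fractional Laplacians\<close>

text \<open>What the proof uses of an \<alpha>-harmonic function, for a Borel representative and with respect to
Lebesgue-Borel measure. The test functions are those that occur
when \<open>u\<close> is mollified.\<close>

definition weakly_harmonic :: "real \<Rightarrow> (real ^ 'n::finite \<Rightarrow> real) \<Rightarrow> bool" where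
  "weakly_harmonic \<alpha> u \<longleftrightarrow> u \<in> borel_measurable borel \<and> integrable lborel (\<lambda>x. u x * weight \<alpha> x) \<and>
     (\<forall>b e. 0 < e \<longrightarrow> (\<integral>x. u x * sym_lap \<alpha> (bump e) (b - x) \<partial>lborel) = 0)"

lemma Gamma_integral_scaled:
  fixes s a :: real
  assumes s: "0 < s" and a: "0 < a"
  shows "has_bochner_integral lborel (\<lambda>r. indicator {0<..} r * (r powr (s - 1) * exp (- (r * a)))) (Gamma s * a powr (- s))"
proof (rule has_bochner_integral_nn_integral)
  have "(\<integral>\<^sup>+r. ennreal (indicator {0<..} r * (r powr (s - 1) * exp (- (r * a)))) \<partial>lborel) =
     (\<integral>\<^sup>+r\<in>{0<..}. ennreal (r powr (s - 1) * exp (- (r * a))) \<partial>lborel)"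
    by (intro nn_integral_cong) (auto simp: indicator_def)
  then show "(\<integral>\<^sup>+r. ennreal (indicator {0<..} r * (r powr (s - 1) * exp (- (r * a)))) \<partial>lborel) = ennreal (Gamma s * a powr (- s))"
    using nn_integral_Gamma_scaled[OF s a] by simp
  show "0 \<le> Gamma s * a powr (- s)" using Gamma_real_pos[OF s] by simp
qed (auto simp: indicator_def)

text \<open>The Riesz potential of the second time difference converges: \<open>\<alpha> > 0\<close> gives integrability at zero, and
the two time derivatives give the exponent \<open>\<alpha> - 3 < - 1\<close> at infinity.\<close>

lemma riesz_weight_integrable:
  fixes \<alpha> s :: real
  assumes \<alpha>: "0 < \<alpha>" "\<alpha> < 2" and s: "0 < s"
  shows "integrable lborel (\<lambda>r. indicator {0<..} r * (r powr (\<alpha> / 2 - 1) * (r + s) powr (\<alpha> / 2 - 2)))"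
proof -
  let ?h = "\<lambda>r. indicator {0<..} r * (if r \<le> 1 then r powr (\<alpha> / 2 - 1) else r powr (\<alpha> - 3)) :: real"
  have "(\<integral>\<^sup>+r. ennreal (?h r) \<partial>lborel) =
     (\<integral>\<^sup>+r\<in>{0<..}. ennreal (if r \<le> 1 then r powr (\<alpha> / 2 - 1) else r powr (\<alpha> - 3)) \<partial>lborel)"
    by (intro nn_integral_cong) (auto simp: indicator_def)
  also have "\<dots> < \<infinity>" using \<alpha> by (intro nn_integral_powr_split) auto
  finally have h: "integrable lborel ?h" by (intro integrableI_nonneg) (auto simp: indicator_def)
  have "integrable lborel (\<lambda>r. (s powr (\<alpha> / 2 - 2) + 1) * ?h r)" by (intro integrable_mult_right h)
  then show ?thesis
  proof (rule Bochner_Integration.integrable_bound, measurable, intro AE_I2)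
    fix r :: real
    have "r powr (\<alpha> / 2 - 1) * (r + s) powr (\<alpha> / 2 - 2) \<le> (s powr (\<alpha> / 2 - 2) + 1) * (if r \<le> 1 then r powr (\<alpha> / 2 - 1) else r powr (\<alpha> - 3))"
      if r: "0 < r"
    proof (cases "r \<le> 1")
      case True
      have "(r + s) powr (\<alpha> / 2 - 2) \<le> s powr (\<alpha> / 2 - 2)"
        using r s \<alpha> by (intro powr_mono2') auto
      then have "r powr (\<alpha> / 2 - 1) * (r + s) powr (\<alpha> / 2 - 2) \<le> r powr (\<alpha> / 2 - 1) * (s powr (\<alpha> / 2 - 2) + 1)"
        by (intro mult_left_mono) auto
      then show ?thesis using True by (simp add: mult.commute)
    next
      case False
      have "(r + s) powr (\<alpha> / 2 - 2) \<le> r powr (\<alpha> / 2 - 2)"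
        using r s \<alpha> by (intro powr_mono2') auto
      then have "r powr (\<alpha> / 2 - 1) * (r + s) powr (\<alpha> / 2 - 2) \<le> r powr (\<alpha> / 2 - 1) * r powr (\<alpha> / 2 - 2)"
        by (intro mult_left_mono) auto
      also have "\<dots> = 1 * r powr (\<alpha> - 3)" by (simp flip: powr_add)
      also have "\<dots> \<le> (s powr (\<alpha> / 2 - 2) + 1) * r powr (\<alpha> - 3)" by (intro mult_right_mono) auto
      finally show ?thesis using False by simp
    qed
    then show "norm (indicator {0<..} r * (r powr (\<alpha> / 2 - 1) * (r + s) powr (\<alpha> / 2 - 2))) \<le> norm ((s powr (\<alpha> / 2 - 2) + 1) * ?h r)"
      by (auto simp: indicator_def abs_mult)
  qed
qed

text \<open>The second difference is the square \<open>exp (- s y) (1 - exp (- z))\<^sup>2\<close> with \<open>z = (t - s) y / 2\<close>. This shows that it is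
nonnegative, which makes Fubini's theorem for the Riesz potential easy, and that it vanishes at the
origin fast enough for the division by \<open>|\<xi>|\<^sup>\<alpha>\<close>.\<close>

lemma gaussian_second_difference_bound:
  fixes \<alpha> s t y :: real
  assumes \<alpha>: "0 < \<alpha>" "\<alpha> < 2" and st: "0 < s" "s < t" and y: "0 \<le> y"
  shows "0 \<le> exp (- (s * y)) - 2 * exp (- ((s + t) / 2 * y)) + exp (- (t * y))"
    and "exp (- (s * y)) - 2 * exp (- ((s + t) / 2 * y)) + exp (- (t * y))
       \<le> exp (- (s * y)) * ((t - s) / 2) powr (\<alpha> / 2) * y powr (\<alpha> / 2)"
proof -
  define z where "z = (t - s) / 2 * y"
  have z: "0 \<le> z" using st y by (simp add: z_def)
  have eq: "exp (- (s * y)) - 2 * exp (- ((s + t) / 2 * y)) + exp (- (t * y)) = exp (- (s * y)) * (1 - exp (- z))\<^sup>2"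
  proof -
    have "exp (- (s * y)) * exp (- z) = exp (- ((s + t) / 2 * y))"
      unfolding exp_add[symmetric] z_def by (rule arg_cong[of _ _ exp]) (simp add: field_simps)
    moreover have "exp (- (s * y)) * (exp (- z) * exp (- z)) = exp (- (t * y))"
      unfolding exp_add[symmetric] z_def by (rule arg_cong[of _ _ exp]) (simp add: field_simps)
    ultimately show ?thesis by (simp add: power2_eq_square algebra_simps)
  qed
  show "0 \<le> exp (- (s * y)) - 2 * exp (- ((s + t) / 2 * y)) + exp (- (t * y))"
    unfolding eq by simp
  have e: "0 \<le> 1 - exp (- z)" "1 - exp (- z) \<le> 1" "1 - exp (- z) \<le> z"
    using z exp_ge_add_one_self[of "- z"] by auto
  have "1 - exp (- z) \<le> z powr (\<alpha> / 2)"
  proof (cases "z \<le> 1")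
    case True
    have "z = z powr 1" using z by simp
    also have "\<dots> \<le> z powr (\<alpha> / 2)" using True z \<alpha> by (intro powr_mono') auto
    finally show ?thesis using e by linarith
  next
    case False
    then have "1 \<le> z powr (\<alpha> / 2)" using \<alpha> by (intro ge_one_powr_ge_zero) auto
    then show ?thesis using e by linarith
  qed
  moreover have "(1 - exp (- z))\<^sup>2 \<le> 1 - exp (- z)"
    using mult_left_mono[OF e(2) e(1)] by (simp add: power2_eq_square)
  ultimately have "(1 - exp (- z))\<^sup>2 \<le> z powr (\<alpha> / 2)" by linarith
  also have "\<dots> = ((t - s) / 2) powr (\<alpha> / 2) * y powr (\<alpha> / 2)"
    unfolding z_def by (rule powr_mult)
  finally show "exp (- (s * y)) - 2 * exp (- ((s + t) / 2 * y)) + exp (- (t * y))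
       \<le> exp (- (s * y)) * ((t - s) / 2) powr (\<alpha> / 2) * y powr (\<alpha> / 2)"
    unfolding eq by (simp add: mult.assoc)
qed

text \<open>With \<open>D\<close> the Fourier transform of the second time difference \<open>g\<close>, the function \<open>m = |\<xi>|\<^sup>-\<^sup>\<alpha> D\<close> is
integrable. Its inverse transform is the Riesz potential \<open>f\<close>, an integral over \<open>r\<close> of second time differences of the heat
kernel at times shifted by \<open>r\<close>, because the powers \<open>|\<xi>|\<^sup>-\<^sup>\<alpha>\<close> are superpositions of \<open>exp (- r |\<xi>|\<^sup>2)\<close>. This
representation shows that \<open>f\<close> inherits the decay of the second time differences, and
\<open>harmonic_annihilates\<close> applies.\<close>

lemma harmonic_heat_midpoint:
  fixes u :: "real ^ 'n \<Rightarrow> real"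
  assumes \<alpha>: "0 < \<alpha>" "\<alpha> < 2" and u: "weakly_harmonic \<alpha> u" and st: "0 < s" "s < t"
  shows "(\<integral>x. u x * (heat s (a - x) - 2 * heat ((s + t) / 2) (a - x) + heat t (a - x)) \<partial>lborel) = 0"
proof -
  define c where "c = (4 * pi * pi) powr (- (real CARD('n) / 2))"
  have c0: "0 \<le> c" by (simp add: c_def)
  define D where "D \<xi> = exp (- (s * (norm \<xi>)\<^sup>2)) - 2 * exp (- ((s + t) / 2 * (norm \<xi>)\<^sup>2)) + exp (- (t * (norm \<xi>)\<^sup>2))" for \<xi> :: "real ^ 'n"
  define \<delta> where "\<delta> = ((t - s) / 2) powr (\<alpha> / 2)"
  have \<delta>0: "0 \<le> \<delta>" by (simp add: \<delta>_def)
  have [measurable]: "D \<in> borel_measurable borel" unfolding D_def[abs_def] by measurable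
  have D0: "0 \<le> D \<xi>" for \<xi>
    unfolding D_def by (rule gaussian_second_difference_bound(1)[OF \<alpha> st]) simp
  have Dle: "D \<xi> \<le> exp (- (s * (norm \<xi>)\<^sup>2)) * \<delta> * norm \<xi> powr \<alpha>" for \<xi>
    using gaussian_second_difference_bound(2)[OF \<alpha> st, of "(norm \<xi>)\<^sup>2"]
    unfolding D_def \<delta>_def by (simp add: powr_square)
  have D00: "D 0 = 0" by (simp add: D_def)
  define H where "H r x = heat (r + s) x - 2 * heat (r + (s + t) / 2) x + heat (r + t) x" for r and x :: "real ^ 'n"
  have H_meas [measurable]: "(\<lambda>(r, x). H r x) \<in> borel_measurable (borel \<Otimes>\<^sub>M borel)"
    unfolding H_def heat_def by measurable
  obtain C where C: "0 \<le> C" "\<And>r x :: real ^ 'n. 0 \<le> r \<Longrightarrow> \<bar>H r x\<bar> \<le> C * (r + s) powr (\<alpha> / 2 - 2) * weight \<alpha> x"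
    unfolding H_def using heat_time_difference_bound[OF \<alpha> st, where 'n='n] by blast
  have Hf: "has_bochner_integral lborel (\<lambda>\<xi>. of_real (c * (exp (- (r * (norm \<xi>)\<^sup>2)) * D \<xi>)) * cis (x \<bullet> \<xi>)) (of_real (H r x))"
    if r: "0 \<le> r" for r x
  proof -
    have "has_bochner_integral lborel (\<lambda>\<xi>.
        of_real (c * exp (- ((r + s) * (norm \<xi>)\<^sup>2))) * cis (x \<bullet> \<xi>) -
        2 * (of_real (c * exp (- ((r + (s + t) / 2) * (norm \<xi>)\<^sup>2))) * cis (x \<bullet> \<xi>)) +
        of_real (c * exp (- ((r + t) * (norm \<xi>)\<^sup>2))) * cis (x \<bullet> \<xi>))
       (of_real (heat (r + s) x) - 2 * of_real (heat (r + (s + t) / 2) x) + of_real (heat (r + t) x))"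
    proof -
      have pos: "0 < r + s" "0 < r + (s + t) / 2" "0 < r + t" using r st by (auto simp: add_nonneg_pos)
      show ?thesis unfolding c_def
        by (intro has_bochner_integral_add has_bochner_integral_diff has_bochner_integral_mult_right impI heat_fourier pos)
    qed
    moreover have "of_real (c * exp (- ((r + s) * (norm \<xi>)\<^sup>2))) * cis (x \<bullet> \<xi>) -
        2 * (of_real (c * exp (- ((r + (s + t) / 2) * (norm \<xi>)\<^sup>2))) * cis (x \<bullet> \<xi>)) +
        of_real (c * exp (- ((r + t) * (norm \<xi>)\<^sup>2))) * cis (x \<bullet> \<xi>) =
        of_real (c * (exp (- (r * (norm \<xi>)\<^sup>2)) * D \<xi>)) * cis (x \<bullet> \<xi>)" for \<xi>
    proof -
      have e: "exp (- ((r + b) * (norm \<xi>)\<^sup>2)) = exp (- (r * (norm \<xi>)\<^sup>2)) * exp (- (b * (norm \<xi>)\<^sup>2))" for b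
        by (simp add: algebra_simps flip: exp_add)
      have "c * exp (- ((r + s) * (norm \<xi>)\<^sup>2)) - 2 * (c * exp (- ((r + (s + t) / 2) * (norm \<xi>)\<^sup>2))) + c * exp (- ((r + t) * (norm \<xi>)\<^sup>2)) =
        c * (exp (- (r * (norm \<xi>)\<^sup>2)) * D \<xi>)"
        unfolding e D_def by (simp only: algebra_simps)
      moreover have "of_real b1 * z - 2 * (of_real b2 * z) + of_real b3 * z = of_real (b1 - 2 * b2 + b3) * z"
        for b1 b2 b3 :: real and z :: complex by (simp add: algebra_simps)
      ultimately show ?thesis by (simp only:)
    qed
    moreover have "of_real (heat (r + s) x) - 2 * of_real (heat (r + (s + t) / 2) x) + of_real (heat (r + t) x) = complex_of_real (H r x)"
      by (simp add: H_def)
    ultimately show ?thesis by (simp only:)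
  qed
  have G0: "0 < Gamma (\<alpha> / 2)" using \<alpha> by (intro Gamma_real_pos) auto
  \<comment> \<open>At \<open>\<xi> = 0\<close> both factors are zero, in agreement with the limit.\<close>
  define m where "m \<xi> = c * (D \<xi> * norm \<xi> powr (- \<alpha>))" for \<xi>
  have [measurable]: "m \<in> borel_measurable borel" unfolding m_def[abs_def] by measurable
  have m0: "0 \<le> m \<xi>" for \<xi> using c0 D0 by (simp add: m_def)
  have m_int: "integrable lborel m"
  proof (rule Bochner_Integration.integrable_bound)
    show "integrable lborel (\<lambda>\<xi> :: real ^ 'n. c * \<delta> * exp (- (s * (norm \<xi>)\<^sup>2)))"
      by (intro integrable_mult_right integrable_gaussian st)
    show "AE \<xi> in lborel. norm (m \<xi>) \<le> norm (c * \<delta> * exp (- (s * (norm \<xi>)\<^sup>2)))"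
    proof (intro AE_I2)
      fix \<xi> :: "real ^ 'n"
      have "D \<xi> * norm \<xi> powr (- \<alpha>) \<le> \<delta> * exp (- (s * (norm \<xi>)\<^sup>2))"
      proof (cases "\<xi> = 0")
        case False
        have "D \<xi> * norm \<xi> powr (- \<alpha>) \<le> (exp (- (s * (norm \<xi>)\<^sup>2)) * \<delta> * norm \<xi> powr \<alpha>) * norm \<xi> powr (- \<alpha>)"
          by (intro mult_right_mono Dle) auto
        also have "\<dots> = exp (- (s * (norm \<xi>)\<^sup>2)) * \<delta> * (norm \<xi> powr \<alpha> * norm \<xi> powr (- \<alpha>))" by simp
        also have "norm \<xi> powr \<alpha> * norm \<xi> powr (- \<alpha>) = 1" using False by (simp flip: powr_add)
        finally show ?thesis by (simp add: mult.commute)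
      qed (use \<delta>0 D00 in auto)
      then have "m \<xi> \<le> c * (\<delta> * exp (- (s * (norm \<xi>)\<^sup>2)))" unfolding m_def using c0 by (rule mult_left_mono)
      then show "norm (m \<xi>) \<le> norm (c * \<delta> * exp (- (s * (norm \<xi>)\<^sup>2)))"
        using m0[of \<xi>] c0 \<delta>0 by (simp add: mult.assoc)
    qed
  qed measurable
  have mD: "norm \<xi> powr \<alpha> * m \<xi> = c * (exp (- (0 * (norm \<xi>)\<^sup>2)) * D \<xi>)" for \<xi>
  proof (cases "\<xi> = 0")
    case False
    have "norm \<xi> powr \<alpha> * m \<xi> = c * D \<xi> * (norm \<xi> powr \<alpha> * norm \<xi> powr (- \<alpha>))" by (simp add: m_def)
    also have "norm \<xi> powr \<alpha> * norm \<xi> powr (- \<alpha>) = 1" using False by (simp flip: powr_add)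
    finally show ?thesis by simp
  qed (simp add: D00 m_def)
  define f where "f x = (1 / Gamma (\<alpha> / 2)) * (\<integral>r. indicator {0<..} r * (r powr (\<alpha> / 2 - 1) * H r x) \<partial>lborel)" for x
  have f_meas: "f \<in> borel_measurable borel" unfolding f_def[abs_def] by measurable
  define J where "J = (\<integral>r. indicator {0<..} r * (r powr (\<alpha> / 2 - 1) * (r + s) powr (\<alpha> / 2 - 2)) \<partial>lborel)"
  have J: "0 \<le> J" unfolding J_def by (intro integral_nonneg_AE AE_I2) (auto simp: indicator_def)
  have fb: "\<bar>f x\<bar> \<le> (1 / Gamma (\<alpha> / 2) * (C * J)) * weight \<alpha> x" for x
  proof -
    have int: "integrable lborel (\<lambda>r. C * weight \<alpha> x * (indicator {0<..} r * (r powr (\<alpha> / 2 - 1) * (r + s) powr (\<alpha> / 2 - 2))))"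
      by (intro integrable_mult_right riesz_weight_integrable \<alpha> st)
    have le: "norm (indicator {0<..} r * (r powr (\<alpha> / 2 - 1) * H r x)) \<le>
       C * weight \<alpha> x * (indicator {0<..} r * (r powr (\<alpha> / 2 - 1) * (r + s) powr (\<alpha> / 2 - 2)))" for r
    proof -
      have "r powr (\<alpha> / 2 - 1) * \<bar>H r x\<bar> \<le> r powr (\<alpha> / 2 - 1) * (C * (r + s) powr (\<alpha> / 2 - 2) * weight \<alpha> x)" if "0 < r"
        using that by (intro mult_left_mono C) auto
      then show ?thesis
        by (auto simp: indicator_def abs_mult mult_ac)
    qed
    have int': "integrable lborel (\<lambda>r. indicator {0<..} r * (r powr (\<alpha> / 2 - 1) * H r x))"
      by (rule Bochner_Integration.integrable_bound[OF int])
         (measurable, intro AE_I2 order_trans[OF le], simp)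
    have "norm (\<integral>r. indicator {0<..} r * (r powr (\<alpha> / 2 - 1) * H r x) \<partial>lborel) \<le>
      (\<integral>r. C * weight \<alpha> x * (indicator {0<..} r * (r powr (\<alpha> / 2 - 1) * (r + s) powr (\<alpha> / 2 - 2))) \<partial>lborel)"
      by (rule order_trans[OF integral_norm_bound]) (intro integral_mono integrable_norm int int' le)
    also have "\<dots> = C * weight \<alpha> x * J" unfolding J_def by (rule integral_mult_right_zero)
    finally have *: "\<bar>\<integral>r. indicator {0<..} r * (r powr (\<alpha> / 2 - 1) * H r x) \<partial>lborel\<bar> \<le> C * weight \<alpha> x * J" by simp
    have "\<bar>f x\<bar> = 1 / Gamma (\<alpha> / 2) * \<bar>\<integral>r. indicator {0<..} r * (r powr (\<alpha> / 2 - 1) * H r x) \<partial>lborel\<bar>"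
      using G0 by (simp add: f_def abs_mult)
    also have "\<dots> \<le> 1 / Gamma (\<alpha> / 2) * (C * weight \<alpha> x * J)" using G0 by (intro mult_left_mono *) auto
    finally show ?thesis by (simp add: mult_ac)
  qed
  have F: "of_real (f x) = (\<integral>\<xi>. of_real (m \<xi>) * cis (x \<bullet> \<xi>) \<partial>lborel)" for x
  proof -
    let ?w = "\<lambda>r \<xi>. indicator {0<..} r * (r powr (\<alpha> / 2 - 1) * exp (- (r * (norm \<xi>)\<^sup>2))) :: real"
    let ?k = "\<lambda>\<xi> r. of_real (c * D \<xi> * ?w r \<xi>) * cis (x \<bullet> \<xi>)"
    have nm: "norm (?k \<xi> r) = c * D \<xi> * ?w r \<xi>" for \<xi> r
      using c0 D0[of \<xi>] by (simp only: norm_mult norm_cis mult_1_right norm_of_real) (simp add: abs_mult indicator_def)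
    have w: "has_bochner_integral lborel (\<lambda>r. c * D \<xi> * ?w r \<xi>) (Gamma (\<alpha> / 2) * m \<xi>)" for \<xi>
    proof (cases "\<xi> = 0")
      case False
      have "has_bochner_integral lborel (\<lambda>r. c * D \<xi> * ?w r \<xi>) (c * D \<xi> * (Gamma (\<alpha> / 2) * ((norm \<xi>)\<^sup>2) powr (- (\<alpha> / 2))))"
        using \<alpha> False by (intro has_bochner_integral_mult_right Gamma_integral_scaled) auto
      moreover have "((norm \<xi>)\<^sup>2) powr (- (\<alpha> / 2)) = norm \<xi> powr (- \<alpha>)" by (simp add: powr_square)
      ultimately show ?thesis by (simp add: m_def mult_ac)
    qed (simp add: D00 m_def has_bochner_integral_zero)
    have "complex_of_real (\<integral>r. indicator {0<..} r * (r powr (\<alpha> / 2 - 1) * H r x) \<partial>lborel) =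
      (\<integral>r. of_real (indicator {0<..} r * (r powr (\<alpha> / 2 - 1) * H r x)) \<partial>lborel)"
      by (rule integral_complex_of_real[symmetric])
    also have "\<dots> = (\<integral>r. (\<integral>\<xi>. ?k \<xi> r \<partial>lborel) \<partial>lborel)"
    proof (intro Bochner_Integration.integral_cong refl)
      fix r :: real
      show "of_real (indicator {0<..} r * (r powr (\<alpha> / 2 - 1) * H r x)) = (\<integral>\<xi>. ?k \<xi> r \<partial>lborel)"
      proof (cases "0 < r")
        case True
        have "(\<integral>\<xi>. ?k \<xi> r \<partial>lborel) = (\<integral>\<xi>. of_real (r powr (\<alpha> / 2 - 1)) * (of_real (c * (exp (- (r * (norm \<xi>)\<^sup>2)) * D \<xi>)) * cis (x \<bullet> \<xi>)) \<partial>lborel)"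
          using True by (intro Bochner_Integration.integral_cong refl) (simp add: mult_ac)
        also have "\<dots> = of_real (r powr (\<alpha> / 2 - 1)) * of_real (H r x)"
          using has_bochner_integral_integral_eq[OF Hf[of r x]] True by (simp only: integral_mult_right_zero)
        finally show ?thesis using True by simp
      qed simp
    qed
    also have "\<dots> = (\<integral>\<xi>. (\<integral>r. ?k \<xi> r \<partial>lborel) \<partial>lborel)"
    proof (rule lborel_swap_integrals[symmetric])
      show "(\<lambda>(\<xi>, r). ?k \<xi> r) \<in> borel_measurable (borel \<Otimes>\<^sub>M borel)" unfolding cis_conv_exp by measurable
      show "integrable lborel (?k \<xi>)" for \<xi>
        using w[of \<xi>] by (intro integrable_mult_left integrable_of_real) (simp add: has_bochner_integral_iff)
      show "integrable lborel (\<lambda>\<xi>. Gamma (\<alpha> / 2) * m \<xi>)" by (intro integrable_mult_right m_int)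
      show "(\<integral>r. norm (?k \<xi> r) \<partial>lborel) \<le> Gamma (\<alpha> / 2) * m \<xi>" for \<xi>
        by (simp only: nm has_bochner_integral_integral_eq[OF w] order_refl)
    qed
    also have "\<dots> = (\<integral>\<xi>. of_real (Gamma (\<alpha> / 2)) * (of_real (m \<xi>) * cis (x \<bullet> \<xi>)) \<partial>lborel)"
      by (simp only: integral_mult_left_zero integral_complex_of_real has_bochner_integral_integral_eq[OF w]) (simp add: mult.assoc)
    also have "\<dots> = of_real (Gamma (\<alpha> / 2)) * (\<integral>\<xi>. of_real (m \<xi>) * cis (x \<bullet> \<xi>) \<partial>lborel)"
      by (rule integral_mult_right_zero)
    finally show ?thesis using G0 unfolding f_def by (simp add: of_real_mult of_real_divide)
  qed
  have G: "of_real (H 0 x) = (\<integral>\<xi>. of_real (norm \<xi> powr \<alpha> * m \<xi>) * cis (x \<bullet> \<xi>) \<partial>lborel)" for x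
    unfolding mD by (rule has_bochner_integral_integral_eq[OF Hf, symmetric]) simp
  have mint2: "integrable lborel (\<lambda>\<xi>. norm \<xi> powr \<alpha> * m \<xi>)"
  proof -
    have "integrable lborel (\<lambda>\<xi>. of_real (c * (exp (- (0 * (norm \<xi>)\<^sup>2)) * D \<xi>)) * cis (0 \<bullet> \<xi>))"
      using Hf[of 0 0] by (simp add: has_bochner_integral_iff)
    from integrable_Re[OF this] show ?thesis unfolding mD by simp
  qed
  have gc: "continuous_on UNIV (H 0)"
    unfolding H_def using st by (intro continuous_intros heat_continuous) auto
  have gb: "\<bar>H 0 x\<bar> \<le> (C * s powr (\<alpha> / 2 - 2)) * weight \<alpha> x" for x using C(2)[of 0 x] by simp
  have "(\<integral>x. u x * H 0 (a - x) \<partial>lborel) = 0"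
  proof (rule harmonic_annihilates[OF \<alpha> _ f_meas _ _ m_int mint2 F G fb gc gb])
    show "u \<in> borel_measurable borel" "integrable lborel (\<lambda>x. u x * weight \<alpha> x)"
      using u by (auto simp: weakly_harmonic_def)
    show "(\<integral>x. u x * sym_lap \<alpha> (bump e) (b - x) \<partial>lborel) = 0" if "0 < e" for b e
      using u that by (auto simp: weakly_harmonic_def)
  qed
  then show ?thesis by (simp add: H_def)
qed

section \<open>The heat flow of an \<alpha>-harmonic function\<close>

definition heat_flow :: "(real ^ 'n::finite \<Rightarrow> real) \<Rightarrow> real \<Rightarrow> real ^ 'n \<Rightarrow> real" where
  "heat_flow u t a = (\<integral>x. u x * heat t (a - x) \<partial>lborel)"

lemma weakly_harmonic_measurable: "weakly_harmonic \<alpha> u \<Longrightarrow> u \<in> borel_measurable borel"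
  by (simp add: weakly_harmonic_def)

lemma weakly_harmonic_integrable: "weakly_harmonic \<alpha> u \<Longrightarrow> integrable lborel (\<lambda>x. u x * weight \<alpha> x)"
  by (simp add: weakly_harmonic_def)

lemma heat_flow_integrable:
  fixes u :: "real ^ 'n \<Rightarrow> real"
  assumes \<alpha>: "0 < \<alpha>" and u: "weakly_harmonic \<alpha> u" and t: "0 < t"
  shows "integrable lborel (\<lambda>x. u x * heat t (a - x))"
proof -
  obtain C where C: "0 \<le> C" "\<And>\<tau> x :: real ^ 'n. t \<le> \<tau> \<Longrightarrow> heat \<tau> x \<le> C * \<tau> powr (\<alpha> / 2) * weight \<alpha> x"
    using heat_le[OF \<alpha> t, where 'n='n] by blast
  show ?thesis
    by (rule weight_weighted_integrable[OF \<alpha> weakly_harmonic_measurable[OF u] _ weakly_harmonic_integrable[OF u], where C="C * t powr (\<alpha> / 2)"])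
       (use C in auto)
qed

lemma integral_weighted_bound:
  fixes u g :: "real ^ 'n \<Rightarrow> real"
  assumes \<alpha>: "0 < \<alpha>" and u: "weakly_harmonic \<alpha> u" and g: "\<And>x. \<bar>g x\<bar> \<le> C * weight \<alpha> x"
    and int: "integrable lborel (\<lambda>x. u x * g (a - x))"
  shows "\<bar>\<integral>x. u x * g (a - x) \<partial>lborel\<bar> \<le> C * (\<integral>x. \<bar>u x * weight \<alpha> (a - x)\<bar> \<partial>lborel)"
proof -
  have w: "integrable lborel (\<lambda>x. u x * weight \<alpha> (a - x))"
    by (rule weight_weighted_integrable[OF \<alpha> weakly_harmonic_measurable[OF u] _ weakly_harmonic_integrable[OF u], where C=1]) auto
  have "\<bar>\<integral>x. u x * g (a - x) \<partial>lborel\<bar> \<le> (\<integral>x. \<bar>u x * g (a - x)\<bar> \<partial>lborel)"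
    by (rule integral_abs_bound)
  also have "\<dots> \<le> (\<integral>x. C * \<bar>u x * weight \<alpha> (a - x)\<bar> \<partial>lborel)"
  proof (intro integral_mono integrable_abs int integrable_mult_right w)
    fix x
    have "\<bar>u x\<bar> * \<bar>g (a - x)\<bar> \<le> \<bar>u x\<bar> * (C * weight \<alpha> (a - x))" by (intro mult_left_mono g) auto
    then show "\<bar>u x * g (a - x)\<bar> \<le> C * \<bar>u x * weight \<alpha> (a - x)\<bar>" by (simp add: abs_mult mult_ac)
  qed
  also have "\<dots> = C * (\<integral>x. \<bar>u x * weight \<alpha> (a - x)\<bar> \<partial>lborel)" by (rule integral_mult_right_zero)
  finally show ?thesis .
qed

text \<open>Midpoint-affinity makes the increment \<open>E(k)\<close> over the time \<open>2\<^sup>k h\<close> double in each step, so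
\<open>E(k) = 2\<^sup>k E(0)\<close>; but it is bounded by a multiple of \<open>2\<^sup>k\<close> to the power \<open>\<alpha> / 2 < 1\<close>, whence
\<open>E(0) = 0\<close>.\<close>

lemma heat_flow_constant_less:
  fixes u :: "real ^ 'n \<Rightarrow> real"
  assumes \<alpha>: "0 < \<alpha>" "\<alpha> < 2" and u: "weakly_harmonic \<alpha> u" and st: "0 < s" "s < t"
  shows "heat_flow u t a = heat_flow u s a"
proof -
  define h where "h = t - s"
  have h: "0 < h" using st by (simp add: h_def)
  obtain C where C: "0 \<le> C" "\<And>\<tau> x :: real ^ 'n. s \<le> \<tau> \<Longrightarrow> heat \<tau> x \<le> C * \<tau> powr (\<alpha> / 2) * weight \<alpha> x"
    using heat_le[OF \<alpha>(1) st(1), where 'n='n] by blast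
  define I where "I = (\<integral>x. \<bar>u x * weight \<alpha> (a - x)\<bar> \<partial>lborel)"
  have I: "0 \<le> I" unfolding I_def by (intro integral_nonneg_AE AE_I2) auto
  have growth: "\<bar>heat_flow u \<tau> a\<bar> \<le> C * \<tau> powr (\<alpha> / 2) * I" if "s \<le> \<tau>" for \<tau>
    unfolding heat_flow_def I_def
    using that st C(2)[OF that] by (intro integral_weighted_bound \<alpha> u heat_flow_integrable[OF \<alpha>(1) u]) auto
  define E where "E k = heat_flow u (s + 2 ^ k * h) a - heat_flow u s a" for k :: nat
  have E_Suc: "E (Suc k) = 2 * E k" for k
  proof -
    let ?t = "s + 2 ^ Suc k * h"
    have mid: "(s + ?t) / 2 = s + 2 ^ k * h" by (simp add: field_simps)
    have t: "s < ?t" using h by simp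
    have pos: "0 < s + 2 ^ k * h" "0 < ?t" using h st by (auto intro!: add_pos_pos)
    have "0 = (\<integral>x. u x * (heat s (a - x) - 2 * heat (s + 2 ^ k * h) (a - x) + heat ?t (a - x)) \<partial>lborel)"
      using harmonic_heat_midpoint[OF \<alpha> u st(1) t, of a] unfolding mid by simp
    also have "\<dots> = (\<integral>x. u x * heat s (a - x) - 2 * (u x * heat (s + 2 ^ k * h) (a - x)) + u x * heat ?t (a - x) \<partial>lborel)"
      by (simp add: algebra_simps)
    also have "\<dots> = heat_flow u s a - 2 * heat_flow u (s + 2 ^ k * h) a + heat_flow u ?t a"
      using heat_flow_integrable[OF \<alpha>(1) u st(1), of a] heat_flow_integrable[OF \<alpha>(1) u pos(1), of a]
        heat_flow_integrable[OF \<alpha>(1) u pos(2), of a]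
      unfolding heat_flow_def by simp
    finally show ?thesis by (simp add: E_def)
  qed
  then have E_pow: "E k = 2 ^ k * E 0" for k by (induction k) auto
  \<comment> \<open>The ratio of the growth \<open>2\<^sup>k\<^sup>\<alpha>\<^sup>/\<^sup>2\<close> to the doubling \<open>2\<^sup>k\<close>.\<close>
  define q where "q = 2 powr (\<alpha> / 2 - 1)"
  have q: "0 \<le> q" "q < 1" using \<alpha> by (auto simp: q_def powr_less_one)
  have "\<bar>E 0\<bar> \<le> C * (s + h) powr (\<alpha> / 2) * I * q ^ k + \<bar>heat_flow u s a\<bar> * (1 / 2) ^ k" for k
  proof -
    have "\<bar>E k\<bar> \<le> \<bar>heat_flow u (s + 2 ^ k * h) a\<bar> + \<bar>heat_flow u s a\<bar>"
      unfolding E_def by simp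
    also have "\<bar>heat_flow u (s + 2 ^ k * h) a\<bar> \<le> C * (s + 2 ^ k * h) powr (\<alpha> / 2) * I"
      using h by (intro growth) auto
    also have "\<dots> \<le> C * (2 ^ k * (s + h)) powr (\<alpha> / 2) * I"
    proof -
      have "s * 1 \<le> s * 2 ^ k" using st by (intro mult_left_mono) auto
      then have "s + 2 ^ k * h \<le> 2 ^ k * (s + h)" by (simp add: algebra_simps)
      then show ?thesis using st h \<alpha> C(1) I by (intro mult_right_mono mult_left_mono powr_mono2) auto
    qed
    finally have *: "\<bar>E k\<bar> \<le> C * (2 ^ k * (s + h)) powr (\<alpha> / 2) * I + \<bar>heat_flow u s a\<bar>" by simp
    have qk: "(2 ^ k) powr (\<alpha> / 2) = 2 ^ k * q ^ k"
    proof -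
      have "(2 ^ k) powr (\<alpha> / 2) = (2 powr (\<alpha> / 2)) ^ k"
        by (simp add: powr_realpow[symmetric] powr_powr mult.commute)
      also have "2 powr (\<alpha> / 2) = 2 * q" by (simp add: q_def powr_diff)
      finally show ?thesis by (simp add: power_mult_distrib)
    qed
    have "\<bar>E 0\<bar> = \<bar>E k\<bar> / 2 ^ k" by (simp add: E_pow[of k] abs_mult)
    also have "\<dots> \<le> (C * (2 ^ k * (s + h)) powr (\<alpha> / 2) * I + \<bar>heat_flow u s a\<bar>) / 2 ^ k"
      by (intro divide_right_mono *) auto
    also have "\<dots> = C * (s + h) powr (\<alpha> / 2) * I * q ^ k + \<bar>heat_flow u s a\<bar> * (1 / 2) ^ k"
      by (simp add: powr_mult qk add_divide_distrib power_one_over)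
    finally show ?thesis .
  qed
  moreover have "(\<lambda>k. C * (s + h) powr (\<alpha> / 2) * I * q ^ k + \<bar>heat_flow u s a\<bar> * (1 / 2) ^ k) \<longlonglongrightarrow>
      C * (s + h) powr (\<alpha> / 2) * I * 0 + \<bar>heat_flow u s a\<bar> * 0"
    using q by (intro tendsto_intros LIMSEQ_realpow_zero) auto
  ultimately have "\<bar>E 0\<bar> \<le> C * (s + h) powr (\<alpha> / 2) * I * 0 + \<bar>heat_flow u s a\<bar> * 0"
    by (intro LIMSEQ_le_const) auto
  then show ?thesis by (simp add: E_def h_def)
qed

lemma heat_flow_constant:
  fixes u :: "real ^ 'n \<Rightarrow> real"
  assumes \<alpha>: "0 < \<alpha>" "\<alpha> < 2" and u: "weakly_harmonic \<alpha> u" and st: "0 < s" "0 < t"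
  shows "heat_flow u t a = heat_flow u s a"
  using heat_flow_constant_less[OF \<alpha> u, of s t a] heat_flow_constant_less[OF \<alpha> u, of t s a] st
  by (cases s t rule: linorder_cases) auto

text \<open>Two derivatives in space gain a factor \<open>1 / t\<close> over the bound for the heat kernel.\<close>

lemma heat_space_difference_bound:
  fixes h :: "real ^ 'n"
  assumes \<alpha>: "0 < \<alpha>"
  obtains C where "0 \<le> C"
    "\<And>t z :: real ^ 'n. 1 \<le> t \<Longrightarrow> \<bar>second_diff (heat t) z h\<bar> \<le> C * t powr (\<alpha> / 2 - 1) * weight \<alpha> z"
proof -
  let ?N = "real CARD('n) + \<alpha>"
  obtain C where C: "0 \<le> C" "\<And>\<tau> x :: real ^ 'n. 1 \<le> \<tau> \<Longrightarrow>
    (1 + ((norm x)\<^sup>2 / (4 * \<tau>))\<^sup>2) * heat \<tau> x \<le> C * \<tau> powr (\<alpha> / 2) * weight \<alpha> x"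
    using heat_bound[OF \<alpha>, of 1, where 'n='n] by auto
  define A where "A = 2 powr ?N * (1 + norm h powr ?N)"
  have A: "0 \<le> A" by (simp add: A_def)
  have "\<bar>second_diff (heat t) z h\<bar> \<le> (2 * ((norm h)\<^sup>2 * C * A)) * t powr (\<alpha> / 2 - 1) * weight \<alpha> z" if t: "1 \<le> t" for t and z :: "real ^ 'n"
  proof -
    have t0: "0 < t" using t by simp
    define y where "y \<sigma> = z + \<sigma> *\<^sub>R h" for \<sigma>
    define p where "p \<sigma> = heat t (y \<sigma>)" for \<sigma>
    define p' where "p' \<sigma> = heat t (y \<sigma>) * (- ((y \<sigma> \<bullet> h) / (2 * t)))" for \<sigma>
    define p'' where "p'' \<sigma> = heat t (y \<sigma>) * (((y \<sigma> \<bullet> h) / (2 * t))\<^sup>2 - (norm h)\<^sup>2 / (2 * t))" for \<sigma>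
    have dn: "((\<lambda>\<sigma>. (norm (y \<sigma>))\<^sup>2) has_real_derivative 2 * (y \<sigma> \<bullet> h)) (at \<sigma>)" for \<sigma>
    proof -
      have eq: "(norm (y \<sigma>))\<^sup>2 = z \<bullet> z + 2 * \<sigma> * (z \<bullet> h) + \<sigma>\<^sup>2 * (h \<bullet> h)" for \<sigma>
        unfolding power2_norm_eq_inner y_def
        by (simp add: inner_add_left inner_add_right inner_commute power2_eq_square algebra_simps)
      show ?thesis unfolding eq
        by (auto intro!: derivative_eq_intros simp: y_def inner_add_left algebra_simps)
    qed
    have dp: "(p has_real_derivative p' \<sigma>) (at \<sigma>)" for \<sigma>
    proof -
      have "((\<lambda>\<sigma>. (4 * pi * t) powr (- (real CARD('n) / 2)) * exp (- ((norm (y \<sigma>))\<^sup>2 / (4 * t)))) has_real_derivative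
         (4 * pi * t) powr (- (real CARD('n) / 2)) * (exp (- ((norm (y \<sigma>))\<^sup>2 / (4 * t))) * (- (2 * (y \<sigma> \<bullet> h) / (4 * t))))) (at \<sigma>)"
        by (intro DERIV_cmult DERIV_chain2[OF DERIV_exp] DERIV_minus DERIV_cdivide dn)
      then show ?thesis by (simp add: p_def[abs_def] p'_def heat_def mult.assoc)
    qed
    have "\<bar>2 * p 0 - p 1 - p (-1)\<bar> \<le> 2 * ((norm h)\<^sup>2 * C * A * t powr (\<alpha> / 2 - 1) * weight \<alpha> z)"
    proof (rule second_difference_bound[OF dp])
      fix \<sigma> :: real assume \<sigma>: "\<bar>\<sigma>\<bar> \<le> 1"
      have dy: "((\<lambda>\<sigma>. - ((y \<sigma> \<bullet> h) / (2 * t))) has_real_derivative - ((norm h)\<^sup>2 / (2 * t))) (at \<sigma>)"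
        unfolding y_def inner_add_left power2_norm_eq_inner using t0 by (auto intro!: derivative_eq_intros)
      show "(p' has_real_derivative p'' \<sigma>) (at \<sigma>)"
        using DERIV_mult[OF dp dy] unfolding p_def p'_def[abs_def] p''_def
        by (simp add: algebra_simps power2_eq_square)
      define Q where "Q = (norm (y \<sigma>))\<^sup>2 / (4 * t)"
      have "\<bar>y \<sigma> \<bullet> h\<bar>\<^sup>2 \<le> (norm (y \<sigma>) * norm h)\<^sup>2"
        by (intro power_mono Cauchy_Schwarz_ineq2) auto
      then have "(y \<sigma> \<bullet> h)\<^sup>2 / (4 * t\<^sup>2) \<le> (norm (y \<sigma>))\<^sup>2 * (norm h)\<^sup>2 / (4 * t\<^sup>2)"
        by (intro divide_right_mono) (auto simp: power_mult_distrib)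
      also have "\<dots> = (norm h)\<^sup>2 / t * Q" using t0 by (simp add: Q_def power2_eq_square field_simps)
      finally have 1: "((y \<sigma> \<bullet> h) / (2 * t))\<^sup>2 \<le> (norm h)\<^sup>2 / t * Q" by (simp add: power_divide power_mult_distrib)
      have 2: "Q + 1 / 2 \<le> 1 + Q\<^sup>2"
        using zero_le_power2[of "Q - 1/2"] by (simp add: power2_eq_square algebra_simps)
      have "\<bar>((y \<sigma> \<bullet> h) / (2 * t))\<^sup>2 - (norm h)\<^sup>2 / (2 * t)\<bar> \<le> (norm h)\<^sup>2 / t * Q + (norm h)\<^sup>2 / (2 * t)"
      proof -
        have "0 \<le> ((y \<sigma> \<bullet> h) / (2 * t))\<^sup>2" "0 \<le> (norm h)\<^sup>2 / (2 * t)" using t0 by auto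
        with 1 show ?thesis by linarith
      qed
      also have "\<dots> = (norm h)\<^sup>2 / t * (Q + 1 / 2)" using t0 by (simp add: field_simps)
      also have "\<dots> \<le> (norm h)\<^sup>2 / t * (1 + Q\<^sup>2)" using t0 by (intro mult_left_mono 2) auto
      finally have 3: "\<bar>((y \<sigma> \<bullet> h) / (2 * t))\<^sup>2 - (norm h)\<^sup>2 / (2 * t)\<bar> \<le> (norm h)\<^sup>2 / t * (1 + Q\<^sup>2)" .
      have "\<bar>p'' \<sigma>\<bar> \<le> heat t (y \<sigma>) * ((norm h)\<^sup>2 / t * (1 + Q\<^sup>2))"
        by (simp only: p''_def abs_mult abs_of_nonneg[OF heat_nonneg]) (rule mult_left_mono[OF 3 heat_nonneg])
      also have "\<dots> = (norm h)\<^sup>2 / t * ((1 + Q\<^sup>2) * heat t (y \<sigma>))" by simp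
      also have "\<dots> \<le> (norm h)\<^sup>2 / t * (C * t powr (\<alpha> / 2) * weight \<alpha> (y \<sigma>))"
        unfolding Q_def using t0 by (intro mult_left_mono C(2) t) auto
      also have "\<dots> \<le> (norm h)\<^sup>2 / t * (C * t powr (\<alpha> / 2) * (A * weight \<alpha> z))"
      proof -
        have "norm (- (\<sigma> *\<^sub>R h)) powr ?N \<le> norm h powr ?N"
          using \<sigma> \<alpha> by (intro powr_mono2) (auto simp: mult_left_le_one_le)
        then have A': "2 powr ?N * (1 + norm (- (\<sigma> *\<^sub>R h)) powr ?N) \<le> A"
          unfolding A_def by (intro mult_left_mono add_left_mono) auto
        have "weight \<alpha> (y \<sigma>) \<le> 2 powr ?N * (1 + norm (- (\<sigma> *\<^sub>R h)) powr ?N) * weight \<alpha> (y \<sigma> + - (\<sigma> *\<^sub>R h))"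
          by (rule weight_shift[OF \<alpha>])
        also have "\<dots> \<le> A * weight \<alpha> (y \<sigma> + - (\<sigma> *\<^sub>R h))" by (intro mult_right_mono A') auto
        also have "y \<sigma> + - (\<sigma> *\<^sub>R h) = z" by (simp add: y_def)
        finally have "weight \<alpha> (y \<sigma>) \<le> A * weight \<alpha> z" .
        then show ?thesis using C(1) t0 by (intro mult_left_mono) auto
      qed
      also have "\<dots> = (norm h)\<^sup>2 * C * A * (t powr (\<alpha> / 2) / t) * weight \<alpha> z" by simp
      also have "t powr (\<alpha> / 2) / t = t powr (\<alpha> / 2 - 1)" using t0 by (simp add: powr_diff)
      finally show "\<bar>p'' \<sigma>\<bar> \<le> (norm h)\<^sup>2 * C * A * t powr (\<alpha> / 2 - 1) * weight \<alpha> z" .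
    qed
    then show ?thesis by (simp add: p_def y_def second_diff_def mult_ac)
  qed
  moreover have "0 \<le> 2 * ((norm h)\<^sup>2 * C * A)" using C(1) A by auto
  ultimately show thesis using that by blast
qed

text \<open>The second difference does not depend on the time of the flow, and at time \<open>t\<close> it is bounded by a
multiple of \<open>t\<close> to the power \<open>\<alpha> / 2 - 1\<close>, which tends to zero as \<open>\<alpha> < 2\<close>.\<close>

lemma heat_flow_affine:
  fixes u :: "real ^ 'n \<Rightarrow> real"
  assumes \<alpha>: "0 < \<alpha>" "\<alpha> < 2" and u: "weakly_harmonic \<alpha> u"
  shows "second_diff (heat_flow u 1) a h = 0"
proof -
  obtain C where C: "0 \<le> C"
    "\<And>t z :: real ^ 'n. 1 \<le> t \<Longrightarrow> \<bar>second_diff (heat t) z h\<bar> \<le> C * t powr (\<alpha> / 2 - 1) * weight \<alpha> z"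
    using heat_space_difference_bound[OF \<alpha>(1)] by blast
  define I where "I = (\<integral>x. \<bar>u x * weight \<alpha> (a - x)\<bar> \<partial>lborel)"
  have bound: "\<bar>second_diff (heat_flow u 1) a h\<bar> \<le> C * t powr (\<alpha> / 2 - 1) * I" if t: "1 \<le> t" for t
  proof -
    have t0: "0 < t" using t by simp
    note hi = heat_flow_integrable[OF \<alpha>(1) u t0]
    have [simp]: "a - x + h = a + h - x" "a - x - h = a - h - x" for x by (auto simp: algebra_simps)
    have eq: "u x * second_diff (heat t) (a - x) h = 2 * (u x * heat t (a - x)) - u x * heat t (a + h - x) - u x * heat t (a - h - x)" for x
      unfolding second_diff_def by (simp add: algebra_simps)
    have int: "integrable lborel (\<lambda>x. u x * second_diff (heat t) (a - x) h)"
      unfolding eq by (intro Bochner_Integration.integrable_diff integrable_mult_right hi)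
    have "second_diff (heat_flow u 1) a h = second_diff (heat_flow u t) a h"
      unfolding second_diff_def using heat_flow_constant[OF \<alpha> u zero_less_one t0] by simp
    also have "\<dots> = (\<integral>x. u x * second_diff (heat t) (a - x) h \<partial>lborel)"
      unfolding eq using hi[of a] hi[of "a + h"] hi[of "a - h"]
      by (simp add: second_diff_def heat_flow_def)
    also have "\<bar>\<dots>\<bar> \<le> C * t powr (\<alpha> / 2 - 1) * I"
      unfolding I_def by (rule integral_weighted_bound[OF \<alpha>(1) u C(2)[OF t] int])
    finally show ?thesis by simp
  qed
  have "((\<lambda>t. t powr (\<alpha> / 2 - 1)) \<longlongrightarrow> 0) at_top"
    using \<alpha> by (intro tendsto_neg_powr filterlim_ident) auto
  then have "((\<lambda>t. C * t powr (\<alpha> / 2 - 1) * I) \<longlongrightarrow> C * 0 * I) at_top"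
    by (intro tendsto_intros)
  then have "\<bar>second_diff (heat_flow u 1) a h\<bar> \<le> C * 0 * I"
    by (rule tendsto_lowerbound) (rule eventually_mono[OF eventually_ge_at_top[of 1] bound], auto)
  then show ?thesis by simp
qed

lemma heat_flow_continuous:
  fixes u :: "real ^ 'n \<Rightarrow> real"
  assumes \<alpha>: "0 < \<alpha>" and u: "weakly_harmonic \<alpha> u"
  shows "continuous_on UNIV (heat_flow u 1)"
proof (rule continuous_on_sequentiallyI)
  let ?N = "real CARD('n) + \<alpha>"
  fix b :: "nat \<Rightarrow> real ^ 'n" and a assume b: "b \<longlonglongrightarrow> a"
  have [measurable]: "u \<in> borel_measurable borel" by (rule weakly_harmonic_measurable[OF u])
  obtain C where C: "0 \<le> C" "\<And>\<tau> x :: real ^ 'n. 1 \<le> \<tau> \<Longrightarrow> heat \<tau> x \<le> C * \<tau> powr (\<alpha> / 2) * weight \<alpha> x"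
    using heat_le[OF \<alpha>, of 1, where 'n='n] by auto
  obtain R where R: "\<And>k. norm (b k) \<le> R"
    using convergent_imp_Bseq[OF convergentI[OF b]] by (auto simp: Bseq_def)
  define A where "A = C * (2 powr ?N * (1 + R powr ?N))"
  show "(\<lambda>k. heat_flow u 1 (b k)) \<longlonglongrightarrow> heat_flow u 1 a"
    unfolding heat_flow_def
  proof (rule integral_dominated_convergence[where w="\<lambda>x. A * \<bar>u x * weight \<alpha> x\<bar>"])
    show "integrable lborel (\<lambda>x. A * \<bar>u x * weight \<alpha> x\<bar>)"
      by (intro integrable_mult_right integrable_abs weakly_harmonic_integrable u)
    show "AE x in lborel. (\<lambda>k. u x * heat 1 (b k - x)) \<longlonglongrightarrow> u x * heat 1 (a - x)"
    proof (intro AE_I2 tendsto_intros)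
      fix x
      have "(\<lambda>k. b k - x) \<longlonglongrightarrow> a - x" by (intro tendsto_intros b)
      from continuous_on_tendsto_compose[OF heat_continuous[of 1] this]
      show "(\<lambda>k. heat 1 (b k - x)) \<longlonglongrightarrow> heat 1 (a - x)" by simp
    qed
    show "AE x in lborel. norm (u x * heat 1 (b k - x)) \<le> A * \<bar>u x * weight \<alpha> x\<bar>" for k
    proof (intro AE_I2)
      fix x
      have "heat 1 (b k - x) \<le> C * weight \<alpha> (x - b k)" using C(2)[of 1 "b k - x"] by (simp add: weight_commute)
      also have "\<dots> \<le> C * (2 powr ?N * (1 + norm (b k) powr ?N) * weight \<alpha> (x - b k + b k))"
        by (intro mult_left_mono weight_shift \<alpha> C(1))
      also have "\<dots> \<le> C * (2 powr ?N * (1 + R powr ?N) * weight \<alpha> (x - b k + b k))"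
        using \<alpha> R by (intro mult_left_mono mult_right_mono add_left_mono powr_mono2 C(1)) auto
      finally have "\<bar>u x\<bar> * heat 1 (b k - x) \<le> \<bar>u x\<bar> * (A * weight \<alpha> x)"
        unfolding A_def by (intro mult_left_mono) (auto simp: mult.assoc)
      then show "norm (u x * heat 1 (b k - x)) \<le> A * \<bar>u x * weight \<alpha> x\<bar>" by (simp add: abs_mult mult_ac)
    qed
  qed measurable
qed

section \<open>The heat flow at small times\<close>

lemma heat_mass: "has_bochner_integral lborel (heat 1 :: real ^ 'n \<Rightarrow> real) 1"
proof (rule has_bochner_integral_nn_integral)
  let ?c = "(4 * pi) powr (- (real CARD('n) / 2))"
  have "(\<integral>\<^sup>+x. ennreal (heat 1 x) \<partial>(lborel :: (real^'n) measure)) =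
    (\<integral>\<^sup>+x. ennreal ?c * ennreal (exp (- (1 / 4 * (norm (x :: real^'n))\<^sup>2))) \<partial>lborel)"
    by (intro nn_integral_cong) (simp add: heat_def flip: ennreal_mult')
  also have "\<dots> = ennreal ?c * ennreal ((pi / (1 / 4)) powr (real CARD('n) / 2))"
    by (subst nn_integral_cmult, simp, subst nn_integral_gaussian, simp_all)
  also have "\<dots> = ennreal 1"
    by (simp add: mult.commute powr_minus flip: ennreal_mult')
  finally show "(\<integral>\<^sup>+x. ennreal (heat 1 x) \<partial>(lborel :: (real^'n) measure)) = ennreal 1" .
qed auto

text \<open>The kernel decays faster than the weight with the larger parameter \<open>n + 2 \<alpha>\<close>, whose exponent is
\<open>2 (n + \<alpha>)\<close>.\<close>

lemma heat_moment:
  assumes \<alpha>: "0 < \<alpha>"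
  shows "integrable lborel (\<lambda>y :: real ^ 'n. (1 + norm y powr (real CARD('n) + \<alpha>)) * heat 1 y)"
proof -
  let ?N = "real CARD('n) + \<alpha>"
  obtain C where C: "0 \<le> C" "\<And>\<tau> x :: real ^ 'n. 1 \<le> \<tau> \<Longrightarrow>
    heat \<tau> x \<le> C * \<tau> powr ((real CARD('n) + 2 * \<alpha>) / 2) * weight (real CARD('n) + 2 * \<alpha>) x"
    using heat_le[of "real CARD('n) + 2 * \<alpha>" 1, where 'n='n] \<alpha> by (auto simp: add_pos_pos)
  have "integrable lborel (\<lambda>y :: real ^ 'n. 2 * C * weight \<alpha> y)"
    by (intro integrable_mult_right integrable_weight \<alpha>)
  then show ?thesis
  proof (rule Bochner_Integration.integrable_bound, measurable, intro AE_I2)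
    fix y :: "real ^ 'n"
    define X where "X = norm y powr ?N"
    have X: "0 \<le> X" by (simp add: X_def)
    have "norm y powr (real CARD('n) + (real CARD('n) + 2 * \<alpha>)) = X * X"
      unfolding X_def by (simp flip: powr_add)
    then have w: "weight (real CARD('n) + 2 * \<alpha>) y = 1 / (1 + X * X)" by (simp add: weight_def)
    have "(1 + X) * (1 + X) \<le> 2 * (1 + X * X)"
      using zero_le_power2[of "X - 1"] by (simp add: power2_eq_square algebra_simps)
    then have "(1 + X) * (1 / (1 + X * X)) \<le> 2 * (1 / (1 + X))"
      using X by (simp add: field_simps add_pos_nonneg)
    then have *: "(1 + X) * weight (real CARD('n) + 2 * \<alpha>) y \<le> 2 * weight \<alpha> y"
      by (simp add: w) (simp add: weight_def X_def)
    have "(1 + X) * heat 1 y \<le> (1 + X) * (C * weight (real CARD('n) + 2 * \<alpha>) y)"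
      using C(2)[of 1 y] X by (intro mult_left_mono) auto
    also have "\<dots> = C * ((1 + X) * weight (real CARD('n) + 2 * \<alpha>) y)" by simp
    also have "\<dots> \<le> C * (2 * weight \<alpha> y)" by (intro mult_left_mono * C(1))
    finally show "norm ((1 + norm y powr ?N) * heat 1 y) \<le> norm (2 * C * weight \<alpha> y)"
      using X C(1) unfolding X_def[symmetric] by (simp add: mult_ac)
  qed
qed

lemma heat_average_scale:
  fixes \<psi> :: "real ^ 'n \<Rightarrow> real"
  assumes s: "0 < s" and [measurable]: "\<psi> \<in> borel_measurable borel"
  shows "(\<integral>a. \<psi> a * heat (s\<^sup>2) (a - x) \<partial>lborel) = (\<integral>y. \<psi> (x + s *\<^sub>R y) * heat 1 y \<partial>lborel)"
proof -
  have scale: "s ^ CARD('n) * heat (s\<^sup>2) (s *\<^sub>R y) = heat 1 y" for y :: "real ^ 'n"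
  proof -
    have 1: "(4 * pi * s\<^sup>2) powr (- (real CARD('n) / 2)) = s powr (- real CARD('n)) * (4 * pi) powr (- (real CARD('n) / 2))"
      using s by (simp add: powr_mult powr_square)
    have 2: "s ^ CARD('n) * s powr (- real CARD('n)) = 1"
      using s by (simp add: powr_minus powr_realpow)
    have 3: "(norm (s *\<^sub>R y))\<^sup>2 / (4 * s\<^sup>2) = (norm y)\<^sup>2 / 4"
      using s by (simp add: power_mult_distrib)
    have "s ^ CARD('n) * heat (s\<^sup>2) (s *\<^sub>R y) =
      (s ^ CARD('n) * s powr (- real CARD('n))) * ((4 * pi) powr (- (real CARD('n) / 2)) * exp (- ((norm y)\<^sup>2 / 4)))"
      unfolding heat_def 1 3 by (simp only: mult.assoc)
    also have "\<dots> = heat 1 y" unfolding 2 by (simp add: heat_def)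
    finally show ?thesis .
  qed
  have "(\<integral>a. \<psi> a * heat (s\<^sup>2) (a - x) \<partial>lborel) =
    (\<integral>a. \<psi> a * heat (s\<^sup>2) (a - x) \<partial>density (distr lborel borel (\<lambda>y. x + s *\<^sub>R y)) (\<lambda>_. ennreal (\<bar>s\<bar> ^ DIM(real ^ 'n))))"
    using s by (subst lborel_affine[of s x]) (auto simp: ennreal_power)
  also have "\<dots> = (\<integral>a. \<bar>s\<bar> ^ DIM(real ^ 'n) *\<^sub>R (\<psi> a * heat (s\<^sup>2) (a - x)) \<partial>distr lborel borel (\<lambda>y. x + s *\<^sub>R y))"
    by (rule integral_density) auto
  also have "\<dots> = (\<integral>y. \<bar>s\<bar> ^ DIM(real ^ 'n) *\<^sub>R (\<psi> (x + s *\<^sub>R y) * heat (s\<^sup>2) (x + s *\<^sub>R y - x)) \<partial>lborel)"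
    by (rule integral_distr) auto
  also have "\<dots> = (\<integral>y. \<psi> (x + s *\<^sub>R y) * heat 1 y \<partial>lborel)"
    using s by (intro Bochner_Integration.integral_cong refl) (simp add: scale[symmetric])
  finally show ?thesis .
qed

lemma weakly_harmonic_box_integrable:
  fixes u :: "real ^ 'n \<Rightarrow> real"
  assumes \<alpha>: "0 < \<alpha>" and u: "weakly_harmonic \<alpha> u"
  obtains C where "0 \<le> C" "\<And>x. indicator (box l r) x \<le> C * weight \<alpha> (x :: real ^ 'n)"
    "integrable lborel (\<lambda>x. indicator (box l r) x * u x)"
proof -
  let ?N = "real CARD('n) + \<alpha>"
  have [measurable]: "u \<in> borel_measurable borel" by (rule weakly_harmonic_measurable[OF u])
  obtain R where R: "\<And>x. x \<in> box l r \<Longrightarrow> norm x \<le> R"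
    using bounded_box[of l r] by (auto simp: bounded_iff)
  define C where "C = 1 + \<bar>R\<bar> powr ?N"
  have C: "0 \<le> C" by (simp add: C_def)
  have le: "indicator (box l r) x \<le> C * weight \<alpha> x" for x :: "real ^ 'n"
  proof (cases "x \<in> box l r")
    case True
    have "norm x powr ?N \<le> \<bar>R\<bar> powr ?N" using R[OF True] \<alpha> by (intro powr_mono2) auto
    then show ?thesis using True by (simp add: weight_def C_def field_simps add_pos_nonneg)
  qed (use C in simp)
  have "integrable lborel (\<lambda>x. C * \<bar>u x * weight \<alpha> x\<bar>)"
    by (intro integrable_mult_right integrable_abs weakly_harmonic_integrable u)
  then have "integrable lborel (\<lambda>x. indicator (box l r) x * u x)"
  proof (rule Bochner_Integration.integrable_bound, measurable, intro AE_I2)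
    fix x :: "real ^ 'n"
    have "indicator (box l r) x * \<bar>u x\<bar> \<le> (C * weight \<alpha> x) * \<bar>u x\<bar>" by (intro mult_right_mono le) auto
    then show "norm (indicator (box l r) x * u x) \<le> norm (C * \<bar>u x * weight \<alpha> x\<bar>)"
      using C by (simp add: abs_mult mult_ac)
  qed
  with C le show thesis by (rule that)
qed

text \<open>By Fubini's theorem the flow at time \<open>s\<^sup>2\<close>, integrated over the box, is the pairing of \<open>u\<close> with the heat
average \<open>S\<close> of the indicator function. As \<open>s\<close> tends to zero, \<open>S\<close> converges to the indicator function off
the boundary of the box, dominated by the weight. The left-hand side does not change, as the flow is
constant in time.\<close>

lemma heat_flow_box:
  fixes u :: "real ^ 'n \<Rightarrow> real"
  assumes \<alpha>: "0 < \<alpha>" "\<alpha> < 2" and u: "weakly_harmonic \<alpha> u"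
  shows "(\<integral>a. indicator (box l r) a * heat_flow u 1 a \<partial>lborel) = (\<integral>x. indicator (box l r) x * u x \<partial>lborel)"
proof -
  let ?N = "real CARD('n) + \<alpha>"
  let ?\<psi> = "indicator (box l r) :: real ^ 'n \<Rightarrow> real"
  have [measurable]: "u \<in> borel_measurable borel" by (rule weakly_harmonic_measurable[OF u])
  obtain C where C: "0 \<le> C" "\<And>x. ?\<psi> x \<le> C * weight \<alpha> x"
    using weakly_harmonic_box_integrable[OF \<alpha>(1) u] by blast
  define M where "M = (\<integral>y. (1 + norm y powr ?N) * heat 1 y \<partial>(lborel :: (real ^ 'n) measure))"
  \<comment> \<open>The heat average of the indicator function at time \<open>s\<^sup>2\<close>; in this form the limit \<open>s \<rightarrow> 0\<close> is visible.\<close>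
  define S where "S s x = (\<integral>y. ?\<psi> (x + s *\<^sub>R y) * heat 1 y \<partial>lborel)" for s x
  have [measurable]: "S s \<in> borel_measurable borel" for s unfolding S_def[abs_def] by measurable
  have S0: "0 \<le> S s x" for s x unfolding S_def by (intro integral_nonneg_AE AE_I2) auto
  note h1 = heat_mass[where 'n='n, unfolded has_bochner_integral_iff]
  have psi_int: "integrable lborel (\<lambda>y. ?\<psi> (x + s *\<^sub>R y) * heat 1 y)" for x s
    by (rule Bochner_Integration.integrable_bound[OF conjunct1[OF h1]])
       (auto intro!: AE_I2 simp: indicator_def)
  have "0 \<le> M" unfolding M_def by (intro integral_nonneg_AE AE_I2) auto
  define B where "B = C * 2 powr ?N * M"
  have B: "0 \<le> B" using C(1) \<open>0 \<le> M\<close> by (simp add: B_def)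
  have S_le: "S s x \<le> B * weight \<alpha> x" if s: "0 < s" "s \<le> 1" for s x
  proof -
    have "S s x \<le> (\<integral>y. C * 2 powr ?N * weight \<alpha> x * ((1 + norm y powr ?N) * heat 1 y) \<partial>(lborel :: (real ^ 'n) measure))"
      unfolding S_def
    proof (rule integral_mono)
      show "integrable lborel (\<lambda>y. ?\<psi> (x + s *\<^sub>R y) * heat 1 y)" by (rule psi_int)
      show "integrable lborel (\<lambda>y :: real ^ 'n. C * 2 powr ?N * weight \<alpha> x * ((1 + norm y powr ?N) * heat 1 y))"
        by (intro integrable_mult_right heat_moment \<alpha>)
      fix y :: "real ^ 'n"
      have "?\<psi> (x + s *\<^sub>R y) \<le> C * weight \<alpha> (x + s *\<^sub>R y)" by (rule C(2))
      also have "\<dots> \<le> C * (2 powr ?N * (1 + norm (- (s *\<^sub>R y)) powr ?N) * weight \<alpha> (x + s *\<^sub>R y + - (s *\<^sub>R y)))"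
        by (intro mult_left_mono weight_shift \<alpha> C(1))
      also have "\<dots> \<le> C * (2 powr ?N * (1 + norm y powr ?N) * weight \<alpha> (x + s *\<^sub>R y + - (s *\<^sub>R y)))"
        using s \<alpha> by (intro mult_left_mono mult_right_mono add_left_mono powr_mono2 C(1)) (auto simp: mult_left_le_one_le)
      also have "\<dots> = C * (2 powr ?N * (1 + norm y powr ?N) * weight \<alpha> x)" by simp
      finally have "?\<psi> (x + s *\<^sub>R y) * heat 1 y \<le> C * (2 powr ?N * (1 + norm y powr ?N) * weight \<alpha> x) * heat 1 y"
        by (rule mult_right_mono) simp
      then show "?\<psi> (x + s *\<^sub>R y) * heat 1 y \<le> C * 2 powr ?N * weight \<alpha> x * ((1 + norm y powr ?N) * heat 1 y)"
        by (simp only: mult_ac)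
    qed
    also have "\<dots> = B * weight \<alpha> x" unfolding integral_mult_right_zero by (simp add: B_def M_def)
    finally show ?thesis .
  qed
  have flow: "(\<integral>x. u x * S s x \<partial>lborel) = (\<integral>a. ?\<psi> a * heat_flow u 1 a \<partial>lborel)" if s: "0 < s" "s \<le> 1" for s
  proof -
    let ?k = "\<lambda>x a. u x * (?\<psi> a * heat (s\<^sup>2) (a - x))"
    have S_eq: "S s x = (\<integral>a. ?\<psi> a * heat (s\<^sup>2) (a - x) \<partial>lborel)" for x
      unfolding S_def by (rule heat_average_scale[symmetric, OF s(1)]) measurable
    have "0 < s\<^sup>2" using s by simp
    then obtain K where K: "0 \<le> K" "\<And>\<tau> x :: real ^ 'n. s\<^sup>2 \<le> \<tau> \<Longrightarrow> heat \<tau> x \<le> K * \<tau> powr (\<alpha> / 2) * weight \<alpha> x"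
      using heat_le[OF \<alpha>(1), where 'n='n] by blast
    have bd: "heat (s\<^sup>2) z \<le> K * (s\<^sup>2) powr (\<alpha> / 2)" for z :: "real ^ 'n"
      using K(2)[of "s\<^sup>2" z] mult_left_mono[OF weight_le_1[of \<alpha> z], of "K * (s\<^sup>2) powr (\<alpha> / 2)"] K(1) by simp
    have ki: "integrable lborel (\<lambda>a. ?\<psi> a * heat (s\<^sup>2) (a - x))" for x
    proof (rule Bochner_Integration.integrable_bound)
      show "integrable lborel (\<lambda>a. ?\<psi> a * (K * (s\<^sup>2) powr (\<alpha> / 2)))"
        by (intro integrable_mult_left integrable_real_indicator emeasure_lborel_box_finite) auto
      show "AE a in lborel. norm (?\<psi> a * heat (s\<^sup>2) (a - x)) \<le> norm (?\<psi> a * (K * (s\<^sup>2) powr (\<alpha> / 2)))"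
        using bd K(1) by (intro AE_I2) (auto simp: indicator_def)
    qed measurable
    have "(\<integral>x. u x * S s x \<partial>lborel) = (\<integral>x. (\<integral>a. ?k x a \<partial>lborel) \<partial>lborel)"
      by (simp only: S_eq integral_mult_right_zero)
    also have "\<dots> = (\<integral>a. (\<integral>x. ?k x a \<partial>lborel) \<partial>lborel)"
    proof (rule lborel_swap_integrals)
      show "(\<lambda>(x, a). ?k x a) \<in> borel_measurable (borel \<Otimes>\<^sub>M borel)"
        unfolding heat_def by measurable
      show "integrable lborel (?k x)" for x by (intro integrable_mult_right ki)
      show "integrable lborel (\<lambda>x. B * \<bar>u x * weight \<alpha> x\<bar>)"
        by (intro integrable_mult_right integrable_abs weakly_harmonic_integrable u)
      fix x
      have "norm (?k x a) = \<bar>u x\<bar> * (?\<psi> a * heat (s\<^sup>2) (a - x))" for a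
        by (simp add: abs_mult)
      then have "(\<integral>a. norm (?k x a) \<partial>lborel) = \<bar>u x\<bar> * S s x"
        by (simp only: integral_mult_right_zero S_eq)
      also have "\<dots> \<le> \<bar>u x\<bar> * (B * weight \<alpha> x)" by (intro mult_left_mono S_le s) auto
      finally show "(\<integral>a. norm (?k x a) \<partial>lborel) \<le> B * \<bar>u x * weight \<alpha> x\<bar>"
        by (simp add: abs_mult mult_ac)
    qed
    also have "\<dots> = (\<integral>a. ?\<psi> a * heat_flow u 1 a \<partial>lborel)"
    proof (intro Bochner_Integration.integral_cong refl)
      fix a
      have "?k x a = ?\<psi> a * (u x * heat (s\<^sup>2) (a - x))" for x by simp
      then have "(\<integral>x. ?k x a \<partial>lborel) = ?\<psi> a * heat_flow u (s\<^sup>2) a"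
        unfolding heat_flow_def by (simp only: integral_mult_right_zero)
      then show "(\<integral>x. ?k x a \<partial>lborel) = ?\<psi> a * heat_flow u 1 a"
        using heat_flow_constant[OF \<alpha> u, of 1 "s\<^sup>2"] s by simp
    qed
    finally show ?thesis .
  qed
  define e where "e k = 1 / real (Suc k)" for k
  have e: "0 < e k" "e k \<le> 1" for k by (auto simp: e_def)
  have e0: "e \<longlonglongrightarrow> 0" unfolding e_def by (rule LIMSEQ_Suc[OF lim_1_over_n])
  have "(\<lambda>k. \<integral>x. u x * S (e k) x \<partial>lborel) \<longlonglongrightarrow> (\<integral>x. u x * ?\<psi> x \<partial>lborel)"
  proof (rule integral_dominated_convergence[where w="\<lambda>x. B * \<bar>u x * weight \<alpha> x\<bar>"])
    show "integrable lborel (\<lambda>x. B * \<bar>u x * weight \<alpha> x\<bar>)"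
      by (intro integrable_mult_right integrable_abs weakly_harmonic_integrable u)
    show "AE x in lborel. norm (u x * S (e k) x) \<le> B * \<bar>u x * weight \<alpha> x\<bar>" for k
    proof (intro AE_I2)
      fix x
      have "\<bar>u x\<bar> * S (e k) x \<le> \<bar>u x\<bar> * (B * weight \<alpha> x)" by (intro mult_left_mono S_le e) auto
      then show "norm (u x * S (e k) x) \<le> B * \<bar>u x * weight \<alpha> x\<bar>"
        using S0[of "e k" x] by (simp add: abs_mult mult_ac)
    qed
    have ae: "AE x in lborel. x \<notin> cbox l r - box l r"
      by (rule AE_not_in) (rule null_sets_cbox_Diff_box)
    show "AE x in lborel. (\<lambda>k. u x * S (e k) x) \<longlonglongrightarrow> u x * ?\<psi> x"
      using ae
    proof eventually_elim
      case (elim x)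
      have ev: "eventually (\<lambda>k. ?\<psi> (x + e k *\<^sub>R y) = ?\<psi> x) sequentially" for y
      proof -
        have lim: "(\<lambda>k. x + e k *\<^sub>R y) \<longlonglongrightarrow> x + 0 *\<^sub>R y" by (intro tendsto_intros e0)
        show ?thesis
        proof (cases "x \<in> box l r")
          case True
          have "eventually (\<lambda>k. x + e k *\<^sub>R y \<in> box l r) sequentially"
            using topological_tendstoD[OF lim open_box, of l r] True by simp
          then show ?thesis by (rule eventually_mono) (use True in simp)
        next
          case False
          then have "x \<in> - cbox l r" using elim by auto
          then have "eventually (\<lambda>k. x + e k *\<^sub>R y \<in> - cbox l r) sequentially"
            using topological_tendstoD[OF lim, of "- cbox l r"] by (simp add: open_Compl closed_cbox)
          then show ?thesis
          proof (rule eventually_mono)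
            fix k assume "x + e k *\<^sub>R y \<in> - cbox l r"
            then have "x + e k *\<^sub>R y \<notin> box l r" using box_subset_cbox[of l r] by blast
            then show "?\<psi> (x + e k *\<^sub>R y) = ?\<psi> x" using False by simp
          qed
        qed
      qed
      have "(\<lambda>k. S (e k) x) \<longlonglongrightarrow> (\<integral>y. ?\<psi> x * heat 1 y \<partial>(lborel :: (real ^ 'n) measure))"
        unfolding S_def
      proof (rule integral_dominated_convergence[where w="heat 1"])
        show "integrable lborel (heat 1 :: real ^ 'n \<Rightarrow> real)" using h1 by simp
        show "AE y in lborel. (\<lambda>k. ?\<psi> (x + e k *\<^sub>R y) * heat 1 y) \<longlonglongrightarrow> ?\<psi> x * heat 1 y"
          by (intro AE_I2 tendsto_intros tendsto_eventually ev)
        show "AE y in lborel. norm (?\<psi> (x + e k *\<^sub>R y) * heat 1 y) \<le> heat 1 y" for k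
          by (intro AE_I2) (auto simp: indicator_def)
      qed measurable
      also have "(\<integral>y. ?\<psi> x * heat 1 y \<partial>(lborel :: (real ^ 'n) measure)) = ?\<psi> x" using h1 by simp
      finally show ?case by (intro tendsto_intros)
    qed
  qed measurable
  then have "(\<lambda>k. \<integral>a. ?\<psi> a * heat_flow u 1 a \<partial>lborel) \<longlonglongrightarrow> (\<integral>x. u x * ?\<psi> x \<partial>lborel)"
    using flow[OF e] by simp
  from LIMSEQ_unique[OF tendsto_const this] show ?thesis by (simp add: mult.commute)
qed

text \<open>The positive and the negative part of \<open>f\<close> are densities of two measures that agree on boxes, hence on
all Borel sets.\<close>

lemma AE_eq_if_box_integrals_eq:
  fixes f :: "'a::euclidean_space \<Rightarrow> real"
  assumes f [measurable]: "f \<in> borel_measurable borel"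
    and int: "\<And>l r. integrable lborel (\<lambda>x. indicator (box l r) x * f x)"
    and zero: "\<And>l r. (\<integral>x. indicator (box l r) x * f x \<partial>lborel) = 0"
  shows "AE x in lborel. f x = 0"
proof -
  let ?p = "\<lambda>x. ennreal (f x)" and ?m = "\<lambda>x. ennreal (- f x)"
  have pm: "(\<integral>\<^sup>+x. ?p x * indicator (box l r) x \<partial>lborel) = (\<integral>\<^sup>+x. ?m x * indicator (box l r) x \<partial>lborel)"
    and fin: "(\<integral>\<^sup>+x. ?p x * indicator (box l r) x \<partial>lborel) \<noteq> \<infinity>" for l r
  proof -
    let ?g = "\<lambda>x. indicator (box l r) x * f x"
    have p: "(\<integral>\<^sup>+x. ?p x * indicator (box l r) x \<partial>lborel) = (\<integral>\<^sup>+x. ennreal (?g x) \<partial>lborel)"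
      by (intro nn_integral_cong) (auto simp: indicator_def)
    have m: "(\<integral>\<^sup>+x. ?m x * indicator (box l r) x \<partial>lborel) = (\<integral>\<^sup>+x. ennreal (- ?g x) \<partial>lborel)"
      by (intro nn_integral_cong) (auto simp: indicator_def)
    have fp: "(\<integral>\<^sup>+x. ennreal (?g x) \<partial>lborel) \<noteq> \<infinity>" and fm: "(\<integral>\<^sup>+x. ennreal (- ?g x) \<partial>lborel) \<noteq> \<infinity>"
      using int[of l r] by (auto simp: real_integrable_def)
    have "enn2real (\<integral>\<^sup>+x. ennreal (?g x) \<partial>lborel) - enn2real (\<integral>\<^sup>+x. ennreal (- ?g x) \<partial>lborel) = 0"
      using zero[of l r] real_lebesgue_integral_def[OF int[of l r]] by simp
    then have eq: "enn2real (\<integral>\<^sup>+x. ennreal (?g x) \<partial>lborel) = enn2real (\<integral>\<^sup>+x. ennreal (- ?g x) \<partial>lborel)"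
      by simp
    have "a = b" if "a \<noteq> \<infinity>" "b \<noteq> \<infinity>" "enn2real a = enn2real b" for a b :: ennreal
      using that by (cases a; cases b) auto
    from this[OF fp fm eq] show "(\<integral>\<^sup>+x. ?p x * indicator (box l r) x \<partial>lborel) = (\<integral>\<^sup>+x. ?m x * indicator (box l r) x \<partial>lborel)"
      using p m by simp
    show "(\<integral>\<^sup>+x. ?p x * indicator (box l r) x \<partial>lborel) \<noteq> \<infinity>" using p fp by simp
  qed
  have "density lborel ?p = density lborel ?m"
  proof (rule measure_eqI_generator_eq)
    let ?E = "range (\<lambda>(a, b). box a b::'a set)"
    show "Int_stable ?E" by (auto simp: Int_stable_def box_Int_box)
    show "?E \<subseteq> Pow UNIV" "sets (density lborel ?p) = sigma_sets UNIV ?E" "sets (density lborel ?m) = sigma_sets UNIV ?E"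
      by (simp_all add: borel_eq_box)
    let ?A = "\<lambda>n::nat. box (- (real n *\<^sub>R One)) (real n *\<^sub>R One) :: 'a set"
    show "range ?A \<subseteq> ?E" "(\<Union>i. ?A i) = UNIV"
      unfolding UN_box_eq_UNIV by auto
    show "emeasure (density lborel ?p) (?A i) \<noteq> \<infinity>" for i
      using fin by (simp add: emeasure_density)
    show "emeasure (density lborel ?p) X = emeasure (density lborel ?m) X" if "X \<in> ?E" for X
      using that pm by (auto simp: emeasure_density)
  qed
  then have "AE x in lborel. ?p x = ?m x"
    by (intro sigma_finite_measure.density_unique[OF sigma_finite_lborel]) auto
  then show ?thesis
  proof eventually_elim
    case (elim x)
    then show ?case by (cases "0 \<le> f x") (auto simp: ennreal_neg ennreal_eq_0_iff)
  qed
qed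

lemma weakly_harmonic_eq_heat_flow:
  fixes u :: "real ^ 'n \<Rightarrow> real"
  assumes \<alpha>: "0 < \<alpha>" "\<alpha> < 2" and u: "weakly_harmonic \<alpha> u"
  shows "AE x in lborel. u x = heat_flow u 1 x"
proof -
  have [measurable]: "u \<in> borel_measurable borel" by (rule weakly_harmonic_measurable[OF u])
  have c: "continuous_on UNIV (heat_flow u 1)" by (rule heat_flow_continuous[OF \<alpha>(1) u])
  have [measurable]: "heat_flow u 1 \<in> borel_measurable borel" by (rule borel_measurable_continuous_onI[OF c])
  have ui: "integrable lborel (\<lambda>x. indicator (box l r) x * u x)" for l r
    using weakly_harmonic_box_integrable[OF \<alpha>(1) u, of l r] by blast
  have Ai: "integrable lborel (\<lambda>x. indicator (box l r) x * heat_flow u 1 x)" for l r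
  proof -
    have "integrable lborel (\<lambda>x. indicator (cbox l r) x *\<^sub>R heat_flow u 1 x)"
      by (rule borel_integrable_compact) (auto intro: continuous_on_subset[OF c])
    then show ?thesis
      by (rule Bochner_Integration.integrable_bound) (auto intro!: AE_I2 simp: indicator_def dest: box_subset_cbox[THEN subsetD])
  qed
  have "AE x in lborel. u x - heat_flow u 1 x = 0"
  proof (rule AE_eq_if_box_integrals_eq)
    show "integrable lborel (\<lambda>x. indicator (box l r) x * (u x - heat_flow u 1 x))" for l r
      unfolding right_diff_distrib by (intro Bochner_Integration.integrable_diff ui Ai)
    show "(\<integral>x. indicator (box l r) x * (u x - heat_flow u 1 x) \<partial>lborel) = 0" for l r
      unfolding right_diff_distrib using ui Ai heat_flow_box[OF \<alpha> u, of l r] by simp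
  qed measurable
  then show ?thesis by eventually_elim simp
qed

section \<open>The Liouville theorem\<close>

text \<open>Translated bumps are test functions on which the fractional Laplacian is \<open>sym_lap\<close> up to
the constant, which may be cancelled by \<open>frac_const_pos\<close>.\<close>

lemma alpha_harmonic_weakly_harmonic:
  fixes u :: "real ^ 'n \<Rightarrow> real"
  assumes \<alpha>: "0 < \<alpha>" "\<alpha> < 2" and u: "alpha_harmonic \<alpha> u"
  obtains v where "weakly_harmonic \<alpha> v" "AE x in lebesgue. u x = v x"
proof -
  have um: "u \<in> borel_measurable lebesgue"
    and ui: "integrable lebesgue (\<lambda>x. \<bar>u x\<bar> / (1 + norm x powr (real CARD('n) + \<alpha>)))"
    and uh: "\<And>\<phi>. \<phi> \<in> test_functions \<Longrightarrow> (LINT x|lebesgue. u x * frac_laplacian \<alpha> \<phi> x) = 0"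
    using u by (auto simp: alpha_harmonic_def L_space_def)
  obtain v where v: "v \<in> borel_measurable lborel" "AE x in lborel. u x = v x"
    using completion_ex_borel_measurable_real[OF um] by blast
  have [measurable]: "v \<in> borel_measurable borel" using v(1) by simp
  have ae: "AE x in lebesgue. u x = v x" by (rule AE_completion[OF v(2)])
  have vi: "integrable lborel (\<lambda>x. v x * weight \<alpha> x)"
  proof -
    have "integrable lebesgue (\<lambda>x. \<bar>v x\<bar> * weight \<alpha> x)"
    proof (rule integrable_cong_AE_imp[OF ui])
      show "(\<lambda>x. \<bar>v x\<bar> * weight \<alpha> x) \<in> borel_measurable lebesgue"
        by (rule measurable_completion) measurable
      show "AE x in lebesgue. \<bar>u x\<bar> / (1 + norm x powr (real CARD('n) + \<alpha>)) = \<bar>v x\<bar> * weight \<alpha> x"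
        using ae by eventually_elim (simp add: weight_def)
    qed
    then have "integrable lborel (\<lambda>x. \<bar>v x\<bar> * weight \<alpha> x)"
      by (subst (asm) integrable_completion) measurable
    then show ?thesis
      by (rule Bochner_Integration.integrable_bound) (auto intro!: AE_I2 simp: abs_mult)
  qed
  have "(\<integral>x. v x * sym_lap \<alpha> (bump e) (b - x) \<partial>lborel) = 0" if e: "0 < e" for b :: "real ^ 'n" and e
  proof -
    define \<phi> where "\<phi> x = bump e (b - x)" for x
    have \<phi>: "\<phi> \<in> bumps b e" unfolding \<phi>_def[abs_def] by (rule bump_translate)
    obtain C where C: "tame \<alpha> C \<phi>" using schwartz_imp_tame[OF \<alpha>(1) bumps_schwartz[OF \<phi> e]] .
    have translate: "sym_lap \<alpha> \<phi> x = sym_lap \<alpha> (bump e) (b - x)" for x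
    proof -
      have "second_diff \<phi> x y = second_diff (bump e) (b - x) y" for y
        by (simp add: second_diff_def \<phi>_def algebra_simps)
      then show ?thesis by (simp add: sym_lap_def)
    qed
    let ?c = "frac_const TYPE('n) \<alpha>"
    have "0 = (LINT x|lebesgue. u x * frac_laplacian \<alpha> \<phi> x)"
      using uh[OF bumps_test_function[OF \<phi> e]] by simp
    also have "\<dots> = (LINT x|lebesgue. ?c * (v x * sym_lap \<alpha> (bump e) (b - x)))"
    proof (rule integral_cong_AE)
      have fm: "(\<lambda>x. sym_lap \<alpha> (bump e) (b - x)) \<in> borel_measurable borel" by measurable
      have eq: "frac_laplacian \<alpha> \<phi> x = ?c * sym_lap \<alpha> (bump e) (b - x)" for x
        by (simp add: frac_laplacian_def pv_integral_eq_sym_lap[OF \<alpha> C] translate)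
      have cm: "(\<lambda>x. ?c * sym_lap \<alpha> (bump e) (b - x)) \<in> borel_measurable lebesgue"
        by (rule measurable_completion) measurable
      show "(\<lambda>x. u x * frac_laplacian \<alpha> \<phi> x) \<in> borel_measurable lebesgue"
        unfolding eq by (rule borel_measurable_times[OF um cm])
      show "(\<lambda>x. ?c * (v x * sym_lap \<alpha> (bump e) (b - x))) \<in> borel_measurable lebesgue"
        by (rule measurable_completion) measurable
      show "AE x in lebesgue. u x * frac_laplacian \<alpha> \<phi> x = ?c * (v x * sym_lap \<alpha> (bump e) (b - x))"
        using ae by eventually_elim (simp add: eq)
    qed
    also have "\<dots> = (\<integral>x. ?c * (v x * sym_lap \<alpha> (bump e) (b - x)) \<partial>lborel)"
      by (rule integral_completion) measurable
    also have "\<dots> = ?c * (\<integral>x. v x * sym_lap \<alpha> (bump e) (b - x) \<partial>lborel)"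
      by (rule integral_mult_right_zero)
    finally show ?thesis using frac_const_pos[OF \<alpha>, where 'n='n] by simp
  qed
  with vi have "weakly_harmonic \<alpha> v" by (simp add: weakly_harmonic_def)
  with ae show thesis using that by blast
qed

text \<open>The values on the multiples of \<open>v\<close> satisfy the recursion of an arithmetic progression.\<close>

lemma second_diff_zero_multiples:
  fixes A :: "real ^ 'n \<Rightarrow> real"
  assumes "\<And>a h. second_diff A a h = 0"
  shows "A (real k *\<^sub>R v) = A 0 + real k * (A v - A 0)"
proof -
  have "A (real k *\<^sub>R v) = A 0 + real k * (A v - A 0) \<and> A (real (Suc k) *\<^sub>R v) = A 0 + real (Suc k) * (A v - A 0)"
  proof (induction k)
    case (Suc k)
    have "2 * A (real (Suc k) *\<^sub>R v) - A (real (Suc k) *\<^sub>R v + v) - A (real (Suc k) *\<^sub>R v - v) = 0"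
      using assms[of "real (Suc k) *\<^sub>R v" v] by (simp add: second_diff_def)
    moreover have "real (Suc k) *\<^sub>R v + v = real (Suc (Suc k)) *\<^sub>R v" "real (Suc k) *\<^sub>R v - v = real k *\<^sub>R v"
      by (simp_all only: of_nat_Suc scaleR_left_distrib scaleR_one) (simp_all add: ac_simps)
    ultimately show ?case using Suc by (simp add: algebra_simps)
  qed simp
  then show ?thesis by simp
qed

text \<open>The bound holds pointwise since it fails on an open set, which would have positive measure if it were nonempty. On the ray
through \<open>v\<close> the function is \<open>A 0 + k (A v - A 0)\<close>, and dividing the bound by \<open>k\<close> shows that
\<open>A v \<ge> A 0\<close>; the same for \<open>- v\<close> gives the reverse inequality.\<close>

lemma affine_sublinear_below_constant:
  fixes A :: "real ^ 'n \<Rightarrow> real"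
  assumes c: "continuous_on UNIV A" and A: "\<And>a h. second_diff A a h = 0" and \<gamma>: "\<gamma> \<le> 1"
    and below: "\<And>\<epsilon>. 0 < \<epsilon> \<Longrightarrow> \<exists>R>0. AE x in lebesgue. R < norm x \<longrightarrow> - \<epsilon> * norm x powr \<gamma> \<le> A x"
  shows "A v = A 0"
proof -
  have ge: "A 0 \<le> A v" for v
  proof (cases "v = 0")
    case False
    have key: "- (\<epsilon> * norm v) \<le> A v - A 0" if \<epsilon>: "0 < \<epsilon>" for \<epsilon>
    proof -
      obtain R where R: "0 < R" "AE x in lebesgue. R < norm x \<longrightarrow> - \<epsilon> * norm x powr \<gamma> \<le> A x"
        using below[OF \<epsilon>] by blast
      have pw: "- \<epsilon> * norm x powr \<gamma> \<le> A x" if x: "R < norm x" for x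
      proof -
        let ?S = "{x :: real ^ 'n. R < norm x}" and ?D = "{x. R < norm x \<and> A x < - \<epsilon> * norm x powr \<gamma>}"
        have S: "open ?S" by (intro open_Collect_less continuous_intros)
        have "continuous_on ?S (\<lambda>x. - \<epsilon> * norm x powr \<gamma> - A x)"
          using R(1) by (intro continuous_intros continuous_on_subset[OF c]) auto
        then have "open (?S \<inter> (\<lambda>x. - \<epsilon> * norm x powr \<gamma> - A x) -` {0<..})"
          using S by (intro continuous_open_preimage) auto
        also have "?S \<inter> (\<lambda>x. - \<epsilon> * norm x powr \<gamma> - A x) -` {0<..} = ?D" by auto
        finally have "open ?D" .
        moreover have "negligible ?D"
          unfolding negligible_iff_null_sets
        proof (rule AE_iff_null_sets[THEN iffD2])
          show "?D \<in> sets lebesgue" using \<open>open ?D\<close> by (intro sets_completionI_sets) (simp only: sets_lborel borel_open)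
          show "AE x in lebesgue. x \<notin> ?D" using R(2) by (rule eventually_mono) (auto simp: not_less)
        qed
        ultimately have "?D = {}" using open_not_negligible by blast
        then have "x \<notin> ?D" by (simp only: empty_iff not_False_eq_True)
        then show ?thesis using x by simp
      qed
      obtain K :: nat where K: "max 1 R / norm v < K" using reals_Archimedean2 by blast
      have bound: "- (\<epsilon> * norm v) \<le> A 0 / real k + (A v - A 0)" if k: "K \<le> k" for k
      proof -
        have kv: "max 1 R < real k * norm v"
        proof -
          have "max 1 R < real K * norm v" using K False by (simp add: field_simps)
          also have "\<dots> \<le> real k * norm v" using k by (intro mult_right_mono) auto
          finally show ?thesis .
        qed
        then have k0: "0 < real k" using False by (cases "k = 0") auto
        have "(real k * norm v) powr \<gamma> \<le> (real k * norm v) powr 1"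
          using kv \<gamma> by (intro powr_mono) auto
        then have "\<epsilon> * (real k * norm v) powr \<gamma> \<le> \<epsilon> * (real k * norm v)"
          using \<epsilon> kv by (intro mult_left_mono) auto
        moreover have "- \<epsilon> * norm (real k *\<^sub>R v) powr \<gamma> \<le> A (real k *\<^sub>R v)"
          using kv by (intro pw) auto
        ultimately have "- (\<epsilon> * (real k * norm v)) \<le> A 0 + real k * (A v - A 0)"
          unfolding second_diff_zero_multiples[OF A] by simp
        then have "real k * (- (\<epsilon> * norm v)) \<le> real k * (A 0 / real k + (A v - A 0))"
          using k0 by (simp add: algebra_simps)
        then show ?thesis using k0 by (simp only: mult_le_cancel_left_pos)
      qed
      have "(\<lambda>k. A 0 / real k + (A v - A 0)) \<longlonglongrightarrow> 0 + (A v - A 0)"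
        by (intro tendsto_intros lim_const_over_n)
      then have "- (\<epsilon> * norm v) \<le> 0 + (A v - A 0)"
        by (rule LIMSEQ_le_const) (use bound in blast)
      then show ?thesis by simp
    qed
    show ?thesis
    proof (rule field_le_epsilon)
      fix \<delta> :: real assume "0 < \<delta>"
      then have "- (\<delta> / norm v * norm v) \<le> A v - A 0" using False by (intro key) simp
      then show "A 0 \<le> A v + \<delta>" using False by simp
    qed
  qed simp
  have "A v - A 0 = - (A (- v) - A 0)" using A[of 0 v] by (simp add: second_diff_def)
  then show ?thesis using ge[of v] ge[of "- v"] by linarith
qed

lemma ess_liminf_lower_bound:
  fixes u :: "real ^ 'n \<Rightarrow> real"
  assumes "0 \<le> ess_liminf_at_infinity (\<lambda>x. u x / norm x powr \<gamma>)" and \<epsilon>: "0 < \<epsilon>"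
  obtains R where "0 < R" "AE x in lebesgue. R < norm x \<longrightarrow> - \<epsilon> * norm x powr \<gamma> \<le> u x"
proof -
  have "eventually (\<lambda>x. ereal (- \<epsilon>) < ereal (u x / norm x powr \<gamma>)) (inf at_infinity (ae_filter lebesgue))"
  proof -
    have "\<forall>y<0. eventually (\<lambda>x. y < ereal (u x / norm x powr \<gamma>)) (inf at_infinity (ae_filter lebesgue))"
      using assms(1) unfolding ess_liminf_at_infinity_def le_Liminf_iff .
    then show ?thesis using \<epsilon> by (elim allE[of _ "ereal (- \<epsilon>)"]) simp
  qed
  then obtain P Q where P: "eventually P at_infinity" and Q: "eventually Q (ae_filter lebesgue)"
    and PQ: "\<And>x. P x \<Longrightarrow> Q x \<Longrightarrow> - \<epsilon> < u x / norm x powr \<gamma>"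
    unfolding eventually_inf by auto
  obtain R0 where R0: "\<And>x. R0 \<le> norm x \<Longrightarrow> P x"
    using P by (auto simp: eventually_at_infinity)
  define R where "R = max 1 R0"
  have "AE x in lebesgue. R < norm x \<longrightarrow> - \<epsilon> * norm x powr \<gamma> \<le> u x"
    using Q
  proof eventually_elim
    case (elim x)
    show ?case
    proof
      assume x: "R < norm x"
      then have "P x" "0 < norm x" by (auto intro!: R0 simp: R_def simp del: zero_less_norm_iff)
      then have "- \<epsilon> < u x / norm x powr \<gamma>" "0 < norm x powr \<gamma>" using PQ elim by auto
      then show "- \<epsilon> * norm x powr \<gamma> \<le> u x" by (simp add: field_simps)
    qed
  qed
  moreover have "0 < R" by (simp add: R_def)
  ultimately show thesis using that by blast
qed

theorem theorem1p2:
  fixes u :: "real ^ 'n \<Rightarrow> real" and \<alpha> \<gamma> :: real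
  assumes "0 < \<alpha>" and "\<alpha> < 2"
    and "u \<in> L_space \<alpha>" and "alpha_harmonic \<alpha> u"
    and "0 \<le> \<gamma>" and "\<gamma> \<le> 1" and "\<gamma> < \<alpha>"
    and "ess_liminf_at_infinity (\<lambda>x. u x / norm x powr \<gamma>) \<ge> 0"
  shows "\<exists>C. AE x in lebesgue. u x = C"
proof -
  note \<alpha> = \<open>0 < \<alpha>\<close> \<open>\<alpha> < 2\<close>
  obtain v where v: "weakly_harmonic \<alpha> v" "AE x in lebesgue. u x = v x"
    using alpha_harmonic_weakly_harmonic[OF \<alpha> \<open>alpha_harmonic \<alpha> u\<close>] .
  define A where "A = heat_flow v 1"
  have vA: "AE x in lebesgue. v x = A x"
    unfolding A_def by (rule AE_completion[OF weakly_harmonic_eq_heat_flow[OF \<alpha> v(1)]])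
  have uA: "AE x in lebesgue. u x = A x" using v(2) vA by eventually_elim simp
  have const: "A x = A 0" for x
  proof (rule affine_sublinear_below_constant[OF _ _ \<open>\<gamma> \<le> 1\<close>])
    show "continuous_on UNIV A" unfolding A_def by (rule heat_flow_continuous[OF \<alpha>(1) v(1)])
    show "second_diff A a h = 0" for a h unfolding A_def by (rule heat_flow_affine[OF \<alpha> v(1)])
    fix \<epsilon> :: real assume "0 < \<epsilon>"
    then obtain R where R: "0 < R" "AE x in lebesgue. R < norm x \<longrightarrow> - \<epsilon> * norm x powr \<gamma> \<le> u x"
      using ess_liminf_lower_bound[OF assms(8)] by blast
    have "AE x in lebesgue. R < norm x \<longrightarrow> - \<epsilon> * norm x powr \<gamma> \<le> A x"
      using R(2) uA by eventually_elim simp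
    with R(1) show "\<exists>R>0. AE x in lebesgue. R < norm x \<longrightarrow> - \<epsilon> * norm x powr \<gamma> \<le> A x" by blast
  qed
  have "AE x in lebesgue. u x = A 0" using uA by eventually_elim (metis const)
  then show ?thesis by blast
qed

end
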